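(* (a) For every flat torus $(T^2,g)$ of unit area there exists $C<\infty$ such that $$\|\Psi-P_g(\Psi)\|_{L^1(T^2,g)}\le C\,\|\bar\partial\Psi\|_{L^1(T^2,g)}\qquad\text{for every }\Psi\in\mathcal{Q}(T^2,g).$$ (b) This estimate is not uniform: given any $C<\infty$ there exists a torus $(T^2,g)$ that is flat and has unit area, but for which the estimate in (a) with this constant $C$ is violated (i.e. fails for some $\Psi\in\mathcal{Q}(T^2,g)$).
   Context: A flat metric $g$ on the (oriented) torus $T^2$ determines a compatible complex structure $c$. $\mathcal{Q}(T^2,g)$ is the complex vector space of smooth quadratic differentials on $(T^2,c)$: complex tensors which in each local complex coordinate $z$ have the form $\Psi=\psi\,dz^2$ with $\psi$ a smooth complex-valued function. $\mathcal{H}(T^2,g)\subset\mathcal{Q}(T^2,g)$ is the finite-dimensional subspace of holomorphic quadratic differentials (every local $\psi$ holomorphic). In a local complex coordinate $z=x+iy$ write $g=\rho^2\,dz\,d\bar z=\rho^2(dx^2+dy^2)$ and let $dv_g$ be the area form. The $L^2$ inner product is $$\langle \phi\,dz^2,\psi\,dz^2\rangle_{L^2}=\int\phi\bar\psi\,|dz^2|^2\,dv_g=4\int\phi\bar\psi\,\rho^{-2}\,dx\,dy ,$$ and $P_g:\mathcal{Q}(T^2,g)\to\mathcal{H}(T^2,g)$ is the $L^2(T^2,g)$-orthogonal projection onto $\mathcal{H}(T^2,g)$. The antiholomorphic derivative of $\Psi=\psi\,dz^2$ is the tensor $\bar\partial\Psi=\partial_{\bar z}\psi\,d\bar z\otimes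 dz^2$, where $\partial_{\bar z}=\frac12(\partial_x+i\partial_y)$. Norms are taken with respect to $g$: pointwise $|\psi\,dz^2|=2|\psi|\rho^{-2}$ and $|\partial_{\bar z}\psi\,d\bar z\otimes dz^2|=2\sqrt2\,|\partial_{\bar z}\psi|\,\rho^{-3}$, and $L^1$ norms are the integrals of these pointwise norms against $dv_g$. *)

theory Defs
  imports "HOL-Complex_Analysis.Complex_Analysis"
begin

text \<open>
  The oriented torus is \<open>T\<^sup>2 = \<real>\<^sup>2 / \<int>\<^sup>2\<close>.  Functions and tensor fields on it are represented by their
  \<open>\<int>\<^sup>2\<close>-periodic lifts to \<^typ>\<open>real^2\<close>, which plays the role of a mere oriented smooth manifold; local
  complex coordinates take values in \<^typ>\<open>complex\<close>.
\<close>

fun times_cont_diff_on ::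
    "nat \<Rightarrow> 'a::real_normed_vector set \<Rightarrow> ('a \<Rightarrow> 'b::real_normed_vector) \<Rightarrow> bool" where
  "times_cont_diff_on 0 S f \<longleftrightarrow> continuous_on S f"
| "times_cont_diff_on (Suc n) S f \<longleftrightarrow>
     (\<forall>x\<in>S. f differentiable (at x)) \<and>
     (\<forall>v. times_cont_diff_on n S (\<lambda>x. frechet_derivative f (at x) v))"

text \<open>Only meaningful for open \<open>S\<close>, since unrestricted derivatives are used.\<close>

definition smooth_on :: "'a::real_normed_vector set \<Rightarrow> ('a \<Rightarrow> 'b::real_normed_vector) \<Rightarrow> bool" where
  "smooth_on S f \<longleftrightarrow> (\<forall>n. times_cont_diff_on n S f)"

definition torus_periodic :: "(real^2 \<Rightarrow> 'a) \<Rightarrow> bool" where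
  "torus_periodic f \<longleftrightarrow> (\<forall>p m. (\<forall>i. m $ i \<in> \<int>) \<longrightarrow> f (p + m) = f p)"

type_synonym metric = "real^2 \<Rightarrow> real^2 \<Rightarrow> real^2 \<Rightarrow> real"
type_synonym tensor2 = "real^2 \<Rightarrow> real^2 \<Rightarrow> real^2 \<Rightarrow> complex"
type_synonym tensor3 = "real^2 \<Rightarrow> real^2 \<Rightarrow> real^2 \<Rightarrow> real^2 \<Rightarrow> complex"

definition riemannian_metric :: "metric \<Rightarrow> bool" where
  "riemannian_metric g \<longleftrightarrow>
     torus_periodic g \<and>
     (\<forall>v w. smooth_on UNIV (\<lambda>p. g p v w)) \<and>
     (\<forall>p. bilinear (g p) \<and> (\<forall>v w. g p v w = g p w v) \<and> (\<forall>v. v \<noteq> 0 \<longrightarrow> g p v v > 0))"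

abbreviation dcoord :: "(real^2 \<Rightarrow> complex) \<Rightarrow> real^2 \<Rightarrow> real^2 \<Rightarrow> complex" where
  "dcoord z p v \<equiv> frechet_derivative z (at p) v"

text \<open>
  \<open>z\<close> is a local complex coordinate on \<open>U\<close> for the complex structure determined by \<open>g\<close> and the
  orientation, with \<open>g = \<rho>\<^sup>2 (dx\<^sup>2 + dy\<^sup>2)\<close> on \<open>U\<close>.  The condition on \<open>Im\<close> says that the Jacobian
  determinant of \<open>z\<close> is positive.
\<close>

definition complex_coord ::
    "metric \<Rightarrow> (real^2) set \<Rightarrow> (real^2 \<Rightarrow> complex) \<Rightarrow> (real^2 \<Rightarrow> real) \<Rightarrow> bool" where
  "complex_coord g U z \<rho> \<longleftrightarrow>
     open U \<and> smooth_on U z \<and> inj_on z U \<and>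
     (\<forall>p\<in>U. Im (cnj (dcoord z p (axis 1 1)) * dcoord z p (axis 2 1)) > 0 \<and>
            \<rho> p > 0 \<and>
            (\<forall>v w. g p v w = (\<rho> p)\<^sup>2 * (dcoord z p v \<bullet> dcoord z p w)))"

text \<open>Flat means locally isometric to the Euclidean plane.\<close>

definition flat_metric :: "metric \<Rightarrow> bool" where
  "flat_metric g \<longleftrightarrow>
     riemannian_metric g \<and> (\<forall>p. \<exists>U z. p \<in> U \<and> complex_coord g U z (\<lambda>_. 1))"

definition area_density :: "metric \<Rightarrow> real^2 \<Rightarrow> real" where
  "area_density g p =
     sqrt (g p (axis 1 1) (axis 1 1) * g p (axis 2 1) (axis 2 1) - (g p (axis 1 1) (axis 2 1))\<^sup>2)"

text \<open>The integral over \<open>T\<^sup>2\<close> against \<open>dv\<^sub>g\<close>, computed on the fundamental domain \<open>[0,1]\<^sup>2\<close>.\<close>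

definition torus_integral ::
    "metric \<Rightarrow> (real^2 \<Rightarrow> 'b) \<Rightarrow> 'b::{banach, second_countable_topology}" where
  "torus_integral g f = (LINT p:cbox 0 1|lborel. area_density g p *\<^sub>R f p)"

definition torus_area :: "metric \<Rightarrow> real" where
  "torus_area g = torus_integral g (\<lambda>_. 1)"

text \<open>\<open>\<Psi> = \<psi> dz\<^sup>2\<close> on \<open>U\<close>, where \<open>\<psi>\<close> is regarded as a function of the coordinate.\<close>

definition qd_form ::
    "tensor2 \<Rightarrow> (real^2) set \<Rightarrow> (real^2 \<Rightarrow> complex) \<Rightarrow> (complex \<Rightarrow> complex) \<Rightarrow> bool" where
  "qd_form \<Psi> U z \<psi> \<longleftrightarrow>
     (\<forall>p\<in>U. \<forall>v w. \<Psi> p v w = \<psi> (z p) * dcoord z p v * dcoord z p w)"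

definition quad_diffs :: "metric \<Rightarrow> tensor2 set" where
  "quad_diffs g =
     {\<Psi>. torus_periodic \<Psi> \<and>
          (\<forall>U z \<rho>. complex_coord g U z \<rho> \<longrightarrow> (\<exists>\<psi>. smooth_on (z ` U) \<psi> \<and> qd_form \<Psi> U z \<psi>))}"

definition hol_quad_diffs :: "metric \<Rightarrow> tensor2 set" where
  "hol_quad_diffs g =
     {\<Psi> \<in> quad_diffs g.
        \<forall>U z \<rho> \<psi>. complex_coord g U z \<rho> \<longrightarrow> qd_form \<Psi> U z \<psi> \<longrightarrow> \<psi> holomorphic_on (z ` U)}"

text \<open>
  The pointwise quantities below are given by a formula in a local complex coordinate around \<open>p\<close>
  whose value does not depend on the coordinate; this is what \<open>THE\<close> expresses.
\<close>

definition qd_inner :: "metric \<Rightarrow> tensor2 \<Rightarrow> tensor2 \<Rightarrow> real^2 \<Rightarrow> complex" where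
  "qd_inner g \<Phi> \<Psi> p =
     (THE c. \<exists>U z \<rho> \<phi> \<psi>. complex_coord g U z \<rho> \<and> p \<in> U \<and> qd_form \<Phi> U z \<phi> \<and> qd_form \<Psi> U z \<psi> \<and>
        c = \<phi> (z p) * cnj (\<psi> (z p)) * of_real (4 / (\<rho> p) ^ 4))"

definition L2_inner :: "metric \<Rightarrow> tensor2 \<Rightarrow> tensor2 \<Rightarrow> complex" where
  "L2_inner g \<Phi> \<Psi> = torus_integral g (qd_inner g \<Phi> \<Psi>)"

definition hol_proj :: "metric \<Rightarrow> tensor2 \<Rightarrow> tensor2" where
  "hol_proj g \<Psi> =
     (THE \<Phi>. \<Phi> \<in> hol_quad_diffs g \<and> (\<forall>\<Theta>\<in>hol_quad_diffs g. L2_inner g (\<Psi> - \<Phi>) \<Theta> = 0))"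

definition qd_norm :: "metric \<Rightarrow> tensor2 \<Rightarrow> real^2 \<Rightarrow> real" where
  "qd_norm g \<Psi> p =
     (THE r. \<exists>U z \<rho> \<psi>. complex_coord g U z \<rho> \<and> p \<in> U \<and> qd_form \<Psi> U z \<psi> \<and>
        r = 2 * cmod (\<psi> (z p)) / (\<rho> p)\<^sup>2)"

definition qd_L1_norm :: "metric \<Rightarrow> tensor2 \<Rightarrow> real" where
  "qd_L1_norm g \<Psi> = torus_integral g (qd_norm g \<Psi>)"

definition d_zbar :: "(complex \<Rightarrow> complex) \<Rightarrow> complex \<Rightarrow> complex" where
  "d_zbar \<psi> a =
     (frechet_derivative \<psi> (at a) 1 + \<i> * frechet_derivative \<psi> (at a) \<i>) / 2"

definition dbar :: "metric \<Rightarrow> tensor2 \<Rightarrow> tensor3" where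
  "dbar g \<Psi> p u v w =
     (THE c. \<exists>U z \<rho> \<psi>. complex_coord g U z \<rho> \<and> p \<in> U \<and> qd_form \<Psi> U z \<psi> \<and>
        c = d_zbar \<psi> (z p) * cnj (dcoord z p u) * dcoord z p v * dcoord z p w)"

text \<open>Pointwise norm of a tensor of the form \<open>\<tau> cnj(dz) \<otimes> dz\<^sup>2\<close>.\<close>

definition dbar_type_norm :: "metric \<Rightarrow> tensor3 \<Rightarrow> real^2 \<Rightarrow> real" where
  "dbar_type_norm g T p =
     (THE r. \<exists>U z \<rho> \<tau>. complex_coord g U z \<rho> \<and> p \<in> U \<and>
        (\<forall>u v w. T p u v w = \<tau> * cnj (dcoord z p u) * dcoord z p v * dcoord z p w) \<and>
        r = 2 * sqrt 2 * cmod \<tau> / (\<rho> p) ^ 3)"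

definition dbar_type_L1_norm :: "metric \<Rightarrow> tensor3 \<Rightarrow> real" where
  "dbar_type_L1_norm g T = torus_integral g (dbar_type_norm g T)"

end

theory Submission
  imports Defs
begin

text \<open>
  Uniformization. On a flat torus the local isometries to the complex plane differ by rigid motions,
  because the transition functions are holomorphic with derivative of modulus one. They are glued
  over the universal cover \<open>\<real>\<^sup>2\<close> to a developing map \<open>D\<close> (\<open>developing_map_exists\<close>), for which every
  integer translation corresponds to a rigid motion of the plane. A motion with a rotation part
  would have a fixed point, shared by all the others since they commute; then the distance of \<open>D\<close>
  from that point would be periodic and attain a maximum, although \<open>D\<close> is an open map
  (\<open>developing_map_translations\<close>). So the motions are translations by vectors of a lattice. By
  compactness \<open>D\<close> is a covering of the plane and thus bijective (\<open>developing_map_bijective\<close>), that is, a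
  global coordinate.

  Reduction. In this coordinate a quadratic differential is \<open>\<psi> dz\<^sup>2\<close> with \<open>\<psi>\<close> smooth and periodic
  under the lattice. By Liouville's theorem the holomorphic ones are the constants times \<open>dz\<^sup>2\<close>, and
  the projection is the mean of \<open>\<psi>\<close> (\<open>hol_proj_qd\<close>). Part (a) says that the \<open>L\<^sup>1\<close> norm of a periodic
  function of mean zero is controlled by that of its antiholomorphic derivative \<open>h\<close>.

  Estimate. The average of \<open>\<psi>\<close> over the disc of radius \<open>R\<close> around a point differs from \<open>\<psi>\<close> by at most
  \<open>2 R\<close> times the norm of \<open>h\<close>. The reason is that the radial derivative is the sum of a multiple of \<open>h\<close> and of
  \<open>- \<i>\<close> times the angular derivative, and the integral of the latter over a disc vanishes
  (\<open>disc_average_deviation\<close>). On the other hand, averages over large discs are nearly independent of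
  the center on the scale of the lattice, and their mean is zero, so their norm is \<open>O(1 / R)\<close> times that
  of \<open>\<psi>\<close>. A fixed large \<open>R\<close> allows this term to be absorbed (\<open>L1_estimate\<close>).

  Failure of uniformity. On the thin torus with metric \<open>t\<^sup>2 dx\<^sup>2 + t\<^sup>-\<^sup>2 dy\<^sup>2\<close> the wave \<open>exp (2 \<pi> \<i> y)\<close> has
  modulus one and mean zero, but its derivative is proportional to \<open>t\<close>
  (\<open>wave_violates_estimate\<close>). Part (b) follows as \<open>t\<close> tends to zero.
\<close>

section \<open>Calculus of smooth functions\<close>

lemma times_cont_diff_on_cong:
  assumes "open S" "\<And>x. x \<in> S \<Longrightarrow> f x = g x" "times_cont_diff_on n S f"
  shows "times_cont_diff_on n S g"
  using assms(2,3)
proof (induction n arbitrary: f g)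
  case 0
  then show ?case by (simp cong: continuous_on_cong)
next
  case (Suc n)
  have ev: "\<forall>\<^sub>F y in nhds x. f y = g y" if "x \<in> S" for x
    using eventually_nhds_in_open[OF assms(1) that] by eventually_elim (use Suc.prems in auto)
  have der: "(g has_derivative frechet_derivative f (at x)) (at x)" if "x \<in> S" for x
    using Suc.prems that frechet_derivative_works[of f "at x"]
      has_derivative_transform_within_open[OF _ assms(1) that, of f _ UNIV g] by auto
  then have fd: "frechet_derivative f (at x) = frechet_derivative g (at x)" if "x \<in> S" for x
    using frechet_derivative_at[OF der[OF that]] by simp
  have "times_cont_diff_on n S (\<lambda>x. frechet_derivative g (at x) v)" for v
    by (rule Suc.IH[of "\<lambda>x. frechet_derivative f (at x) v"]) (use Suc.prems fd in auto)
  moreover have "\<forall>x\<in>S. g differentiable (at x)"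
    using differentiableI[OF der] by blast
  ultimately show ?case by simp
qed

lemma times_cont_diff_on_subset:
  "times_cont_diff_on n S f \<Longrightarrow> T \<subseteq> S \<Longrightarrow> times_cont_diff_on n T f"
  by (induction n arbitrary: f) (auto intro: continuous_on_subset)

text \<open>
  Being \<open>C\<^sup>n\<close> is a local property. Charts and developing maps are only known near each point,
  so this is how their smoothness is transported to larger sets.
\<close>

lemma times_cont_diff_on_local:
  assumes "\<And>x. x \<in> S \<Longrightarrow> \<exists>T. open T \<and> x \<in> T \<and> times_cont_diff_on n T f"
  shows "times_cont_diff_on n S f"
  using assms
proof (induction n arbitrary: f)
  case 0
  have "continuous (at x) f" if "x \<in> S" for x
    using 0[OF that] by (auto simp: continuous_on_eq_continuous_at)
  then show ?case by (simp add: continuous_at_imp_continuous_on)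
next
  case (Suc n)
  have "times_cont_diff_on n S (\<lambda>x. frechet_derivative f (at x) v)" for v
    by (rule Suc.IH) (use Suc.prems in \<open>fastforce\<close>)
  then show ?case using Suc.prems by fastforce
qed

lemma times_cont_diff_on_Suc_D:
  assumes "times_cont_diff_on (Suc n) S f" shows "times_cont_diff_on n S f"
  using assms
proof (induction n arbitrary: f)
  case 0
  then show ?case
    by (auto intro!: continuous_at_imp_continuous_on differentiable_imp_continuous_within)
next
  case (Suc n)
  then show ?case by (metis times_cont_diff_on.simps(2))
qed

lemma smooth_on_cong:
  "open S \<Longrightarrow> (\<And>x. x \<in> S \<Longrightarrow> f x = g x) \<Longrightarrow> smooth_on S f \<Longrightarrow> smooth_on S g"
  unfolding smooth_on_def using times_cont_diff_on_cong by blast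

lemma smooth_on_subset: "smooth_on S f \<Longrightarrow> T \<subseteq> S \<Longrightarrow> smooth_on T f"
  unfolding smooth_on_def using times_cont_diff_on_subset by blast

lemma smooth_on_local:
  "(\<And>x. x \<in> S \<Longrightarrow> \<exists>T. open T \<and> x \<in> T \<and> smooth_on T f) \<Longrightarrow> smooth_on S f"
  unfolding smooth_on_def by (meson times_cont_diff_on_local)

lemma smooth_on_differentiable: "smooth_on S f \<Longrightarrow> x \<in> S \<Longrightarrow> f differentiable (at x)"
  unfolding smooth_on_def by (metis times_cont_diff_on.simps(2))

lemma smooth_on_has_derivative:
  "smooth_on S f \<Longrightarrow> x \<in> S \<Longrightarrow> (f has_derivative frechet_derivative f (at x)) (at x)"
  using smooth_on_differentiable frechet_derivative_works by blast

lemma smooth_on_frechet_derivative: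
  "smooth_on S f \<Longrightarrow> smooth_on S (\<lambda>x. frechet_derivative f (at x) v)"
  unfolding smooth_on_def by (metis times_cont_diff_on.simps(2))

lemma smooth_on_continuous: "smooth_on S f \<Longrightarrow> continuous_on S f"
  unfolding smooth_on_def by (metis times_cont_diff_on.simps(1))

lemma times_cont_diff_on_const: "times_cont_diff_on n S (\<lambda>x. c)"
  by (induction n arbitrary: c) (simp_all add: frechet_derivative_const)

lemma times_cont_diff_on_bounded_linear:
  assumes "bounded_linear L" shows "times_cont_diff_on n S L"
proof (cases n)
  case 0
  then show ?thesis using assms by (simp add: linear_continuous_on)
next
  case (Suc m)
  have "frechet_derivative L (at x) = L" for x
    using frechet_derivative_at[OF bounded_linear_imp_has_derivative[OF assms]] by simp
  then show ?thesis
    using assms bounded_linear_imp_differentiable times_cont_diff_on_const by (auto simp: Suc)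
qed

lemma times_cont_diff_on_add:
  assumes "open S" "times_cont_diff_on n S f" "times_cont_diff_on n S g"
  shows "times_cont_diff_on n S (\<lambda>x. f x + g x)"
  using assms(2,3)
proof (induction n arbitrary: f g)
  case 0
  then show ?case by (simp add: continuous_on_add)
next
  case (Suc n)
  have der: "((\<lambda>x. f x + g x) has_derivative
      (\<lambda>v. frechet_derivative f (at x) v + frechet_derivative g (at x) v)) (at x)" if "x \<in> S" for x
    using Suc.prems that by (intro derivative_eq_intros) (auto simp: frechet_derivative_works)
  have "times_cont_diff_on n S (\<lambda>x. frechet_derivative (\<lambda>x. f x + g x) (at x) v)" for v
    by (rule times_cont_diff_on_cong[OF assms(1) _ Suc.IH])
       (use Suc.prems frechet_derivative_at[OF der] in \<open>auto simp: fun_eq_iff\<close>)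
  then show ?case using differentiableI[OF der] by auto
qed

text \<open>
  The summands of the Leibniz rule are again products, of \<open>f\<close> with a derivative of \<open>g\<close> and vice versa,
  so the induction runs over all pairs of functions.
\<close>

lemma times_cont_diff_on_bilinear:
  assumes "open S" "bounded_bilinear B" "times_cont_diff_on n S f" "times_cont_diff_on n S g"
  shows "times_cont_diff_on n S (\<lambda>x. B (f x) (g x))"
  using assms(3,4)
proof (induction n arbitrary: f g)
  case 0
  then show ?case using bounded_bilinear.continuous_on[OF assms(2)] by simp
next
  case (Suc n)
  have der: "((\<lambda>x. B (f x) (g x)) has_derivative
      (\<lambda>v. B (f x) (frechet_derivative g (at x) v) + B (frechet_derivative f (at x) v) (g x))) (at x)"
    if "x \<in> S" for x
    by (rule bounded_bilinear.FDERIV[OF assms(2)]) (use Suc.prems that in \<open>auto simp: frechet_derivative_works\<close>)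
  have "times_cont_diff_on n S (\<lambda>x. B (f x) (frechet_derivative g (at x) v)
       + B (frechet_derivative f (at x) v) (g x))" for v
    using Suc.prems times_cont_diff_on_Suc_D[OF Suc.prems(1)] times_cont_diff_on_Suc_D[OF Suc.prems(2)]
    by (intro times_cont_diff_on_add[OF assms(1)] Suc.IH) auto
  then have "times_cont_diff_on n S (\<lambda>x. frechet_derivative (\<lambda>x. B (f x) (g x)) (at x) v)" for v
    by (rule times_cont_diff_on_cong[OF assms(1), rotated])
       (use frechet_derivative_at[OF der] in \<open>auto simp: fun_eq_iff\<close>)
  then show ?case using differentiableI[OF der] by auto
qed

lemma smooth_on_const: "smooth_on S (\<lambda>x. c)"
  unfolding smooth_on_def using times_cont_diff_on_const by blast

lemma smooth_on_bounded_linear: "bounded_linear L \<Longrightarrow> smooth_on S L"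
  unfolding smooth_on_def using times_cont_diff_on_bounded_linear by blast

lemma smooth_on_add:
  "open S \<Longrightarrow> smooth_on S f \<Longrightarrow> smooth_on S g \<Longrightarrow> smooth_on S (\<lambda>x. f x + g x)"
  unfolding smooth_on_def using times_cont_diff_on_add by blast

lemma smooth_on_mult:
  fixes f g :: "'a::real_normed_vector \<Rightarrow> 'b::real_normed_algebra"
  shows "open S \<Longrightarrow> smooth_on S f \<Longrightarrow> smooth_on S g \<Longrightarrow> smooth_on S (\<lambda>x. f x * g x)"
  unfolding smooth_on_def using times_cont_diff_on_bilinear[OF _ bounded_bilinear_mult] by blast

lemma smooth_on_cnj:
  assumes "open S" "smooth_on S f" shows "smooth_on S (\<lambda>x. cnj (f x))"
proof -
  have "times_cont_diff_on n S f \<Longrightarrow> times_cont_diff_on n S (\<lambda>x. cnj (f x))" for n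
  proof (induction n arbitrary: f)
    case 0
    then show ?case by (simp add: continuous_on_cnj)
  next
    case (Suc n)
    have der: "((\<lambda>x. cnj (f x)) has_derivative (\<lambda>v. cnj (frechet_derivative f (at x) v))) (at x)"
      if "x \<in> S" for x
      by (rule has_derivative_cnj) (use Suc.prems that in \<open>auto simp: frechet_derivative_works\<close>)
    have "times_cont_diff_on n S (\<lambda>x. frechet_derivative (\<lambda>x. cnj (f x)) (at x) v)" for v
      by (rule times_cont_diff_on_cong[OF assms(1) _ Suc.IH[of "\<lambda>x. frechet_derivative f (at x) v"]])
         (use Suc.prems frechet_derivative_at[OF der] in \<open>auto simp: fun_eq_iff\<close>)
    then show ?case using differentiableI[OF der] by auto
  qed
  then show ?thesis using assms unfolding smooth_on_def by blast
qed

lemma smooth_on_shift: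
  assumes "open S" "smooth_on S f" shows "smooth_on ((\<lambda>x. x - m) ` S) (\<lambda>x. f (x + m))"
proof -
  have op: "open ((\<lambda>x. x - m) ` S)"
    using open_translation[OF assms(1), of "-m"] by (simp add: image_def)
  have "times_cont_diff_on n S f \<Longrightarrow> times_cont_diff_on n ((\<lambda>x. x - m) ` S) (\<lambda>x. f (x + m))" for n
  proof (induction n arbitrary: f)
    case 0
    then show ?case by (auto intro!: continuous_on_compose2[of S f] continuous_intros)
  next
    case (Suc n)
    have der: "((\<lambda>x. f (x + m)) has_derivative frechet_derivative f (at (x + m))) (at x)"
      if "x \<in> (\<lambda>x. x - m) ` S" for x
    proof -
      have "(f has_derivative frechet_derivative f (at (x + m))) (at (x + m))"
        using Suc.prems that by (auto simp flip: frechet_derivative_works)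
      then have "(f \<circ> (\<lambda>x. x + m) has_derivative frechet_derivative f (at (x + m)) \<circ> (\<lambda>v. v)) (at x)"
        by (intro diff_chain_at) (auto intro!: derivative_eq_intros)
      then show ?thesis by (simp add: o_def)
    qed
    have "times_cont_diff_on n ((\<lambda>x. x - m) ` S) (\<lambda>x. frechet_derivative (\<lambda>x. f (x + m)) (at x) v)" for v
      by (rule times_cont_diff_on_cong[OF op _ Suc.IH[of "\<lambda>x. frechet_derivative f (at x) v"]])
         (use Suc.prems frechet_derivative_at[OF der] in \<open>auto simp: fun_eq_iff\<close>)
    then show ?case using differentiableI[OF der] by auto
  qed
  then show ?thesis using assms unfolding smooth_on_def by blast
qed

text \<open>
  The real derivative in direction \<open>v\<close> is \<open>f' \<cdot> v\<close>, which is again holomorphic, so the induction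
  on the order of differentiability never leaves the class of holomorphic functions.
\<close>

lemma holomorphic_smooth_on:
  assumes "open S" "f holomorphic_on S" shows "smooth_on S f"
proof -
  have "f holomorphic_on S \<Longrightarrow> times_cont_diff_on n S f" for n
  proof (induction n arbitrary: f)
    case 0
    then show ?case by (simp add: holomorphic_on_imp_continuous_on)
  next
    case (Suc n)
    have der: "(f has_derivative (*) (deriv f x)) (at x)" if "x \<in> S" for x
      using Suc.prems that holomorphic_derivI[OF _ assms(1) that] by (simp add: has_field_derivative_def)
    have "times_cont_diff_on n S (\<lambda>x. frechet_derivative f (at x) v)" for v
      by (rule times_cont_diff_on_cong[OF assms(1) _ Suc.IH[of "\<lambda>x. deriv f x * v"]])
        (use Suc.prems frechet_derivative_at[OF der] assms(1)
          in \<open>auto simp: fun_eq_iff intro!: holomorphic_intros\<close>)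
    then show ?case using differentiableI[OF der] by auto
  qed
  then show ?thesis using assms unfolding smooth_on_def by blast
qed

section \<open>Comparison of complex coordinates\<close>

lemma real2_expand: "v = v $ 1 *\<^sub>R axis 1 1 + v $ 2 *\<^sub>R (axis 2 1 :: real^2)"
  by (simp add: vec_eq_iff forall_2 axis_def)

lemma linear_real2_expand:
  "linear L \<Longrightarrow> L v = v $ 1 *\<^sub>R L (axis 1 1) + v $ 2 *\<^sub>R L (axis 2 1 :: real^2)"
  by (subst real2_expand[of v]) (simp only: linear_add linear_scale)

text \<open>
  Both maps induce the same conformal structure and orientation on \<open>\<real>\<^sup>2\<close>. The inner products of the
  images of the two basis vectors give the real part of \<open>cnj (Z e\<^sub>1) * Z e\<^sub>2\<close>, Lagrange's identity gives
  the square of its imaginary part, and the orientation fixes the sign. Hence \<open>Z e\<^sub>2 / Z e\<^sub>1 = F e\<^sub>2 / F e\<^sub>1\<close>.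
\<close>

lemma conformal_maps_differ_by_factor:
  fixes Z F :: "real^2 \<Rightarrow> complex"
  assumes lin: "linear Z" "linear F" and pos: "\<rho> > 0" "\<sigma> > 0"
    and Z: "Im (cnj (Z (axis 1 1)) * Z (axis 2 1)) > 0"
    and F: "Im (cnj (F (axis 1 1)) * F (axis 2 1)) > 0"
    and eq: "\<And>v w. \<rho>\<^sup>2 * (Z v \<bullet> Z w) = \<sigma>\<^sup>2 * (F v \<bullet> F w)"
  shows "\<exists>\<tau>. cmod \<tau> = \<rho> / \<sigma> \<and> (\<forall>v. F v = \<tau> * Z v)"
proof -
  define a b c d where "a = Z (axis 1 1)" "b = Z (axis 2 1)" "c = F (axis 1 1)" "d = F (axis 2 1)"
  note abcd = this
  have lagr: "(Im (cnj x * y))\<^sup>2 = (cmod x)\<^sup>2 * (cmod y)\<^sup>2 - (x \<bullet> y)\<^sup>2" for x y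
    by (simp add: cmod_power2 inner_complex_def) (simp add: power2_eq_square algebra_simps)
  have n: "\<rho>\<^sup>2 * (cmod (Z v))\<^sup>2 = \<sigma>\<^sup>2 * (cmod (F v))\<^sup>2" for v
    using eq[of v v] by (simp add: dot_square_norm)
  have "(\<rho>\<^sup>2 * Im (cnj a * b))\<^sup>2 = (\<rho>\<^sup>2 * (cmod a)\<^sup>2) * (\<rho>\<^sup>2 * (cmod b)\<^sup>2) - (\<rho>\<^sup>2 * (a \<bullet> b))\<^sup>2"
    unfolding power_mult_distrib lagr by (simp add: algebra_simps power2_eq_square)
  also have "\<dots> = (\<sigma>\<^sup>2 * Im (cnj c * d))\<^sup>2"
    unfolding abcd n eq unfolding power_mult_distrib lagr by (simp add: algebra_simps power2_eq_square)
  finally have im: "\<rho>\<^sup>2 * Im (cnj a * b) = \<sigma>\<^sup>2 * Im (cnj c * d)"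
    using Z F pos unfolding abcd
    by (metis less_eq_real_def mult_pos_pos power2_eq_iff_nonneg zero_less_power)
  have "of_real (\<rho>\<^sup>2) * (cnj a * b) = of_real (\<sigma>\<^sup>2) * (cnj c * d)"
    using im eq[of "axis 1 1" "axis 2 1"]
    by (auto simp: complex_eq_iff inner_complex_def simp flip: abcd)
  moreover have "of_real (\<rho>\<^sup>2) * (a * cnj a) = of_real (\<sigma>\<^sup>2) * (c * cnj c)"
    using n[of "axis 1 1"] unfolding abcd complex_norm_square[symmetric]
    by (metis of_real_mult of_real_power)
  moreover have ac: "a \<noteq> 0" "c \<noteq> 0"
    using Z F by (auto simp flip: abcd)
  ultimately have "d * (of_real (\<sigma>\<^sup>2) * cnj c) * a = c * b * (of_real (\<sigma>\<^sup>2) * cnj c)"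
    by algebra
  then have dc: "d = c / a * b"
    using ac pos by (simp add: field_simps)
  have "F v = (c / a) * Z v" for v
    using ac dc unfolding linear_real2_expand[OF lin(1), of v] linear_real2_expand[OF lin(2), of v]
    by (simp add: scaleR_conv_of_real field_simps flip: abcd)
  moreover have "cmod (c / a) = \<rho> / \<sigma>"
  proof -
    have "(\<rho> * cmod a)\<^sup>2 = (\<sigma> * cmod c)\<^sup>2"
      using n[of "axis 1 1"] by (simp add: power_mult_distrib flip: abcd)
    then have "\<rho> * cmod a = \<sigma> * cmod c"
      using pos by (simp add: power2_eq_iff_nonneg)
    then show ?thesis using ac pos by (simp add: norm_divide field_simps)
  qed
  ultimately show ?thesis by blast
qed

lemma complex_coord_linear: "complex_coord g U z \<rho> \<Longrightarrow> p \<in> U \<Longrightarrow> linear (dcoord z p)"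
  unfolding complex_coord_def
  using smooth_on_has_derivative has_derivative_linear by blast

lemma complex_coord_has_derivative:
  "complex_coord g U z \<rho> \<Longrightarrow> p \<in> U \<Longrightarrow> (z has_derivative dcoord z p) (at p)"
  unfolding complex_coord_def using smooth_on_has_derivative by blast

lemma complex_coord_continuous: "complex_coord g U z \<rho> \<Longrightarrow> continuous_on U z"
  unfolding complex_coord_def using smooth_on_continuous by blast

lemma complex_coord_open_image: "complex_coord g U z \<rho> \<Longrightarrow> open (z ` U)"
  by (rule invariance_of_domain_gen)
    (auto simp: complex_coord_def smooth_on_continuous)

lemma transition_factor:
  assumes "complex_coord g U z \<rho>" "complex_coord g V f \<sigma>" "p \<in> U" "p \<in> V"
  shows "\<exists>\<tau>. cmod \<tau> = \<rho> p / \<sigma> p \<and> (\<forall>v. dcoord f p v = \<tau> * dcoord z p v)"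
proof (rule conformal_maps_differ_by_factor)
  show "(\<rho> p)\<^sup>2 * (dcoord z p v \<bullet> dcoord z p w) = (\<sigma> p)\<^sup>2 * (dcoord f p v \<bullet> dcoord f p w)" for v w
    using assms unfolding complex_coord_def by metis
qed (use assms complex_coord_linear in \<open>auto simp: complex_coord_def\<close>)

lemma dcoord_axis_nonzero: "complex_coord g U z \<rho> \<Longrightarrow> p \<in> U \<Longrightarrow> dcoord z p (axis 1 1) \<noteq> 0"
  unfolding complex_coord_def by force

text \<open>
  A map whose real derivative is a complex multiple of that of a chart becomes complex differentiable
  when it is read in the chart. Invariance of domain makes the inverse of the chart continuous, so that
  the inverse is differentiable with the inverse derivative.
\<close>

lemma has_field_derivative_in_coord:
  assumes cc: "complex_coord g U z \<rho>" and p: "p \<in> U"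
    and f: "(f has_derivative f') (at p)" and f': "\<And>v. f' v = \<tau> * dcoord z p v"
  shows "((\<lambda>w. f (inv_into U z w)) has_field_derivative \<tau>) (at (z p))"
proof -
  define a b where "a = dcoord z p (axis 1 1)" "b = dcoord z p (axis 2 1)"
  define J where "J = Im (cnj a * b)"
  \<comment> \<open>The inverse of the derivative of the chart, by Cramer's rule.\<close>
  define G :: "complex \<Rightarrow> real^2" where
    "G w = (- Im (cnj b * w) / J) *\<^sub>R axis 1 1 + (Im (cnj a * w) / J) *\<^sub>R axis 2 1" for w
  have J: "J > 0" using cc p by (auto simp: complex_coord_def J_def a_b_def)
  have inj: "inj_on z U" and op: "open U" and cont: "continuous_on U z"
    using cc complex_coord_continuous by (auto simp: complex_coord_def)
  have zexp: "dcoord z p v = v $ 1 *\<^sub>R a + v $ 2 *\<^sub>R b" for v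
    using linear_real2_expand[OF complex_coord_linear[OF cc p], of v] by (simp add: a_b_def)
  have G1: "G w $ 1 = - Im (cnj b * w) / J" and G2: "G w $ 2 = Im (cnj a * w) / J" for w
    by (simp_all add: G_def axis_def)
  have zG: "dcoord z p (G w) = w" for w
  proof -
    have "of_real J * (dcoord z p (G w)) = of_real J * w"
      using J unfolding zexp G1 G2
      by (simp add: complex_eq_iff field_simps) (simp add: J_def algebra_simps)
    then show ?thesis using J by simp
  qed
  have Gz: "G (dcoord z p v) = v" for v
  proof -
    have "J * G (dcoord z p v) $ 1 = J * v $ 1" "J * G (dcoord z p v) $ 2 = J * v $ 2"
      using J unfolding zexp G1 G2 times_divide_eq_right nonzero_mult_div_cancel_left[OF less_imp_neq[OF J, symmetric]]
      by (simp_all add: J_def algebra_simps)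
    then show ?thesis using J by (simp add: vec_eq_iff forall_2)
  qed
  have blG: "bounded_linear G"
    unfolding G_def by (intro linear_linear[THEN iffD2] linearI)
      (simp_all add: algebra_simps add_divide_distrib diff_divide_distrib scaleR_add_left)
  have "(inv_into U z has_derivative G) (at (z p))"
  proof (rule has_derivative_inverse_basic)
    show "(z has_derivative dcoord z p) (at (inv_into U z (z p)))"
      using complex_coord_has_derivative[OF cc p] inj p by simp
    show "G \<circ> dcoord z p = id" using Gz by auto
    show "continuous (at (z p)) (inv_into U z)"
      using continuous_on_inverse_open[OF op cont, of "inv_into U z"] inj p
        complex_coord_open_image[OF cc] continuous_on_eq_continuous_at by auto
    show "open (z ` U)" by (rule complex_coord_open_image[OF cc])
  qed (use p blG inj in \<open>auto simp: f_inv_into_f\<close>)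
  then have "(f \<circ> inv_into U z has_derivative f' \<circ> G) (at (z p))"
    by (rule diff_chain_at) (use f inj p in simp)
  moreover have "f' \<circ> G = (*) \<tau>" using f' zG by auto
  ultimately show ?thesis by (simp add: has_field_derivative_def o_def)
qed

section \<open>Quadratic differentials in a global coordinate\<close>

text \<open>
  Writing \<open>L v = \<alpha> v + \<beta> cnj v\<close>, the complex linear part cancels in \<open>L v + \<i> L (\<i> v)\<close>, and \<open>\<beta>\<close> is
  the antiholomorphic derivative.
\<close>

lemma d_zbar_real_linear:
  assumes "(\<psi> has_derivative L) (at a)"
  shows "L v + \<i> * L (\<i> * v) = 2 * d_zbar \<psi> a * cnj v"
proof -
  have fd: "frechet_derivative \<psi> (at a) = L" using frechet_derivative_at[OF assms] by simp
  interpret L: bounded_linear L using assms by (rule has_derivative_bounded_linear)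
  have exp: "L u = Re u *\<^sub>R L 1 + Im u *\<^sub>R L \<i>" for u
  proof -
    have "u = Re u *\<^sub>R 1 + Im u *\<^sub>R \<i>" by (simp add: complex_eq_iff)
    then have "L u = L (Re u *\<^sub>R 1 + Im u *\<^sub>R \<i>)" by simp
    then show ?thesis by (simp only: L.add L.scaleR)
  qed
  show ?thesis
    unfolding exp[of v] exp[of "\<i> * v"] d_zbar_def fd
    by (simp add: complex_eq_iff scaleR_conv_of_real algebra_simps)
qed

lemma d_zbar_eqI:
  assumes "(\<psi> has_derivative L) (at a)" "L 1 + \<i> * L \<i> = 2 * c"
  shows "d_zbar \<psi> a = c"
  using d_zbar_real_linear[OF assms(1), of 1] assms(2) by simp

text \<open>
  Only \<open>\<psi>\<close> contributes, since \<open>S\<close> and \<open>T\<close> are complex differentiable. For the coefficients of a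
  quadratic differential in two coordinates the factor is \<open>T = (S')\<^sup>2\<close>.
\<close>

lemma d_zbar_pullback:
  assumes \<psi>: "\<psi> differentiable (at (S w))"
    and S: "(S has_field_derivative s) (at w)" and T: "(T has_field_derivative t) (at w)"
    and op: "open X" "w \<in> X" and \<phi>: "\<And>x. x \<in> X \<Longrightarrow> \<phi> x = \<psi> (S x) * T x"
  shows "d_zbar \<phi> w = d_zbar \<psi> (S w) * cnj s * T w"
proof -
  obtain L where L: "(\<psi> has_derivative L) (at (S w))" using \<psi> unfolding differentiable_def by blast
  have "(\<psi> \<circ> S has_derivative L \<circ> (*) s) (at w)"
    by (rule diff_chain_at) (use S L in \<open>auto simp: has_field_derivative_def\<close>)
  then have "((\<lambda>x. \<psi> (S x) * T x) has_derivative (\<lambda>v. \<psi> (S w) * (t * v) + L (s * v) * T w)) (at w)"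
    using T by (intro has_derivative_mult) (auto simp: has_field_derivative_def o_def)
  then have der: "(\<phi> has_derivative (\<lambda>v. \<psi> (S w) * (t * v) + L (s * v) * T w)) (at w)"
    by (rule has_derivative_transform_within_open[OF _ op]) (use \<phi> in simp)
  have "\<psi> (S w) * (t * 1) + L (s * 1) * T w + \<i> * (\<psi> (S w) * (t * \<i>) + L (s * \<i>) * T w)
    = (L s + \<i> * L (\<i> * s)) * T w"
    by (simp add: algebra_simps)
  also have "\<dots> = 2 * (d_zbar \<psi> (S w) * cnj s * T w)"
    by (simp add: d_zbar_real_linear[OF L] mult_ac)
  finally show ?thesis by (rule d_zbar_eqI[OF der])
qed

lemma fractional_part:
  obtains m :: "real^2" where "\<forall>i. m $ i \<in> \<int>" "\<forall>i. 0 \<le> (p - m) $ i \<and> (p - m) $ i < (1::real)"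
  by (rule that[of "\<chi> i. of_int \<lfloor>p $ i\<rfloor>"]) (auto, linarith)

text \<open>
  A flat torus of unit area together with a global isometric coordinate \<open>D\<close> on its universal cover,
  in which the deck transformations are the translations by the lattice vectors \<open>b m\<close>. Every flat torus
  of unit area arises in this way. Inside the locale all tensors are expressed in the single
  coordinate \<open>D\<close>.
\<close>

locale uniformized_torus =
  fixes g :: metric and D :: "real^2 \<Rightarrow> complex" and b :: "real^2 \<Rightarrow> complex"
  assumes chart: "complex_coord g UNIV D (\<lambda>_. 1)"
    and equivariant: "\<And>p m. (\<forall>i. m $ i \<in> \<int>) \<Longrightarrow> D (p + m) = D p + b m"
    and surj: "surj D"
    and unit_area: "torus_area g = 1"
begin

text \<open>
  The quadratic differential \<open>\<psi> dz\<^sup>2\<close>, where \<open>z\<close> is the global coordinate \<open>D\<close>.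
\<close>

definition qd :: "(complex \<Rightarrow> complex) \<Rightarrow> tensor2" where
  "qd \<psi> = (\<lambda>p v w. \<psi> (D p) * dcoord D p v * dcoord D p w)"

definition lattice_periodic :: "(complex \<Rightarrow> 'a) \<Rightarrow> bool" where
  "lattice_periodic \<psi> \<longleftrightarrow> (\<forall>w m. (\<forall>i. m $ i \<in> \<int>) \<longrightarrow> \<psi> (w + b m) = \<psi> w)"

abbreviation D_in :: "(real^2) set \<Rightarrow> (real^2 \<Rightarrow> complex) \<Rightarrow> complex \<Rightarrow> complex" where
  "D_in U z \<equiv> \<lambda>w. D (inv_into U z w)"

text \<open>
  Reading \<open>D\<close> in an arbitrary chart \<open>z\<close> gives a holomorphic function whose derivative has modulus \<open>\<rho>\<close>.
  All comparisons between \<open>D\<close> and other charts go through this function.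
\<close>

lemma D_in_derivative:
  assumes "complex_coord g U z \<rho>" "p \<in> U"
  shows "(D_in U z has_field_derivative deriv (D_in U z) (z p)) (at (z p))"
    and "cmod (deriv (D_in U z) (z p)) = \<rho> p"
    and "dcoord D p v = deriv (D_in U z) (z p) * dcoord z p v"
proof -
  obtain \<tau> where \<tau>: "cmod \<tau> = \<rho> p" "\<And>v. dcoord D p v = \<tau> * dcoord z p v"
    using transition_factor[OF assms(1) chart assms(2)] by auto
  have *: "(D_in U z has_field_derivative \<tau>) (at (z p))"
    by (rule has_field_derivative_in_coord[OF assms complex_coord_has_derivative[OF chart] \<tau>(2)]) auto
  then have "deriv (D_in U z) (z p) = \<tau>" by (rule DERIV_imp_deriv)
  then show "(D_in U z has_field_derivative deriv (D_in U z) (z p)) (at (z p))"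
    "cmod (deriv (D_in U z) (z p)) = \<rho> p"
    "dcoord D p v = deriv (D_in U z) (z p) * dcoord z p v"
    using * \<tau> by auto
qed

lemma D_in_holomorphic:
  assumes "complex_coord g U z \<rho>" shows "D_in U z holomorphic_on z ` U"
  using D_in_derivative(1)[OF assms] complex_coord_open_image[OF assms]
  by (auto simp: holomorphic_on_open)

lemma D_in_simp: "complex_coord g U z \<rho> \<Longrightarrow> p \<in> U \<Longrightarrow> D_in U z (z p) = D p"
  by (simp add: complex_coord_def)

lemma qd_form_iff:
  assumes "complex_coord g U z \<rho>"
  shows "qd_form (qd \<psi>) U z \<phi> \<longleftrightarrow> (\<forall>p\<in>U. \<phi> (z p) = \<psi> (D p) * (deriv (D_in U z) (z p))\<^sup>2)"
proof
  assume *: "qd_form (qd \<psi>) U z \<phi>"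
  show "\<forall>p\<in>U. \<phi> (z p) = \<psi> (D p) * (deriv (D_in U z) (z p))\<^sup>2"
  proof
    fix p assume p: "p \<in> U"
    have "\<phi> (z p) * dcoord z p (axis 1 1) * dcoord z p (axis 1 1) =
      \<psi> (D p) * (deriv (D_in U z) (z p) * dcoord z p (axis 1 1)) * (deriv (D_in U z) (z p) * dcoord z p (axis 1 1))"
      using * p D_in_derivative(3)[OF assms p] unfolding qd_form_def qd_def by metis
    then show "\<phi> (z p) = \<psi> (D p) * (deriv (D_in U z) (z p))\<^sup>2"
      using dcoord_axis_nonzero[OF assms p] by (simp add: power2_eq_square field_simps)
  qed
next
  assume "\<forall>p\<in>U. \<phi> (z p) = \<psi> (D p) * (deriv (D_in U z) (z p))\<^sup>2"
  then show "qd_form (qd \<psi>) U z \<phi>"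
    unfolding qd_form_def qd_def
    by (auto simp: D_in_derivative(3)[OF assms] power2_eq_square)
qed

lemma qd_form_D: "qd_form (qd \<psi>) UNIV D \<psi>"
  by (simp add: qd_form_def qd_def)

text \<open>
  The definite description is met by the chart \<open>D\<close>. In any other chart the coefficient is multiplied by
  a square of modulus \<open>\<rho>\<^sup>2\<close>, which the weight \<open>\<rho>\<^sup>-\<^sup>2\<close> compensates. The next three lemmas follow the same
  pattern.
\<close>

lemma qd_norm_qd: "qd_norm g (qd \<psi>) p = 2 * cmod (\<psi> (D p))"
  unfolding qd_norm_def
proof (rule the_equality)
  show "\<exists>U z \<rho> \<phi>. complex_coord g U z \<rho> \<and> p \<in> U \<and> qd_form (qd \<psi>) U z \<phi> \<and>
      2 * cmod (\<psi> (D p)) = 2 * cmod (\<phi> (z p)) / (\<rho> p)\<^sup>2"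
    by (rule exI[of _ UNIV], rule exI[of _ D], rule exI[of _ "\<lambda>_. 1"], rule exI[of _ \<psi>])
      (use chart qd_form_D in auto)
next
  fix r assume "\<exists>U z \<rho> \<phi>. complex_coord g U z \<rho> \<and> p \<in> U \<and> qd_form (qd \<psi>) U z \<phi> \<and>
      r = 2 * cmod (\<phi> (z p)) / (\<rho> p)\<^sup>2"
  then obtain U z \<rho> \<phi> where *: "complex_coord g U z \<rho>" "p \<in> U" "qd_form (qd \<psi>) U z \<phi>"
    "r = 2 * cmod (\<phi> (z p)) / (\<rho> p)\<^sup>2" by blast
  have "\<rho> p > 0" using * by (auto simp: complex_coord_def)
  then show "r = 2 * cmod (\<psi> (D p))"
    using * qd_form_iff[OF *(1)] D_in_derivative(2)[OF *(1,2)] by (simp add: norm_mult norm_power)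
qed

lemma qd_inner_qd: "qd_inner g (qd \<phi>) (qd \<psi>) p = 4 * (\<phi> (D p) * cnj (\<psi> (D p)))"
  unfolding qd_inner_def
proof (rule the_equality)
  show "\<exists>U z \<rho> \<phi>' \<psi>'. complex_coord g U z \<rho> \<and> p \<in> U \<and> qd_form (qd \<phi>) U z \<phi>' \<and> qd_form (qd \<psi>) U z \<psi>' \<and>
      4 * (\<phi> (D p) * cnj (\<psi> (D p))) = \<phi>' (z p) * cnj (\<psi>' (z p)) * of_real (4 / (\<rho> p) ^ 4)"
    by (rule exI[of _ UNIV], rule exI[of _ D], rule exI[of _ "\<lambda>_. 1"], rule exI[of _ \<phi>], rule exI[of _ \<psi>])
      (use chart qd_form_D in auto)
next
  fix c assume "\<exists>U z \<rho> \<phi>' \<psi>'. complex_coord g U z \<rho> \<and> p \<in> U \<and> qd_form (qd \<phi>) U z \<phi>' \<and> qd_form (qd \<psi>) U z \<psi>' \<and>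
      c = \<phi>' (z p) * cnj (\<psi>' (z p)) * of_real (4 / (\<rho> p) ^ 4)"
  then obtain U z \<rho> \<phi>' \<psi>' where *: "complex_coord g U z \<rho>" "p \<in> U" "qd_form (qd \<phi>) U z \<phi>'"
    "qd_form (qd \<psi>) U z \<psi>'" "c = \<phi>' (z p) * cnj (\<psi>' (z p)) * of_real (4 / (\<rho> p) ^ 4)" by blast
  define t where "t = deriv (D_in U z) (z p)"
  have \<rho>: "\<rho> p > 0" using * by (auto simp: complex_coord_def)
  have "t * cnj t = of_real ((\<rho> p)\<^sup>2)"
    using D_in_derivative(2)[OF *(1,2)] by (simp add: t_def complex_norm_square[symmetric] flip: of_real_power)
  then have "t\<^sup>2 * cnj (t\<^sup>2) = of_real ((\<rho> p) ^ 4)"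
    by (metis (no_types, opaque_lifting) complex_cnj_power mult_2 numeral_Bit0 of_real_power power_add
        power_mult_distrib power2_eq_square)
  moreover have "\<phi>' (z p) * cnj (\<psi>' (z p)) = \<phi> (D p) * cnj (\<psi> (D p)) * (t\<^sup>2 * cnj (t\<^sup>2))"
    using * qd_form_iff[OF *(1)] by (simp add: t_def mult_ac)
  ultimately show "c = 4 * (\<phi> (D p) * cnj (\<psi> (D p)))"
    using * \<rho> by simp
qed

lemma dbar_qd:
  assumes \<psi>: "\<psi> differentiable (at (D p))"
  shows "dbar g (qd \<psi>) p u v w = d_zbar \<psi> (D p) * cnj (dcoord D p u) * dcoord D p v * dcoord D p w"
  unfolding dbar_def
proof (rule the_equality)
  show "\<exists>U z \<rho> \<phi>. complex_coord g U z \<rho> \<and> p \<in> U \<and> qd_form (qd \<psi>) U z \<phi> \<and>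
      d_zbar \<psi> (D p) * cnj (dcoord D p u) * dcoord D p v * dcoord D p w =
      d_zbar \<phi> (z p) * cnj (dcoord z p u) * dcoord z p v * dcoord z p w"
    by (rule exI[of _ UNIV], rule exI[of _ D], rule exI[of _ "\<lambda>_. 1"], rule exI[of _ \<psi>])
      (use chart qd_form_D in auto)
next
  fix c assume "\<exists>U z \<rho> \<phi>. complex_coord g U z \<rho> \<and> p \<in> U \<and> qd_form (qd \<psi>) U z \<phi> \<and>
      c = d_zbar \<phi> (z p) * cnj (dcoord z p u) * dcoord z p v * dcoord z p w"
  then obtain U z \<rho> \<phi> where *: "complex_coord g U z \<rho>" "p \<in> U" "qd_form (qd \<psi>) U z \<phi>"
    "c = d_zbar \<phi> (z p) * cnj (dcoord z p u) * dcoord z p v * dcoord z p w" by blast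
  define S where "S = D_in U z"
  have op: "open (z ` U)" by (rule complex_coord_open_image[OF *(1)])
  have Sp: "S (z p) = D p" using D_in_simp[OF *(1,2)] by (simp add: S_def)
  have hol: "(\<lambda>w. (deriv S w)\<^sup>2) holomorphic_on z ` U"
    unfolding S_def using D_in_holomorphic[OF *(1)] op by (intro holomorphic_intros)
  have "d_zbar \<phi> (z p) = d_zbar \<psi> (S (z p)) * cnj (deriv S (z p)) * (deriv S (z p))\<^sup>2"
  proof (rule d_zbar_pullback[OF _ _ _ op])
    show "(S has_field_derivative deriv S (z p)) (at (z p))"
      using D_in_derivative(1)[OF *(1,2)] by (simp add: S_def)
    show "((\<lambda>w. (deriv S w)\<^sup>2) has_field_derivative deriv (\<lambda>w. (deriv S w)\<^sup>2) (z p)) (at (z p))"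
      using holomorphic_derivI[OF hol op] * by blast
    show "\<phi> x = \<psi> (S x) * (deriv S x)\<^sup>2" if "x \<in> z ` U" for x
      using that *(3) D_in_simp[OF *(1)] unfolding qd_form_iff[OF *(1)] by (auto simp: S_def)
  qed (use \<psi> Sp * in auto)
  then show "c = d_zbar \<psi> (D p) * cnj (dcoord D p u) * dcoord D p v * dcoord D p w"
    unfolding D_in_derivative(3)[OF *(1,2)] *(4) Sp by (simp add: S_def power2_eq_square mult_ac)
qed

lemma dbar_type_norm_qd:
  assumes \<psi>: "\<psi> differentiable (at (D p))"
  shows "dbar_type_norm g (dbar g (qd \<psi>)) p = 2 * sqrt 2 * cmod (d_zbar \<psi> (D p))"
  unfolding dbar_type_norm_def
proof (rule the_equality)
  show "\<exists>U z \<rho> \<tau>. complex_coord g U z \<rho> \<and> p \<in> U \<and>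
    (\<forall>u v w. dbar g (qd \<psi>) p u v w = \<tau> * cnj (dcoord z p u) * dcoord z p v * dcoord z p w) \<and>
    2 * sqrt 2 * cmod (d_zbar \<psi> (D p)) = 2 * sqrt 2 * cmod \<tau> / (\<rho> p) ^ 3"
    by (rule exI[of _ UNIV], rule exI[of _ D], rule exI[of _ "\<lambda>_. 1"], rule exI[of _ "d_zbar \<psi> (D p)"])
      (use chart dbar_qd[of \<psi> p, OF assms] in auto)
next
  fix r assume "\<exists>U z \<rho> \<tau>. complex_coord g U z \<rho> \<and> p \<in> U \<and>
    (\<forall>u v w. dbar g (qd \<psi>) p u v w = \<tau> * cnj (dcoord z p u) * dcoord z p v * dcoord z p w) \<and>
    r = 2 * sqrt 2 * cmod \<tau> / (\<rho> p) ^ 3"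
  then obtain U z \<rho> \<tau> where *: "complex_coord g U z \<rho>" "p \<in> U"
    "\<And>u v w. dbar g (qd \<psi>) p u v w = \<tau> * cnj (dcoord z p u) * dcoord z p v * dcoord z p w"
    "r = 2 * sqrt 2 * cmod \<tau> / (\<rho> p) ^ 3" by blast
  have \<rho>: "\<rho> p > 0" using * by (auto simp: complex_coord_def)
  define e where "e = dcoord z p (axis 1 1)"
  have e: "e \<noteq> 0" using dcoord_axis_nonzero[OF *(1,2)] by (simp add: e_def)
  have "cmod (\<tau> * cnj e * e * e) = cmod (d_zbar \<psi> (D p) * cnj (deriv (D_in U z) (z p) * e)
     * (deriv (D_in U z) (z p) * e) * (deriv (D_in U z) (z p) * e))"
    using *(3)[of "axis 1 1" "axis 1 1" "axis 1 1"] dbar_qd[of \<psi> p "axis 1 1" "axis 1 1" "axis 1 1", OF assms]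
    unfolding D_in_derivative(3)[OF *(1,2)] unfolding e_def by metis
  then have "cmod \<tau> = cmod (d_zbar \<psi> (D p)) * (\<rho> p) ^ 3"
    using e D_in_derivative(2)[OF *(1,2)] by (simp add: norm_mult power3_eq_cube)
  then show "r = 2 * sqrt 2 * cmod (d_zbar \<psi> (D p))"
    using * \<rho> by simp
qed

lemma D_has_derivative: "(D has_derivative dcoord D p) (at p)"
  using complex_coord_has_derivative[OF chart] by simp

lemma continuous_D: "continuous_on S D"
  using complex_coord_continuous[OF chart] continuous_on_subset by blast

lemma continuous_dcoord_D: "continuous_on S (\<lambda>p. dcoord D p v)"
  using chart smooth_on_continuous[OF smooth_on_frechet_derivative] continuous_on_subset
  by (metis complex_coord_def subset_UNIV)

lemma dcoord_D_periodic:
  fixes m :: "real^2"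
  assumes "\<forall>i. m $ i \<in> \<int>" shows "dcoord D (p + m) = dcoord D p"
proof -
  have "((\<lambda>q. D (q + m)) has_derivative dcoord D (p + m)) (at p)"
    by (rule has_derivative_compose[of "\<lambda>q. q + m" "\<lambda>v. v" p UNIV D, simplified])
       (auto intro!: derivative_eq_intros D_has_derivative)
  moreover have "((\<lambda>q. D (q + m)) has_derivative dcoord D p) (at p)"
    unfolding equivariant[OF assms] by (auto intro!: derivative_eq_intros D_has_derivative)
  ultimately show ?thesis by (rule has_derivative_unique)
qed

lemma torus_periodic_qd:
  assumes "lattice_periodic \<psi>" shows "torus_periodic (qd \<psi>)"
  using assms by (auto simp: torus_periodic_def qd_def dcoord_D_periodic equivariant lattice_periodic_def)

text \<open>
  \<open>D\<close> is itself a chart, so the coefficient of \<open>\<Psi>\<close> is a smooth function on the whole complex plane, and the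
  periodicity of the tensor becomes invariance of the coefficient under the lattice.
\<close>

lemma quad_diffs_obtain:
  assumes "\<Psi> \<in> quad_diffs g"
  obtains \<psi> where "smooth_on UNIV \<psi>" "lattice_periodic \<psi>" "\<Psi> = qd \<psi>"
proof -
  obtain \<psi> where \<psi>: "smooth_on UNIV \<psi>" "qd_form \<Psi> UNIV D \<psi>"
  proof -
    have "\<exists>\<psi>. smooth_on (D ` UNIV) \<psi> \<and> qd_form \<Psi> UNIV D \<psi>"
      using assms chart unfolding quad_diffs_def by blast
    then show thesis using that surj by auto
  qed
  have eq: "\<Psi> = qd \<psi>"
    using \<psi>(2) by (auto simp: qd_form_def qd_def fun_eq_iff)
  have "\<psi> (D p + b m) = \<psi> (D p)" if m: "\<forall>i. m $ i \<in> \<int>" for p and m :: "real^2"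
  proof -
    have "\<Psi> (p + m) = \<Psi> p" using assms m by (simp add: quad_diffs_def torus_periodic_def)
    then have "\<psi> (D (p + m)) * dcoord D p (axis 1 1) * dcoord D p (axis 1 1) =
      \<psi> (D p) * dcoord D p (axis 1 1) * dcoord D p (axis 1 1)"
      unfolding eq qd_def dcoord_D_periodic[OF m] by metis
    then show ?thesis
      using dcoord_axis_nonzero[OF chart, of p] equivariant[OF m] by simp
  qed
  then have "lattice_periodic \<psi>"
    unfolding lattice_periodic_def using surj by (metis surjD)
  then show ?thesis using that \<psi> eq by blast
qed

text \<open>
  Coefficients of the form \<open>F * cnj G\<close> with entire \<open>F\<close> and \<open>G\<close> cover both the constants and the plane
  waves of the counterexample, and for them smoothness in an arbitrary chart needs nothing beyond
  products and conjugates of holomorphic functions.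
\<close>

lemma qd_in_quad_diffs:
  assumes F: "F holomorphic_on UNIV" and G: "G holomorphic_on UNIV"
    and per: "lattice_periodic (\<lambda>w. F w * cnj (G w))"
  shows "qd (\<lambda>w. F w * cnj (G w)) \<in> quad_diffs g"
  unfolding quad_diffs_def
proof (intro CollectI conjI torus_periodic_qd[OF per] allI impI)
  fix U z \<rho> assume cc: "complex_coord g U z \<rho>"
  have op: "open (z ` U)" by (rule complex_coord_open_image[OF cc])
  define S where "S = D_in U z"
  have S: "S holomorphic_on z ` U" using D_in_holomorphic[OF cc] by (simp add: S_def)
  have comp: "(\<lambda>w. H (S w)) holomorphic_on z ` U" if "H holomorphic_on UNIV" for H
    using holomorphic_on_compose_gen[OF S that] by (simp add: o_def)
  have "smooth_on (z ` U) (\<lambda>w. F (S w) * cnj (G (S w)) * (deriv S w)\<^sup>2)"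
    by (intro smooth_on_mult smooth_on_cnj holomorphic_smooth_on op comp F G
        holomorphic_on_power holomorphic_deriv S)
  moreover have "qd_form (qd (\<lambda>w. F w * cnj (G w))) U z (\<lambda>w. F (S w) * cnj (G (S w)) * (deriv S w)\<^sup>2)"
    using D_in_simp[OF cc] unfolding qd_form_iff[OF cc] by (simp add: S_def)
  ultimately show "\<exists>\<psi>. smooth_on (z ` U) \<psi> \<and> qd_form (qd (\<lambda>w. F w * cnj (G w))) U z \<psi>" by blast
qed

lemma lattice_periodic_range:
  assumes "lattice_periodic \<psi>" shows "range \<psi> \<subseteq> (\<lambda>p. \<psi> (D p)) ` cbox 0 1"
proof
  fix y assume "y \<in> range \<psi>"
  then obtain p where p: "y = \<psi> (D p)" using surj by (metis imageE surjD)
  obtain m :: "real^2" where m: "\<forall>i. m $ i \<in> \<int>" "\<forall>i. 0 \<le> (p - m) $ i \<and> (p - m) $ i < 1"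
    using fractional_part by blast
  have "\<psi> (D (p - m + m)) = \<psi> (D (p - m))"
    using assms m(1) equivariant[OF m(1), of "p - m"] unfolding lattice_periodic_def by simp
  then have "y = \<psi> (D (p - m))" using p by simp
  moreover have "p - m \<in> cbox 0 1" using m(2) by (auto simp: mem_box_cart less_imp_le)
  ultimately show "y \<in> (\<lambda>p. \<psi> (D p)) ` cbox 0 1" by blast
qed

lemma lattice_periodic_bounded:
  fixes \<psi> :: "complex \<Rightarrow> 'a::metric_space"
  assumes "lattice_periodic \<psi>" "continuous_on UNIV \<psi>" shows "bounded (range \<psi>)"
proof -
  have "compact ((\<lambda>p. \<psi> (D p)) ` cbox 0 1)"
    by (intro compact_continuous_image continuous_on_compose2[OF assms(2) continuous_D]) auto
  then show ?thesis using lattice_periodic_range[OF assms(1)] bounded_subset compact_imp_bounded by blast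
qed

text \<open>
  A holomorphic coefficient is entire and, being periodic, bounded; Liouville's theorem makes it
  constant.
\<close>

lemma hol_quad_diffs_eq: "hol_quad_diffs g = range (\<lambda>c. qd (\<lambda>_. c))"
proof (intro equalityI subsetI)
  fix \<Psi> assume "\<Psi> \<in> range (\<lambda>c. qd (\<lambda>_. c))"
  then obtain c where c: "\<Psi> = qd (\<lambda>_. c)" by auto
  have "qd (\<lambda>w. (\<lambda>_. c) w * cnj ((\<lambda>_. 1) w)) \<in> quad_diffs g"
    by (rule qd_in_quad_diffs) (auto simp: lattice_periodic_def)
  moreover have "\<psi> holomorphic_on z ` U" if cc: "complex_coord g U z \<rho>" and q: "qd_form \<Psi> U z \<psi>" for U z \<rho> \<psi>
  proof (rule holomorphic_transform)
    show "(\<lambda>w. c * (deriv (D_in U z) w)\<^sup>2) holomorphic_on z ` U"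
      using D_in_holomorphic[OF cc] complex_coord_open_image[OF cc] by (intro holomorphic_intros)
    show "c * (deriv (D_in U z) w)\<^sup>2 = \<psi> w" if "w \<in> z ` U" for w
      using q that unfolding c qd_form_iff[OF cc] by auto
  qed
  ultimately show "\<Psi> \<in> hol_quad_diffs g" by (auto simp: hol_quad_diffs_def c)
next
  fix \<Psi> assume \<Psi>: "\<Psi> \<in> hol_quad_diffs g"
  then obtain \<psi> where \<psi>: "smooth_on UNIV \<psi>" "lattice_periodic \<psi>" "\<Psi> = qd \<psi>"
    using quad_diffs_obtain[of \<Psi>] by (auto simp: hol_quad_diffs_def)
  have "\<psi> holomorphic_on UNIV"
    using \<Psi> \<psi>(3) chart qd_form_D[of \<psi>] surj unfolding hol_quad_diffs_def by (metis (mono_tags, lifting) mem_Collect_eq)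
  then obtain c where "\<And>w. \<psi> w = c"
    using Liouville_theorem lattice_periodic_bounded[OF \<psi>(2) smooth_on_continuous[OF \<psi>(1)]]
    by (metis constant_on_def UNIV_I)
  then show "\<Psi> \<in> range (\<lambda>c. qd (\<lambda>_. c))" using \<psi>(3) by (metis ext rangeI)
qed

text \<open>
  The Jacobian determinant of \<open>D\<close>.
\<close>

definition jac :: "real^2 \<Rightarrow> real" where
  "jac p = Im (cnj (dcoord D p (axis 1 1)) * dcoord D p (axis 2 1))"

lemma jac_pos: "jac p > 0"
  using chart by (auto simp: complex_coord_def jac_def)

lemma area_density_eq_jac: "area_density g p = jac p"
proof -
  have g: "g p v w = dcoord D p v \<bullet> dcoord D p w" for v w
    using chart by (auto simp: complex_coord_def)
  have lagr: "(x \<bullet> x) * (y \<bullet> y) - (x \<bullet> y)\<^sup>2 = (Im (cnj x * y))\<^sup>2" for x y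
    by (simp add: inner_complex_def) (simp add: power2_eq_square algebra_simps)
  show ?thesis
    unfolding area_density_def g lagr using jac_pos[of p] by (simp add: jac_def)
qed

lemma continuous_jac: "continuous_on S jac"
  unfolding jac_def by (intro continuous_intros continuous_dcoord_D)

lemma torus_integral_jac: "torus_integral g f = (LINT p:cbox 0 1|lborel. jac p *\<^sub>R f p)"
  by (simp add: torus_integral_def area_density_eq_jac)

lemma torus_integrable:
  fixes \<phi> :: "complex \<Rightarrow> 'a::{banach, second_countable_topology}"
  assumes "continuous_on UNIV \<phi>"
  shows "set_integrable lborel (cbox 0 1) (\<lambda>p. jac p *\<^sub>R \<phi> (D p))"
  unfolding set_integrable_def
  by (rule borel_integrable_compact)
    (auto intro!: continuous_intros continuous_jac continuous_on_compose2[OF assms continuous_D])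

lemma torus_integral_diff_const:
  assumes "continuous_on UNIV \<phi>"
  shows "torus_integral g (\<lambda>p. \<phi> (D p) - c) = torus_integral g (\<lambda>p. \<phi> (D p)) - (c :: complex)"
proof -
  have "torus_integral g (\<lambda>p. \<phi> (D p) - c) = torus_integral g (\<lambda>p. \<phi> (D p)) - torus_integral g (\<lambda>_. c)"
    unfolding torus_integral_jac scaleR_diff_right
    by (rule set_integral_diff(2)) (use torus_integrable[OF assms] torus_integrable[of "\<lambda>_. c"] in auto)
  also have "torus_integral g (\<lambda>_. c) = torus_area g *\<^sub>R c"
    unfolding torus_area_def torus_integral_jac
    using torus_integrable[of "\<lambda>_. 1 :: real"] integral_scaleR_left[of c lborel "\<lambda>p. indicator (cbox 0 1) p *\<^sub>R jac p"]
    by (simp add: set_lebesgue_integral_def set_integrable_def)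
  finally show ?thesis by (simp add: unit_area)
qed

lemma L2_inner_qd_const:
  "L2_inner g (qd \<phi>) (qd (\<lambda>_. d)) = 4 * cnj d * torus_integral g (\<lambda>p. \<phi> (D p))"
proof -
  have "L2_inner g (qd \<phi>) (qd (\<lambda>_. d)) = (LINT p:cbox 0 1|lborel. (4 * cnj d) * (jac p *\<^sub>R \<phi> (D p)))"
    unfolding L2_inner_def torus_integral_jac qd_inner_qd by (simp add: scaleR_conv_of_real mult_ac)
  then show ?thesis unfolding torus_integral_jac by (simp only: set_integral_mult_right)
qed

lemma qd_minus_const: "qd \<psi> - qd (\<lambda>_. c) = qd (\<lambda>w. \<psi> w - c)"
  by (simp add: qd_def fun_eq_iff algebra_simps)

text \<open>
  The holomorphic differentials are the constant multiples of \<open>dz\<^sup>2\<close>, so on a torus of unit area the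
  projection replaces the coefficient by its mean.
\<close>

lemma hol_proj_qd:
  assumes "continuous_on UNIV \<psi>"
  shows "hol_proj g (qd \<psi>) = qd (\<lambda>_. torus_integral g (\<lambda>p. \<psi> (D p)))"
  unfolding hol_proj_def hol_quad_diffs_eq
proof (rule the_equality)
  have "L2_inner g (qd \<psi> - qd (\<lambda>_. torus_integral g (\<lambda>p. \<psi> (D p)))) (qd (\<lambda>_. d)) = 0" for d
    unfolding qd_minus_const L2_inner_qd_const torus_integral_diff_const[OF assms] by simp
  then show "qd (\<lambda>_. torus_integral g (\<lambda>p. \<psi> (D p))) \<in> range (\<lambda>c. qd (\<lambda>_. c)) \<and>
    (\<forall>\<Theta>\<in>range (\<lambda>c. qd (\<lambda>_. c)). L2_inner g (qd \<psi> - qd (\<lambda>_. torus_integral g (\<lambda>p. \<psi> (D p)))) \<Theta> = 0)"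
    by auto
next
  fix \<Phi> assume "\<Phi> \<in> range (\<lambda>c. qd (\<lambda>_. c)) \<and>
    (\<forall>\<Theta>\<in>range (\<lambda>c. qd (\<lambda>_. c)). L2_inner g (qd \<psi> - \<Phi>) \<Theta> = 0)"
  then obtain c where c: "\<Phi> = qd (\<lambda>_. c)" and "L2_inner g (qd \<psi> - \<Phi>) (qd (\<lambda>_. 1)) = 0"
    by auto
  then have "torus_integral g (\<lambda>p. \<psi> (D p)) - c = 0"
    unfolding c qd_minus_const L2_inner_qd_const torus_integral_diff_const[OF assms] by simp
  then show "\<Phi> = qd (\<lambda>_. torus_integral g (\<lambda>p. \<psi> (D p)))" by (simp add: c)
qed

end

section \<open>Lebesgue measure on the complex plane\<close>

lemma nn_integral_lborel_shift:
  fixes f :: "'a::euclidean_space \<Rightarrow> ennreal"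
  assumes [measurable]: "f \<in> borel_measurable borel"
  shows "(\<integral>\<^sup>+w. f (w + c) \<partial>lborel) = (\<integral>\<^sup>+w. f w \<partial>lborel)"
proof -
  have "(\<integral>\<^sup>+w. f w \<partial>lborel) = (\<integral>\<^sup>+w. f w \<partial>(distr lborel borel ((+) c)))"
    by (simp add: lborel_distr_plus)
  also have "\<dots> = (\<integral>\<^sup>+w. f (w + c) \<partial>lborel)"
    by (subst nn_integral_distr) (auto simp: add.commute)
  finally show ?thesis by simp
qed

lemma integral_lborel_shift:
  fixes f :: "'a::euclidean_space \<Rightarrow> complex"
  assumes [measurable]: "f \<in> borel_measurable borel"
  shows "(LINT w|lborel. f (w + c)) = (LINT w|lborel. f w)"
proof -
  have "(LINT w|lborel. f w) = (LINT w|distr lborel borel ((+) c). f w)"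
    by (simp add: lborel_distr_plus)
  also have "\<dots> = (LINT w|lborel. f (w + c))"
    by (subst integral_distr) (auto simp: add.commute)
  finally show ?thesis by simp
qed

lemma norm_integral_le_nn_integral:
  fixes f :: "'a \<Rightarrow> 'b::{banach, second_countable_topology}"
  shows "ennreal (norm (integral\<^sup>L M f)) \<le> (\<integral>\<^sup>+x. ennreal (norm (f x)) \<partial>M)"
  by (cases "integrable M f") (auto intro: integral_norm_bound_ennreal simp: not_integrable_integral_eq)

lemma norm_set_integral_le_nn_integral:
  fixes f :: "'a \<Rightarrow> 'b::{banach, second_countable_topology}"
  shows "ennreal (norm (LINT x:A|M. f x)) \<le> (\<integral>\<^sup>+x\<in>A. ennreal (norm (f x)) \<partial>M)"
  unfolding set_lebesgue_integral_def
  by (rule order_trans[OF norm_integral_le_nn_integral])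
    (auto intro!: nn_integral_mono split: split_indicator)

lemma set_integrable_bounded_continuous:
  fixes f :: "'a::euclidean_space \<Rightarrow> 'b::{banach, second_countable_topology}"
  assumes "bounded K" "K \<in> sets borel" "continuous_on UNIV f"
  shows "set_integrable lborel K f"
proof (rule set_integrable_subset)
  show "set_integrable lborel (closure K) f"
    unfolding set_integrable_def
    by (rule borel_integrable_compact) (use assms continuous_on_subset in \<open>auto simp: compact_closure\<close>)
qed (use assms closure_subset in auto)

text \<open>
  Fubini's theorem for continuous functions on bounded Borel sets, where integrability is automatic.
\<close>

lemma set_integral_product:
  fixes f :: "'a::euclidean_space \<times> 'b::euclidean_space \<Rightarrow> complex"
  assumes K: "bounded K" "K \<in> sets borel" and L: "bounded L" "L \<in> sets borel" and f: "continuous_on UNIV f"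
  shows "(LINT x:K|lborel. LINT y:L|lborel. f (x, y)) = (LINT p:K \<times> L|lborel. f p)"
    and "(LINT y:L|lborel. LINT x:K|lborel. f (x, y)) = (LINT p:K \<times> L|lborel. f p)"
proof -
  have meas: "K \<times> L \<in> sets borel"
    unfolding borel_prod[symmetric] using K L by (intro pair_measureI)
  have "set_integrable lborel (K \<times> L) f"
    by (rule set_integrable_bounded_continuous[OF bounded_Times meas f]) (use K L in auto)
  then have int: "integrable (lborel \<Otimes>\<^sub>M lborel) (\<lambda>(x, y). indicator (K \<times> L) (x, y) *\<^sub>R f (x, y))"
    by (simp add: set_integrable_def lborel_prod case_prod_unfold)
  have ind: "indicat_real (K \<times> L) (x, y) = indicator K x * indicator L y" for x y
    by (simp add: indicator_def)
  have eq: "(LINT p:K \<times> L|lborel. f p) = integral\<^sup>L (lborel \<Otimes>\<^sub>M lborel) (\<lambda>(x, y). indicator (K \<times> L) (x, y) *\<^sub>R f (x, y))"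
    by (simp add: set_lebesgue_integral_def lborel_prod case_prod_unfold)
  show "(LINT x:K|lborel. LINT y:L|lborel. f (x, y)) = (LINT p:K \<times> L|lborel. f p)"
    unfolding eq lborel_pair.integral_fst'[OF int, symmetric]
    by (simp add: set_lebesgue_integral_def ind flip: scaleR_scaleR integral_scaleR_right)
  show "(LINT y:L|lborel. LINT x:K|lborel. f (x, y)) = (LINT p:K \<times> L|lborel. f p)"
    unfolding eq lborel_pair.integral_snd[OF int, symmetric]
    by (simp add: set_lebesgue_integral_def ind mult.commute[of "indicator K _"] flip: scaleR_scaleR integral_scaleR_right)
qed

definition cart_complex :: "real^2 \<Rightarrow> complex" where
  "cart_complex v = Complex (v $ 1) (v $ 2)"

lemma linear_cart_complex: "linear cart_complex"
  by (intro linearI) (auto simp: cart_complex_def complex_eq_iff)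

lemma borel_measurable_cart_complex [measurable]: "cart_complex \<in> borel_measurable borel"
  by (intro borel_measurable_continuous_onI linear_continuous_on)
    (simp add: linear_cart_complex flip: linear_conv_bounded_linear)

text \<open>
  Lebesgue measure on the complex plane is that of \<open>\<real>\<^sup>2\<close>. Rotations and changes of variables
  are treated in \<open>\<real>\<^sup>2\<close> and transported through this identification.
\<close>

lemma lborel_distr_cart_complex: "distr lborel borel cart_complex = lborel"
proof (rule lborel_eqI[symmetric])
  fix l u :: complex assume *: "\<And>b. b \<in> Basis \<Longrightarrow> l \<bullet> b \<le> u \<bullet> b"
  have le: "Re l \<le> Re u" "Im l \<le> Im u"
    using *[of 1] *[of \<i>] by (auto simp: Basis_complex_def)
  have "cart_complex -` box l u = box (vector [Re l, Im l]) (vector [Re u, Im u])"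
    by (auto simp: cart_complex_def in_box_complex_iff mem_box_cart forall_2)
  then have "emeasure (distr lborel borel cart_complex) (box l u)
     = emeasure lborel (box (vector [Re l, Im l]) (vector [Re u, Im u]) :: (real^2) set)"
    by (subst emeasure_distr) auto
  also have "\<dots> = ennreal ((Re u - Re l) * (Im u - Im l))"
    using le by (subst emeasure_lborel_box)
      (auto simp: Basis_vec_def UNIV_2 axis_eq_axis inner_axis)
  also have "\<dots> = ennreal (\<Prod>b\<in>Basis. (u - l) \<bullet> b)"
    by (simp add: Basis_complex_def)
  finally show "emeasure (distr lborel borel cart_complex) (box l u) = ennreal (\<Prod>b\<in>Basis. (u - l) \<bullet> b)" .
qed simp

lemma lborel_distr_rotation:
  assumes e: "cmod e = 1" shows "distr lborel borel ((*) e) = lborel"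
proof (rule lborel_eqI[symmetric])
  fix l u :: complex assume *: "\<And>b. b \<in> Basis \<Longrightarrow> l \<bullet> b \<le> u \<bullet> b"
  define X where "X = cart_complex -` box l u"
  define ic :: "complex \<Rightarrow> real^2" where "ic w = vector [Re w, Im w]" for w
  \<comment> \<open>The rotation by \<open>cnj e\<close>, conjugated to an orthogonal map of \<open>\<real>\<^sup>2\<close>.\<close>
  define O' where "O' v = ic (cnj e * cart_complex v)" for v
  have cc: "cart_complex (ic w) = w" for w
    by (simp add: cart_complex_def ic_def)
  have cci: "ic (cart_complex w) = w" for w
    by (simp add: cart_complex_def ic_def vec_eq_iff forall_2)
  have nrm: "norm (cart_complex v) = norm v" for v
    by (simp add: cart_complex_def cmod_def norm_vec_def L2_set_def sum_2)
  have "linear O'"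
    by (intro linearI) (auto simp: O'_def ic_def cart_complex_def vec_eq_iff forall_2 algebra_simps)
  moreover have "norm (O' v) = norm v" for v
    using e nrm[of v] nrm[of "O' v"] by (simp add: O'_def cc norm_mult)
  ultimately have orth: "orthogonal_transformation O'"
    by (simp add: orthogonal_transformation)
  have ee: "e * (cnj e * w) = w" "cnj e * (e * w) = w" for w
    using e by (simp_all add: complex_norm_square[symmetric] mult.assoc[symmetric] mult.commute[of "cnj e"])
  have img: "O' ` X = cart_complex -` ((*) e -` box l u)"
  proof (intro equalityI subsetI)
    fix v assume "v \<in> O' ` X"
    then show "v \<in> cart_complex -` ((*) e -` box l u)" by (auto simp: O'_def X_def cc ee)
  next
    fix v assume v: "v \<in> cart_complex -` ((*) e -` box l u)"
    have "v = O' (ic (e * cart_complex v))" by (simp add: O'_def cc ee cci)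
    moreover have "ic (e * cart_complex v) \<in> X" using v by (simp add: X_def cc)
    ultimately show "v \<in> O' ` X" by blast
  qed
  have emb: "emeasure lborel (box l u) = emeasure lborel X"
    unfolding X_def by (subst lborel_distr_cart_complex[symmetric], subst emeasure_distr) auto
  then have fin: "emeasure lborel X < \<infinity>" using emeasure_bounded_finite[OF bounded_box, of l u] by simp
  have X: "X \<in> sets borel" unfolding X_def using borel_measurable_cart_complex
    by (metis borel_open measurable_sets_borel open_box)
  have lm: "X \<in> lmeasurable" using X fin by (auto simp: fmeasurable_def)
  have "open ((*) e -` box l u)"
    by (intro open_vimage continuous_intros open_box)
  then have eb: "(*) e -` box l u \<in> sets borel" by simp
  then have X': "O' ` X \<in> sets borel" unfolding img
    by (intro measurable_sets_borel[OF borel_measurable_cart_complex])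
  have "emeasure (distr lborel borel ((*) e)) (box l u) = emeasure lborel ((*) e -` box l u)"
    by (subst emeasure_distr) auto
  also have "\<dots> = emeasure lborel (O' ` X)"
    unfolding img using eb by (subst lborel_distr_cart_complex[symmetric], subst emeasure_distr) auto
  also have "\<dots> = emeasure lebesgue (O' ` X)" using X' by simp
  also have "\<dots> = emeasure lebesgue X"
    using measure_orthogonal_image[OF orth lm] lm measurable_orthogonal_image[OF orth lm]
    by (metis emeasure_eq_measure2 fmeasurableD2 top.not_eq_extremum)
  also have "\<dots> = emeasure lborel X" using X by simp
  finally show "emeasure (distr lborel borel ((*) e)) (box l u) = ennreal (\<Prod>b\<in>Basis. (u - l) \<bullet> b)"
    using * by (simp add: emb[symmetric])
qed simp

lemma disc_integral_rotation:
  fixes f :: "complex \<Rightarrow> complex"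
  assumes [measurable]: "f \<in> borel_measurable borel" and e: "cmod e = 1"
  shows "(LINT z:cball 0 1|lborel. f (e * z)) = (LINT z:cball 0 1|lborel. f z)"
proof -
  have "(LINT z:cball 0 1|lborel. f z) = (LINT z:cball 0 1|distr lborel borel ((*) e). f z)"
    by (simp add: lborel_distr_rotation[OF e])
  also have "\<dots> = (LINT z:cball 0 1|lborel. f (e * z))"
    unfolding set_lebesgue_integral_def using e
    by (subst integral_distr) (auto simp: indicator_def norm_mult intro!: Bochner_Integration.integral_cong)
  finally show ?thesis by simp
qed

section \<open>Periodic functions and fundamental domains\<close>

text \<open>
  A bounded set of unit area whose translates by \<open>\<Lambda>\<close> tile the plane. The \<open>L\<^sup>1\<close> norm on the torus is
  the integral over such a set.
\<close>

locale fundamental_domain =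
  fixes A \<Lambda> :: "complex set"
  assumes A_borel: "A \<in> sets borel" and A_bounded: "bounded A"
    and A_measure: "emeasure lborel A = 1"
    and countable_\<Lambda>: "countable \<Lambda>" and uminus_\<Lambda>: "\<And>l. l \<in> \<Lambda> \<Longrightarrow> - l \<in> \<Lambda>"
    and unique_translate: "\<And>w. \<exists>!l. l \<in> \<Lambda> \<and> w - l \<in> A"
begin

definition periodic :: "(complex \<Rightarrow> 'a) \<Rightarrow> bool" where
  "periodic \<phi> \<longleftrightarrow> (\<forall>w. \<forall>l\<in>\<Lambda>. \<phi> (w + l) = \<phi> w)"

lemma A_borel_measurable [measurable]: "A \<in> sets borel" by (rule A_borel)

lemma sum_translates: "(\<integral>\<^sup>+l. indicator A (w - l) \<partial>count_space \<Lambda>) = (1::ennreal)"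
proof -
  obtain l where l: "l \<in> \<Lambda>" "w - l \<in> A" "\<And>k. k \<in> \<Lambda> \<Longrightarrow> w - k \<in> A \<Longrightarrow> k = l"
    using unique_translate[of w] by auto
  have "indicator A (w - k) = (indicator {l} k :: ennreal)" if "k \<in> \<Lambda>" for k
    using l(2) l(3)[OF that] by (cases "k = l") (auto simp: indicator_def)
  then have "(\<integral>\<^sup>+l. indicator A (w - l) \<partial>count_space \<Lambda>) = (\<integral>\<^sup>+k. indicator {l} k \<partial>count_space \<Lambda>)"
    by (intro nn_integral_cong) simp
  also have "\<dots> = 1" using l(1) by simp
  finally show ?thesis .
qed

lemma sum_translates': "(\<integral>\<^sup>+l. indicator A (w + l) \<partial>count_space \<Lambda>) = (1::ennreal)"
proof -
  obtain l where l: "l \<in> \<Lambda>" "w - l \<in> A" "\<And>k. k \<in> \<Lambda> \<Longrightarrow> w - k \<in> A \<Longrightarrow> k = l"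
    using unique_translate[of w] by auto
  have uniq: "w + k \<in> A \<Longrightarrow> k = - l" if "k \<in> \<Lambda>" for k
  proof -
    assume "w + k \<in> A"
    then have "- k = l" using l(3)[OF uminus_\<Lambda>[OF that]] by simp
    then show "k = - l" by auto
  qed
  have "indicator A (w + k) = (indicator {- l} k :: ennreal)" if "k \<in> \<Lambda>" for k
    using uniq[OF that] l(2) by (cases "k = - l") (auto simp: indicator_def)
  then have "(\<integral>\<^sup>+l. indicator A (w + l) \<partial>count_space \<Lambda>) = (\<integral>\<^sup>+k. indicator {- l} k \<partial>count_space \<Lambda>)"
    by (intro nn_integral_cong) simp
  also have "\<dots> = 1" using uminus_\<Lambda>[OF l(1)] by simp
  finally show ?thesis .
qed

text \<open>
  The translate \<open>A + z\<close> is another fundamental domain. Cutting it along the tiles \<open>A + l\<close> and moving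
  every piece back into \<open>A\<close> reassembles \<open>A\<close>, and a periodic function does not notice the moves.
\<close>

lemma nn_integral_shift:
  fixes \<phi> :: "complex \<Rightarrow> ennreal"
  assumes [measurable]: "\<phi> \<in> borel_measurable borel" and per: "periodic \<phi>"
  shows "(\<integral>\<^sup>+w\<in>A. \<phi> (w + z) \<partial>lborel) = (\<integral>\<^sup>+w\<in>A. \<phi> w \<partial>lborel)"
proof -
  have "(\<integral>\<^sup>+w\<in>A. \<phi> (w + z) \<partial>lborel) = (\<integral>\<^sup>+w. \<phi> w * indicator A (w - z) \<partial>lborel)"
    using nn_integral_lborel_shift[of "\<lambda>w. \<phi> w * indicator A (w - z)" z] by simp
  also have "\<dots> = (\<integral>\<^sup>+w. (\<integral>\<^sup>+l. \<phi> w * indicator A (w - z) * indicator A (w - l) \<partial>count_space \<Lambda>) \<partial>lborel)"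
    by (simp add: nn_integral_cmult sum_translates)
  also have "\<dots> = (\<integral>\<^sup>+l. (\<integral>\<^sup>+w. \<phi> w * indicator A (w - z) * indicator A (w - l) \<partial>lborel) \<partial>count_space \<Lambda>)"
    by (rule nn_integral_count_space_nn_integral[OF countable_\<Lambda>]) measurable
  also have "\<dots> = (\<integral>\<^sup>+l. (\<integral>\<^sup>+w. \<phi> w * indicator A w * indicator A (w - z + l) \<partial>lborel) \<partial>count_space \<Lambda>)"
  proof (rule nn_integral_cong)
    fix l assume "l \<in> space (count_space \<Lambda>)"
    then have l: "\<phi> (w + l) = \<phi> w" for w using per by (simp add: periodic_def)
    show "(\<integral>\<^sup>+w. \<phi> w * indicator A (w - z) * indicator A (w - l) \<partial>lborel)
      = (\<integral>\<^sup>+w. \<phi> w * indicator A w * indicator A (w - z + l) \<partial>lborel)"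
      using nn_integral_lborel_shift[of "\<lambda>w. \<phi> w * indicator A (w - z) * indicator A (w - l)" l]
      by (simp add: l algebra_simps)
  qed
  also have "\<dots> = (\<integral>\<^sup>+w. (\<integral>\<^sup>+l. \<phi> w * indicator A w * indicator A (w - z + l) \<partial>count_space \<Lambda>) \<partial>lborel)"
    by (rule nn_integral_count_space_nn_integral[OF countable_\<Lambda>, symmetric]) measurable
  also have "\<dots> = (\<integral>\<^sup>+w\<in>A. \<phi> w \<partial>lborel)"
    by (simp add: nn_integral_cmult sum_translates')
  finally show ?thesis .
qed

text \<open>
  By Tonelli's theorem and translation invariance every \<open>x \<in> K\<close> contributes the same amount. Both halves
  of the estimate for functions of mean zero are bounded in this way: with \<open>K\<close> a cylinder and \<open>T (s, z) = s z\<close>, and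
  with \<open>K\<close> an annulus.
\<close>

lemma nn_integral_average_shifts:
  fixes \<phi> :: "complex \<Rightarrow> ennreal" and T :: "'x::euclidean_space \<Rightarrow> complex"
  assumes [measurable]: "\<phi> \<in> borel_measurable borel" and per: "periodic \<phi>"
    and [measurable]: "T \<in> borel_measurable borel" "K \<in> sets borel"
  shows "(\<integral>\<^sup>+w\<in>A. (\<integral>\<^sup>+x\<in>K. \<phi> (w + T x) \<partial>lborel) \<partial>lborel) = emeasure lborel K * (\<integral>\<^sup>+w\<in>A. \<phi> w \<partial>lborel)"
proof -
  have "(\<integral>\<^sup>+w\<in>A. (\<integral>\<^sup>+x\<in>K. \<phi> (w + T x) \<partial>lborel) \<partial>lborel)
    = (\<integral>\<^sup>+w. (\<integral>\<^sup>+x. \<phi> (w + T x) * indicator K x * indicator A w \<partial>lborel) \<partial>lborel)"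
    by (simp add: nn_integral_multc)
  also have "\<dots> = (\<integral>\<^sup>+x. (\<integral>\<^sup>+w. \<phi> (w + T x) * indicator K x * indicator A w \<partial>lborel) \<partial>lborel)"
    by (rule lborel_pair.Fubini'[symmetric]) measurable
  also have "\<dots> = (\<integral>\<^sup>+x. (\<integral>\<^sup>+w\<in>A. \<phi> (w + T x) \<partial>lborel) * indicator K x \<partial>lborel)"
    by (intro nn_integral_cong, subst nn_integral_multc[symmetric])
      (auto intro!: nn_integral_cong simp: mult_ac)
  also have "\<dots> = (\<integral>\<^sup>+x\<in>K. (\<integral>\<^sup>+w\<in>A. \<phi> w \<partial>lborel) \<partial>lborel)"
    by (simp add: nn_integral_shift[OF assms(1) per])
  also have "\<dots> = (\<integral>\<^sup>+w\<in>A. \<phi> w \<partial>lborel) * emeasure lborel K"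
    by (rule nn_integral_cmult_indicator) (simp add: assms(4))
  finally show ?thesis by (subst mult.commute)
qed

lemma set_integrable_A:
  fixes \<phi> :: "complex \<Rightarrow> 'b::{banach, second_countable_topology}"
  shows "continuous_on UNIV \<phi> \<Longrightarrow> set_integrable lborel A \<phi>"
  by (rule set_integrable_bounded_continuous[OF A_bounded A_borel])

lemma measure_A: "measure lborel A = 1"
  by (simp add: measure_def A_measure)

lemma real_integral_shift:
  fixes \<phi> :: "complex \<Rightarrow> real"
  assumes cont: "continuous_on UNIV \<phi>" and per: "periodic \<phi>" and bdd: "bounded (range \<phi>)"
  shows "(LINT w:A|lborel. \<phi> (w + z)) = (LINT w:A|lborel. \<phi> w)"
proof -
  obtain B where B: "\<And>w. \<bar>\<phi> w\<bar> \<le> B" using bdd by (auto simp: bounded_iff)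
  have cont': "continuous_on UNIV (\<lambda>w. \<phi> (w + z))"
    by (rule continuous_on_compose2[OF cont]) (auto intro!: continuous_intros)
  have int_const: "set_integrable lborel A (\<lambda>_. B)" by (rule set_integrable_A) simp
  have key: "ennreal (LINT w:A|lborel. \<phi> (w + z) + B) = (\<integral>\<^sup>+w\<in>A. ennreal (\<phi> (w + z) + B) \<partial>lborel)"
    if "continuous_on UNIV (\<lambda>w. \<phi> (w + z))" for z
  proof -
    have "set_integrable lborel A (\<lambda>w. \<phi> (w + z) + B)"
      by (intro set_integral_add int_const set_integrable_A that)
    then have int: "integrable lborel (\<lambda>w. indicator A w *\<^sub>R (\<phi> (w + z) + B))"
      by (simp only: set_integrable_def)
    have pos: "0 \<le> \<phi> w + B" for w using B[of w] by linarith
    have "ennreal (LINT w:A|lborel. \<phi> (w + z) + B) = (\<integral>\<^sup>+w. ennreal (indicator A w *\<^sub>R (\<phi> (w + z) + B)) \<partial>lborel)"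
      unfolding set_lebesgue_integral_def
      by (rule nn_integral_eq_integral[OF int, symmetric]) (simp add: pos indicator_def)
    also have "\<dots> = (\<integral>\<^sup>+w\<in>A. ennreal (\<phi> (w + z) + B) \<partial>lborel)"
      by (rule nn_integral_cong) (simp add: indicator_def)
    finally show ?thesis .
  qed
  have nn: "0 \<le> (LINT w:A|lborel. \<phi> (w + z) + B)" for z
  proof -
    have "0 \<le> \<phi> w + B" for w using B[of w] by linarith
    then show ?thesis unfolding set_lebesgue_integral_def by (intro integral_nonneg_AE) auto
  qed
  have [measurable]: "\<phi> \<in> borel_measurable borel"
    using cont by (rule borel_measurable_continuous_onI)
  have sh: "(\<integral>\<^sup>+w\<in>A. ennreal (\<phi> (w + z) + B) \<partial>lborel) = (\<integral>\<^sup>+w\<in>A. ennreal (\<phi> w + B) \<partial>lborel)"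
    by (rule nn_integral_shift[of "\<lambda>w. ennreal (\<phi> w + B)"]) (use per in \<open>auto simp: periodic_def\<close>)
  have k0: "ennreal (LINT w:A|lborel. \<phi> w + B) = (\<integral>\<^sup>+w\<in>A. ennreal (\<phi> w + B) \<partial>lborel)"
    using key[of 0] cont by (simp only: add_0_right)
  have "ennreal (LINT w:A|lborel. \<phi> (w + z) + B) = ennreal (LINT w:A|lborel. \<phi> w + B)"
    by (simp only: key[OF cont'] sh k0)
  moreover have "0 \<le> (LINT w:A|lborel. \<phi> w + B)" using nn[of 0] by (simp only: add_0_right)
  ultimately have "(LINT w:A|lborel. \<phi> (w + z) + B) = (LINT w:A|lborel. \<phi> w + B)"
    using nn[of z] by (simp only: ennreal_inj)
  then show ?thesis
    unfolding set_integral_add(2)[OF set_integrable_A[OF cont'] int_const]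
      set_integral_add(2)[OF set_integrable_A[OF cont] int_const] by (rule add_right_imp_eq)
qed

lemma complex_integral_shift:
  fixes \<phi> :: "complex \<Rightarrow> complex"
  assumes cont: "continuous_on UNIV \<phi>" and per: "periodic \<phi>" and bdd: "bounded (range \<phi>)"
  shows "(LINT w:A|lborel. \<phi> (w + z)) = (LINT w:A|lborel. \<phi> w)"
proof -
  have cont': "continuous_on UNIV (\<lambda>w. \<phi> (w + z))"
    by (rule continuous_on_compose2[OF cont]) (auto intro!: continuous_intros)
  obtain B where B: "\<And>w. cmod (\<phi> w) \<le> B" using bdd by (auto simp: bounded_iff)
  have b: "bounded (range (\<lambda>w. Re (\<phi> w)))" "bounded (range (\<lambda>w. Im (\<phi> w)))"
    unfolding bounded_iff using order_trans[OF abs_Re_le_cmod B] order_trans[OF abs_Im_le_cmod B]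
    by (force intro: exI[of _ B])+
  have ri: "Re (LINT w:A|lborel. f w) = (LINT w:A|lborel. Re (f w))"
    "Im (LINT w:A|lborel. f w) = (LINT w:A|lborel. Im (f w))"
    if "set_integrable lborel A f" for f
    using integral_Re[of lborel "\<lambda>w. indicator A w *\<^sub>R f w"] integral_Im[of lborel "\<lambda>w. indicator A w *\<^sub>R f w"] that
    by (simp_all add: set_lebesgue_integral_def set_integrable_def)
  note int = set_integrable_A[OF cont'] set_integrable_A[OF cont]
  have "(LINT w:A|lborel. Re (\<phi> (w + z))) = (LINT w:A|lborel. Re (\<phi> w))"
    by (rule real_integral_shift[OF continuous_on_Re[OF cont] _ b(1)]) (use per in \<open>simp add: periodic_def\<close>)
  moreover have "(LINT w:A|lborel. Im (\<phi> (w + z))) = (LINT w:A|lborel. Im (\<phi> w))"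
    by (rule real_integral_shift[OF continuous_on_Im[OF cont] _ b(2)]) (use per in \<open>simp add: periodic_def\<close>)
  ultimately show ?thesis
    by (intro complex_eqI) (simp_all only: ri[OF int(1)] ri[OF int(2)])
qed

end

section \<open>Disc averages and the antiholomorphic derivative\<close>

lemma set_integral_swap:
  fixes f :: "'a::euclidean_space \<Rightarrow> 'b::euclidean_space \<Rightarrow> complex"
  assumes "bounded K" "K \<in> sets borel" "bounded L" "L \<in> sets borel"
    and "continuous_on UNIV (\<lambda>p. f (fst p) (snd p))"
  shows "(LINT x:K|lborel. LINT y:L|lborel. f x y) = (LINT y:L|lborel. LINT x:K|lborel. f x y)"
  using set_integral_product(1)[OF assms] set_integral_product(2)[OF assms]
  by (simp only: fst_conv snd_conv)

lemma cis_has_vector_derivative: "(cis has_vector_derivative \<i> * cis t) (at t)"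
proof -
  have "((\<lambda>w. exp (\<i> * w)) has_field_derivative \<i> * exp (\<i> * of_real t)) (at (of_real t))"
    by (auto intro!: derivative_eq_intros)
  from has_vector_derivative_real_field[OF this] show ?thesis
    unfolding cis_conv_exp[abs_def] .
qed

text \<open>
  A continuously differentiable map of the plane with partial derivatives \<open>P\<close> and \<open>Q\<close>. Within the
  locale, \<open>L w\<close> is its derivative at \<open>w\<close> and \<open>h\<close> its antiholomorphic derivative.
\<close>

locale differentiable_plane_map =
  fixes \<psi> P Q :: "complex \<Rightarrow> complex"
  assumes deriv: "\<And>w. (\<psi> has_derivative (\<lambda>v. Re v *\<^sub>R P w + Im v *\<^sub>R Q w)) (at w)"
    and contP: "continuous_on UNIV P" and contQ: "continuous_on UNIV Q"
begin

definition h :: "complex \<Rightarrow> complex" where "h w = (P w + \<i> * Q w) / 2"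

definition L :: "complex \<Rightarrow> complex \<Rightarrow> complex" where "L w v = Re v *\<^sub>R P w + Im v *\<^sub>R Q w"

lemma h_eq_d_zbar: "h w = d_zbar \<psi> w"
  by (simp add: h_def d_zbar_def frechet_derivative_at[OF deriv, symmetric])

text \<open>
  Up to the term with \<open>h\<close>, the derivative in a radial direction \<open>v\<close> equals \<open>- \<i>\<close> times the derivative in
  the angular direction \<open>\<i> v\<close>.
\<close>

lemma derivative_splits_off_d_zbar: "L w v = 2 * h w * cnj v - \<i> * L w (\<i> * v)"
proof -
  have P: "P w = 2 * h w - \<i> * Q w" by (simp add: h_def field_simps)
  show ?thesis by (simp add: L_def P complex_eq_iff algebra_simps)
qed

lemma L_scaleR: "L w (s *\<^sub>R v) = s *\<^sub>R L w v"
  by (simp add: L_def scaleR_add_right)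

lemma continuous_\<psi>: "continuous_on S \<psi>"
  by (rule continuous_at_imp_continuous_on) (simp add: has_derivative_continuous[OF deriv])

lemma continuous_h: "continuous_on UNIV h"
  unfolding h_def by (intro continuous_intros contP contQ) auto

lemma continuous_on_L:
  assumes "continuous_on S f" "continuous_on S v"
  shows "continuous_on S (\<lambda>x. L (f x) (v x))"
  unfolding L_def
  by (intro continuous_on_add continuous_on_scaleR continuous_on_Re continuous_on_Im assms
      continuous_on_compose2[OF contP assms(1)] continuous_on_compose2[OF contQ assms(1)] subset_UNIV)

lemma continuous_on_h_comp: "continuous_on S f \<Longrightarrow> continuous_on S (\<lambda>x. h (f x))"
  by (rule continuous_on_compose2[OF continuous_h]) auto

lemma vector_derivative_along:
  assumes "(c has_vector_derivative c') (at t within S)"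
  shows "((\<lambda>t. \<psi> (c t)) has_vector_derivative L (c t) c') (at t within S)"
proof -
  have "(\<psi> \<circ> c has_derivative (\<lambda>v. L (c t) v) \<circ> (\<lambda>x. x *\<^sub>R c')) (at t within S)"
    using assms deriv[of "c t"] unfolding has_vector_derivative_def L_def
    by (intro diff_chain_within) (auto intro: has_derivative_at_withinI)
  moreover have "(\<lambda>v. L (c t) v) \<circ> (\<lambda>x. x *\<^sub>R c') = (\<lambda>x. x *\<^sub>R L (c t) c')"
    by (auto simp: L_def fun_eq_iff scaleR_add_right)
  ultimately show ?thesis by (simp add: has_vector_derivative_def o_def)
qed

lemma FTC_along:
  assumes "a \<le> b" "\<And>t. (c has_vector_derivative c' t) (at t)" "continuous_on UNIV c'"
  shows "(LINT t:{a..b}|lborel. L (c t) (c' t)) = \<psi> (c b) - \<psi> (c a)"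
  unfolding set_lebesgue_integral_def
proof (rule integral_FTC_atLeastAtMost[OF assms(1)])
  show "((\<lambda>t. \<psi> (c t)) has_vector_derivative L (c t) (c' t)) (at t within {a..b})" for t
    by (rule vector_derivative_along, rule has_vector_derivative_at_within, rule assms(2))
  have "continuous_on UNIV c"
    by (rule continuous_at_imp_continuous_on) (simp add: has_vector_derivative_continuous[OF assms(2)])
  then show "continuous_on {a..b} (\<lambda>t. L (c t) (c' t))"
    by (rule continuous_on_subset[OF continuous_on_L[OF _ assms(3)] subset_UNIV])
qed

text \<open>
  The integral of \<open>\<psi>\<close> over a disc does not change when the disc is rotated, so the angular derivative
  of \<open>\<psi>\<close> has integral zero over the disc. In the proof the derivative is first integrated along every
  circle around \<open>w\<close>, where the fundamental theorem of calculus gives zero. Then the order of integration is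
  exchanged and the inner integral is freed of the angle by rotation invariance. The substitution divides
  by \<open>s\<close>; at \<open>s = 0\<close> the integrand is odd.
\<close>

lemma angular_integral_zero:
  assumes "s \<ge> 0"
  shows "(LINT z:cball 0 1|lborel. L (w + s *\<^sub>R z) (\<i> * z)) = 0"
proof -
  define q where "q z = L (w + s *\<^sub>R z) (\<i> * z)" for z
  have cq: "continuous_on UNIV q" unfolding q_def
    by (intro continuous_on_L continuous_intros)
  have mq: "q \<in> borel_measurable borel" by (rule borel_measurable_continuous_onI[OF cq])
  show ?thesis
  proof (cases "s = 0")
    case True
    have "q (- 1 * z) = - q z" for z
      using True by (simp add: q_def L_def)
    then have "(LINT z:cball 0 1|lborel. - q z) = (LINT z:cball 0 1|lborel. q z)"
      using disc_integral_rotation[OF mq, of "- 1"] by simp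
    moreover have "(LINT z:cball 0 1|lborel. - q z) = - (LINT z:cball 0 1|lborel. q z)"
      by (simp add: set_lebesgue_integral_def)
    ultimately have "(LINT z:cball 0 1|lborel. q z) = 0" by simp
    then show ?thesis by (simp add: q_def)
  next
    case False
    then have s: "s > 0" using assms by simp
    have "(LINT t:{0..2*pi}|lborel. q (cis t * z)) = 0" for z
    proof -
      have "(LINT t:{0..2*pi}|lborel. L (w + s *\<^sub>R (cis t * z)) (s *\<^sub>R (\<i> * cis t * z)))
        = \<psi> (w + s *\<^sub>R (cis (2*pi) * z)) - \<psi> (w + s *\<^sub>R (cis 0 * z))"
      proof (rule FTC_along)
        show "((\<lambda>t. w + s *\<^sub>R (cis t * z)) has_vector_derivative s *\<^sub>R (\<i> * cis t * z)) (at t)" for t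
          using has_vector_derivative_add[OF has_vector_derivative_const
              has_vector_derivative_mult_right[OF cis_has_vector_derivative, of "of_real s * z"]]
          by (simp add: scaleR_conv_of_real mult_ac)
        show "continuous_on UNIV (\<lambda>t. s *\<^sub>R (\<i> * cis t * z))"
          by (simp add: cis_conv_exp[abs_def] continuous_intros)
      qed simp
      also have "\<dots> = 0" by simp
      finally have "s *\<^sub>R (LINT t:{0..2*pi}|lborel. q (cis t * z)) = 0"
        by (simp only: q_def L_scaleR set_integral_scaleR_right mult.assoc)
      then show ?thesis using s by simp
    qed
    then have "0 = (LINT z:cball 0 1|lborel. LINT t:{0..2*pi}|lborel. q (cis t * z))"
      by simp
    also have "\<dots> = (LINT t:{0..2*pi}|lborel. LINT z:cball 0 1|lborel. q (cis t * z))"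
    proof (rule set_integral_swap)
      show "continuous_on UNIV (\<lambda>p. q (cis (snd p) * fst p))"
        by (rule continuous_on_compose2[OF cq]) (simp_all add: cis_conv_exp[abs_def] continuous_intros)
    qed auto
    also have "\<dots> = (LINT t:{0..2*pi}|lborel. LINT z:cball 0 1|lborel. q z)"
      by (simp add: disc_integral_rotation[OF mq])
    also have "\<dots> = (2 * pi) *\<^sub>R (LINT z:cball 0 1|lborel. q z)"
      by (simp add: set_lebesgue_integral_def)
    finally show ?thesis by (simp add: q_def)
  qed
qed

text \<open>
  Growing the disc from radius \<open>0\<close> to \<open>R\<close>, the average of \<open>\<psi>\<close> changes by the integral of its radial
  derivative. The angular part of that derivative integrates to zero, so only \<open>h\<close> remains. This is a
  version of the Cauchy-Pompeiu formula that avoids the singular kernel and polar coordinates.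
\<close>

lemma disc_average_deviation:
  assumes "R \<ge> 0"
  shows "(LINT z:cball 0 1|lborel. \<psi> (w + R *\<^sub>R z) - \<psi> w)
     = (LINT x:{0..R} \<times> cball 0 1|lborel. 2 * h (w + fst x *\<^sub>R snd x) * cnj (snd x))"
proof -
  have "(LINT z:cball 0 1|lborel. \<psi> (w + R *\<^sub>R z) - \<psi> w)
     = (LINT z:cball 0 1|lborel. LINT s:{0..R}|lborel. L (w + s *\<^sub>R z) z)"
  proof -
    have "(LINT s:{0..R}|lborel. L (w + s *\<^sub>R z) z) = \<psi> (w + R *\<^sub>R z) - \<psi> (w + 0 *\<^sub>R z)" for z
      by (rule FTC_along[OF assms])
        (use has_vector_derivative_add[OF has_vector_derivative_const
            has_vector_derivative_scaleR[OF DERIV_ident has_vector_derivative_const]] in simp_all)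
    then show ?thesis by simp
  qed
  also have "\<dots> = (LINT s:{0..R}|lborel. LINT z:cball 0 1|lborel. L (w + s *\<^sub>R z) z)"
    by (rule set_integral_swap) (auto intro!: continuous_on_L continuous_intros)
  also have "\<dots> = (LINT s:{0..R}|lborel. LINT z:cball 0 1|lborel. 2 * h (w + s *\<^sub>R z) * cnj z)"
  proof (rule set_lebesgue_integral_cong; (intro allI impI)?)
    fix s assume s: "s \<in> {0..R}"
    have "(LINT z:cball 0 1|lborel. L (w + s *\<^sub>R z) z) = (LINT z:cball 0 1|lborel. 2 * h (w + s *\<^sub>R z) * cnj z - \<i> * L (w + s *\<^sub>R z) (\<i> * z))"
      by (simp only: derivative_splits_off_d_zbar[symmetric])
    also have "\<dots> = (LINT z:cball 0 1|lborel. 2 * h (w + s *\<^sub>R z) * cnj z) - (LINT z:cball 0 1|lborel. \<i> * L (w + s *\<^sub>R z) (\<i> * z))"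
      by (rule set_integral_diff(2); rule set_integrable_bounded_continuous)
        (auto intro!: continuous_intros continuous_on_L continuous_on_h_comp)
    also have "(LINT z:cball 0 1|lborel. \<i> * L (w + s *\<^sub>R z) (\<i> * z)) = 0"
      using angular_integral_zero[of s w] s by (simp only: set_integral_mult_right) simp
    finally show "(LINT z:cball 0 1|lborel. L (w + s *\<^sub>R z) z) = (LINT z:cball 0 1|lborel. 2 * h (w + s *\<^sub>R z) * cnj z)"
      by simp
  qed simp
  also have "\<dots> = (LINT x:{0..R} \<times> cball 0 1|lborel. 2 * h (w + fst x *\<^sub>R snd x) * cnj (snd x))"
    using set_integral_product(1)[of "{0..R}" "cball 0 1" "\<lambda>x. 2 * h (w + fst x *\<^sub>R snd x) * cnj (snd x)"]
    by (simp add: continuous_on_h_comp continuous_intros)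
  finally show ?thesis .
qed

end

section \<open>The estimate for functions of mean zero\<close>

lemma emeasure_disc: "r \<ge> 0 \<Longrightarrow> emeasure lborel (cball (0::complex) r) = ennreal (pi * r\<^sup>2)"
  using unit_ball_vol_2 by (simp add: emeasure_cball)

lemma measure_unit_disc: "measure lborel (cball (0::complex) 1) = pi"
  using emeasure_disc[of 1] by (simp add: measure_def)

lemma emeasure_annulus:
  assumes "0 \<le> e" "e \<le> 1"
  shows "emeasure lborel (cball (0::complex) (1 + e) - ball 0 (1 - e)) = ennreal (4 * pi * e)"
proof -
  have "emeasure lborel (cball (0::complex) (1 + e) - ball 0 (1 - e))
     = emeasure lborel (cball (0::complex) (1 + e)) - emeasure lborel (ball (0::complex) (1 - e))"
    using assms by (intro emeasure_Diff) (auto simp: emeasure_ball)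
  also have "\<dots> = ennreal (pi * (1 + e)\<^sup>2) - ennreal (pi * (1 - e)\<^sup>2)"
    using assms using unit_ball_vol_2 by (simp add: emeasure_disc emeasure_ball)
  also have "\<dots> = ennreal (pi * (1 + e)\<^sup>2 - pi * (1 - e)\<^sup>2)"
    by (rule ennreal_minus) simp
  also have "pi * (1 + e)\<^sup>2 - pi * (1 - e)\<^sup>2 = 4 * pi * e"
    by (simp add: power2_eq_square algebra_simps)
  finally show ?thesis .
qed

text \<open>
  The unit disc and its translate by \<open>c\<close> differ only inside the annulus of width \<open>2 e\<close> around the unit
  circle.
\<close>

lemma disc_integral_translate_diff:
  fixes f :: "complex \<Rightarrow> complex"
  assumes f: "continuous_on UNIV f" and c: "cmod c \<le> e"
  shows "ennreal (cmod (LINT z:cball 0 1|lborel. f z - f (c + z)))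
    \<le> (\<integral>\<^sup>+z\<in>cball 0 (1 + e) - ball 0 (1 - e). ennreal (cmod (f z)) \<partial>lborel)"
proof -
  have fc: "continuous_on UNIV (\<lambda>z. f (c + z))"
    by (rule continuous_on_compose2[OF f]) (auto intro!: continuous_intros)
  have [measurable]: "f \<in> borel_measurable borel" by (rule borel_measurable_continuous_onI[OF f])
  have int: "set_integrable lborel (cball q 1) f" for q
    by (rule set_integrable_bounded_continuous[OF _ _ f]) auto
  have "(LINT z:cball 0 1|lborel. f z - f (c + z)) = (LINT z:cball 0 1|lborel. f z) - (LINT z:cball 0 1|lborel. f (c + z))"
    by (rule set_integral_diff(2)[OF int]) (rule set_integrable_bounded_continuous[OF _ _ fc], auto)
  also have "(LINT z:cball 0 1|lborel. f (c + z)) = (LINT z:cball c 1|lborel. f z)"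
    using integral_lborel_shift[of "\<lambda>z. indicator (cball c 1) z *\<^sub>R f z" c]
    by (simp add: set_lebesgue_integral_def indicator_def dist_norm add.commute[of c])
  also have "(LINT z:cball 0 1|lborel. f z) - (LINT z:cball c 1|lborel. f z)
    = (LINT z|lborel. indicator (cball 0 1) z *\<^sub>R f z - indicator (cball c 1) z *\<^sub>R f z)"
    unfolding set_lebesgue_integral_def
    by (rule Bochner_Integration.integral_diff[symmetric]) (use int in \<open>simp_all add: set_integrable_def\<close>)
  finally have eq: "(LINT z:cball 0 1|lborel. f z - f (c + z)) = \<dots>" .
  have le: "ennreal (cmod (indicator (cball 0 1) z *\<^sub>R f z - indicator (cball c 1) z *\<^sub>R f z))
     \<le> ennreal (cmod (f z)) * indicator (cball 0 (1 + e) - ball 0 (1 - e)) z" for z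
  proof (cases "z \<in> cball 0 (1 + e) - ball 0 (1 - e)")
    case True
    then show ?thesis by (auto simp: indicator_def)
  next
    case False
    have "cmod z \<le> cmod (c - z) + cmod c" "cmod (c - z) \<le> cmod z + cmod c"
      using norm_triangle_ineq4[of c "c - z"] norm_triangle_ineq4[of c z] by auto
    moreover have "1 + e < cmod z \<or> cmod z < 1 - e" using False by auto
    moreover have "0 \<le> e" using c norm_ge_zero[of c] by linarith
    ultimately have "(cmod z \<le> 1) = (cmod (c - z) \<le> 1)" using c by linarith
    then show ?thesis by (simp add: indicator_def dist_norm)
  qed
  show ?thesis unfolding eq
    by (rule order_trans[OF norm_integral_le_nn_integral nn_integral_mono]) (use le in simp)
qed

text \<open>
  Let \<open>V w\<close> be the integral of \<open>\<psi>\<close> over the disc of radius \<open>R\<close> around \<open>w\<close>, rescaled to the unit disc.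
  By \<open>disc_average_deviation\<close> the \<open>L\<^sup>1\<close> distance between \<open>\<pi> \<psi>\<close> and \<open>V\<close> is at most \<open>2 \<pi> R\<close> times the norm of
  \<open>d_zbar \<psi>\<close>. Since \<open>\<psi>\<close> has mean zero, so does \<open>V (w + p)\<close> as a function of \<open>p \<in> A\<close>, and therefore
  \<open>V w\<close> is the average of \<open>V w - V (w + p)\<close>. These differences only see an annulus of relative width
  \<open>d / R\<close>, so the norm of \<open>V\<close> is at most \<open>4 \<pi> d / R\<close> times that of \<open>\<psi>\<close>. For \<open>R = 8 d\<close> this is half of
  what has to be bounded and can be absorbed.
\<close>

lemma (in fundamental_domain) L1_estimate:
  assumes "differentiable_plane_map \<psi> P Q"
    and per: "periodic \<psi>" and perh: "periodic (d_zbar \<psi>)" and bdd: "bounded (range \<psi>)"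
    and mean: "(LINT w:A|lborel. \<psi> w) = 0" and d: "d > 0" "A \<subseteq> cball 0 d"
  shows "(LINT w:A|lborel. cmod (\<psi> w)) \<le> 32 * d * (LINT w:A|lborel. cmod (d_zbar \<psi> w))"
proof -
  interpret differentiable_plane_map \<psi> P Q by fact
  have hz: "d_zbar \<psi> = h" by (simp add: h_eq_d_zbar fun_eq_iff)
  \<comment> \<open>For this radius the annulus below has area \<open>4 \<pi> / 8 = \<pi> / 2\<close>, half of the unit disc.\<close>
  define R where "R = 8 * d"
  have R: "R > 0" using d by (simp add: R_def)
  note c\<psi> = continuous_\<psi>[of UNIV]
  have c\<psi>': "continuous_on X (\<lambda>x. \<psi> (f x))" if "continuous_on X f" for X and f :: "'b::topological_space \<Rightarrow> complex"
    by (rule continuous_on_compose2[OF c\<psi> that]) auto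
  have [measurable]: "\<psi> \<in> borel_measurable borel" by (rule borel_measurable_continuous_onI[OF c\<psi>])
  have [measurable]: "h \<in> borel_measurable borel" by (rule borel_measurable_continuous_onI[OF continuous_h])
  define I where "I f = (LINT w:A|lborel. cmod (f w))" for f
  have I: "(\<integral>\<^sup>+w\<in>A. ennreal (cmod (f w)) \<partial>lborel) = ennreal (I f)" "I f \<ge> 0"
    if "continuous_on UNIV f" for f
  proof -
    have "set_integrable lborel A (\<lambda>w. cmod (f w))"
      by (intro set_integrable_A continuous_intros that)
    then have int: "integrable lborel (\<lambda>w. indicator A w *\<^sub>R cmod (f w))"
      by (simp only: set_integrable_def)
    have "(\<integral>\<^sup>+w\<in>A. ennreal (cmod (f w)) \<partial>lborel) = (\<integral>\<^sup>+w. ennreal (indicator A w *\<^sub>R cmod (f w)) \<partial>lborel)"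
      by (rule nn_integral_cong) (simp add: indicator_def)
    also have "\<dots> = ennreal (I f)"
      unfolding I_def set_lebesgue_integral_def
      by (rule nn_integral_eq_integral[OF int]) simp
    finally show "(\<integral>\<^sup>+w\<in>A. ennreal (cmod (f w)) \<partial>lborel) = ennreal (I f)" .
    show "I f \<ge> 0" unfolding I_def set_lebesgue_integral_def by (intro integral_nonneg_AE) auto
  qed
  define E :: "complex set" where "E = cball 0 (1 + 1/8) - ball 0 (1 - 1/8)"
  define dev where "dev w = (LINT z:cball 0 1|lborel. \<psi> (w + R *\<^sub>R z) - \<psi> w)" for w
  define V where "V w = (LINT z:cball 0 1|lborel. \<psi> (w + R *\<^sub>R z))" for w
  have disc_int: "set_integrable lborel (cball (0::complex) 1) f" if "continuous_on UNIV f" for f :: "complex \<Rightarrow> complex"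
    by (rule set_integrable_bounded_continuous[OF _ _ that]) auto
  have dev_le: "ennreal (cmod (dev w)) \<le> (\<integral>\<^sup>+x\<in>{0..R} \<times> cball 0 1. ennreal (2 * cmod (h (w + fst x *\<^sub>R snd x))) \<partial>lborel)" for w
  proof -
    have "ennreal (cmod (dev w)) \<le> (\<integral>\<^sup>+x\<in>{0..R} \<times> cball 0 1. ennreal (cmod (2 * h (w + fst x *\<^sub>R snd x) * cnj (snd x))) \<partial>lborel)"
      unfolding dev_def disc_average_deviation[OF less_imp_le[OF R]] by (rule norm_set_integral_le_nn_integral)
    also have "\<dots> \<le> (\<integral>\<^sup>+x\<in>{0..R} \<times> cball 0 1. ennreal (2 * cmod (h (w + fst x *\<^sub>R snd x))) \<partial>lborel)"
      by (intro nn_integral_mono) (auto simp: indicator_def norm_mult mult_left_le intro!: ennreal_leI)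
    finally show ?thesis .
  qed
  have V_le: "ennreal (cmod (V w)) \<le> (\<integral>\<^sup>+z\<in>E. ennreal (cmod (\<psi> (w + R *\<^sub>R z))) \<partial>lborel)" for w
  proof -
    have inner: "(LINT p:A|lborel. \<psi> (w + R *\<^sub>R z) - \<psi> (w + p + R *\<^sub>R z)) = \<psi> (w + R *\<^sub>R z)" for z
    proof -
      have "(LINT p:A|lborel. \<psi> (w + R *\<^sub>R z) - \<psi> (p + (w + R *\<^sub>R z)))
        = (LINT p:A|lborel. \<psi> (w + R *\<^sub>R z)) - (LINT p:A|lborel. \<psi> (p + (w + R *\<^sub>R z)))"
        by (rule set_integral_diff(2); rule set_integrable_A) (auto intro!: c\<psi>' continuous_intros)
      also have "(LINT p:A|lborel. \<psi> (p + (w + R *\<^sub>R z))) = 0"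
        using complex_integral_shift[OF c\<psi> per bdd] mean by simp
      also have "(LINT p:A|lborel. \<psi> (w + R *\<^sub>R z)) = \<psi> (w + R *\<^sub>R z)"
        by (simp add: set_lebesgue_integral_def measure_A A_measure A_borel)
      finally show ?thesis by (simp add: add_ac)
    qed
    have "V w = (LINT z:cball 0 1|lborel. LINT p:A|lborel. \<psi> (w + R *\<^sub>R z) - \<psi> (w + p + R *\<^sub>R z))"
      unfolding V_def inner ..
    also have "\<dots> = (LINT p:A|lborel. LINT z:cball 0 1|lborel. \<psi> (w + R *\<^sub>R z) - \<psi> (w + p + R *\<^sub>R z))"
      by (rule set_integral_swap) (auto intro!: c\<psi>' continuous_intros simp: A_borel A_bounded)
    finally have "ennreal (cmod (V w)) \<le> (\<integral>\<^sup>+p\<in>A. ennreal (cmod (LINT z:cball 0 1|lborel. \<psi> (w + R *\<^sub>R z) - \<psi> (w + p + R *\<^sub>R z))) \<partial>lborel)"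
      by (simp only: norm_set_integral_le_nn_integral)
    also have "\<dots> \<le> (\<integral>\<^sup>+p\<in>A. (\<integral>\<^sup>+z\<in>E. ennreal (cmod (\<psi> (w + R *\<^sub>R z))) \<partial>lborel) \<partial>lborel)"
    proof (rule nn_integral_mono)
      fix p
      show "ennreal (cmod (LINT z:cball 0 1|lborel. \<psi> (w + R *\<^sub>R z) - \<psi> (w + p + R *\<^sub>R z))) * indicator A p
        \<le> (\<integral>\<^sup>+z\<in>E. ennreal (cmod (\<psi> (w + R *\<^sub>R z))) \<partial>lborel) * indicator A p"
      proof (cases "p \<in> A")
        case True
        then have small: "cmod (p /\<^sub>R R) \<le> 1/8" using d R by (auto simp: R_def field_simps)
        have shift: "w + p + R *\<^sub>R z = w + R *\<^sub>R (p /\<^sub>R R + z)" for z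
          using R by (simp add: scaleR_add_right)
        have "continuous_on UNIV (\<lambda>z. \<psi> (w + R *\<^sub>R z))"
          by (intro c\<psi>' continuous_intros)
        from disc_integral_translate_diff[OF this small] show ?thesis
          unfolding shift E_def using True by simp
      qed simp
    qed
    also have "\<dots> = (\<integral>\<^sup>+z\<in>E. ennreal (cmod (\<psi> (w + R *\<^sub>R z))) \<partial>lborel) * emeasure lborel A"
      by (rule nn_integral_cmult_indicator) (simp add: A_borel)
    finally show ?thesis by (simp add: A_measure)
  qed
  have split: "pi * cmod (\<psi> w) \<le> cmod (dev w) + cmod (V w)" for w
  proof -
    have "dev w = V w - (LINT z:cball (0::complex) 1|lborel. \<psi> w)"
      unfolding dev_def V_def
      by (intro set_integral_diff(2)[OF disc_int disc_int] c\<psi>' continuous_intros)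
    also have "(LINT z:cball (0::complex) 1|lborel. \<psi> w) = pi *\<^sub>R \<psi> w"
      by (simp add: set_lebesgue_integral_def measure_unit_disc emeasure_disc)
    finally have "pi *\<^sub>R \<psi> w = V w - dev w" by simp
    then have "norm (pi *\<^sub>R \<psi> w) \<le> norm (V w) + norm (dev w)" using norm_triangle_ineq4 by metis
    then show ?thesis by simp
  qed
  let ?F = "\<lambda>w. (\<integral>\<^sup>+x\<in>{0..R} \<times> cball 0 1. ennreal (2 * cmod (h (w + fst x *\<^sub>R snd x))) \<partial>lborel)"
  let ?G = "\<lambda>w. (\<integral>\<^sup>+z\<in>E. ennreal (cmod (\<psi> (w + R *\<^sub>R z))) \<partial>lborel)"
  have Eb [measurable]: "E \<in> sets borel" by (simp add: E_def)
  have emE: "emeasure lborel E = ennreal (pi / 2)"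
    using emeasure_annulus[of "1/8"] by (simp add: E_def)
  have RUb [measurable]: "{0..R} \<times> cball (0::complex) 1 \<in> sets borel"
    by (intro borel_closed closed_Times) auto
  have emRU: "emeasure lborel ({0..R} \<times> cball (0::complex) 1) = ennreal (R * pi)"
    using R by (simp add: lborel_prod[symmetric] lborel.emeasure_pair_measure_Times emeasure_disc ennreal_mult)
  define T where "T x = fst x *\<^sub>R snd x" for x :: "real \<times> complex"
  have T [measurable]: "T \<in> borel_measurable borel"
    unfolding T_def by (intro borel_measurable_continuous_onI continuous_intros)
  have F_eq: "?F = (\<lambda>w. \<integral>\<^sup>+x\<in>{0..R} \<times> cball 0 1. ennreal (2 * cmod (h (w + T x))) \<partial>lborel)"
    by (simp add: T_def)
  have [measurable]: "?F \<in> borel_measurable borel" "?G \<in> borel_measurable borel"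
    unfolding F_eq by measurable
  have "ennreal pi * ennreal (I \<psi>) = (\<integral>\<^sup>+w\<in>A. ennreal (pi * cmod (\<psi> w)) \<partial>lborel)"
    by (subst I(1)[OF c\<psi>, symmetric], subst nn_integral_cmult[symmetric]) (auto simp: ennreal_mult mult.assoc)
  also have "\<dots> \<le> (\<integral>\<^sup>+w. ?F w * indicator A w + ?G w * indicator A w \<partial>lborel)"
  proof (rule nn_integral_mono)
    fix w
    have "ennreal (pi * cmod (\<psi> w)) \<le> ennreal (cmod (dev w)) + ennreal (cmod (V w))"
      using split[of w] by (simp add: ennreal_leI flip: ennreal_plus)
    also have "\<dots> \<le> ?F w + ?G w" using dev_le[of w] V_le[of w] by (rule add_mono)
    finally show "ennreal (pi * cmod (\<psi> w)) * indicator A w \<le> ?F w * indicator A w + ?G w * indicator A w"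
      by (simp add: indicator_def)
  qed
  also have "\<dots> = (\<integral>\<^sup>+w\<in>A. ?F w \<partial>lborel) + (\<integral>\<^sup>+w\<in>A. ?G w \<partial>lborel)"
    by (rule nn_integral_add) (auto simp: A_borel)
  also have "(\<integral>\<^sup>+w\<in>A. ?F w \<partial>lborel) = ennreal (R * pi) * (\<integral>\<^sup>+w\<in>A. ennreal (2 * cmod (h w)) \<partial>lborel)"
    unfolding emRU[symmetric]
    using nn_integral_average_shifts[OF _ _ T RUb, of "\<lambda>w. ennreal (2 * cmod (h w))"] perh
    by (simp add: periodic_def hz T_def)
  also have "(\<integral>\<^sup>+w\<in>A. ennreal (2 * cmod (h w)) \<partial>lborel) = ennreal 2 * ennreal (I h)"
    by (subst I(1)[OF continuous_h, symmetric], subst nn_integral_cmult[symmetric]) (auto simp: ennreal_mult mult.assoc)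
  also have "(\<integral>\<^sup>+w\<in>A. ?G w \<partial>lborel) = ennreal (pi / 2) * ennreal (I \<psi>)"
    using nn_integral_average_shifts[OF _ _ _ Eb, of "\<lambda>w. ennreal (cmod (\<psi> w))" "\<lambda>z. R *\<^sub>R z"] emE
    by (simp add: I(1)[OF c\<psi>] periodic_def per[unfolded periodic_def])
  finally have "ennreal pi * ennreal (I \<psi>) \<le> ennreal (R * pi) * (ennreal 2 * ennreal (I h)) + ennreal (pi / 2) * ennreal (I \<psi>)" .
  moreover have "0 \<le> R * pi" "0 \<le> pi / 2" using R by auto
  ultimately have "ennreal (pi * I \<psi>) \<le> ennreal (R * pi * (2 * I h) + pi / 2 * I \<psi>)"
    using I(2)[OF c\<psi>] I(2)[OF continuous_h]
    by (simp only: ennreal_mult'[symmetric] ennreal_plus[symmetric] mult_nonneg_nonneg pi_ge_zero zero_le_numeral)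
  then have "pi * I \<psi> \<le> R * pi * (2 * I h) + pi / 2 * I \<psi>"
    using R I(2)[OF c\<psi>] I(2)[OF continuous_h] by (subst (asm) ennreal_le_iff) auto
  then have "pi * I \<psi> \<le> pi * (2 * R * I h + I \<psi> / 2)" by (simp add: algebra_simps)
  then have "I \<psi> \<le> 2 * R * I h + I \<psi> / 2" by simp
  then show ?thesis by (simp add: I_def R_def hz)
qed

section \<open>The projection estimate on a uniformized torus\<close>

context uniformized_torus
begin

lemma inj_D: "inj D"
  using chart by (auto simp: complex_coord_def)

text \<open>
  Half open, so that every orbit of the integer translations meets it exactly once.
\<close>

definition cell :: "(real^2) set" where
  "cell = {p. \<forall>i. 0 \<le> p $ i \<and> p $ i < 1}"

definition lattice :: "complex set" where
  "lattice = b ` {m. \<forall>i. m $ i \<in> \<int>}"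

lemma cell_borel: "cell \<in> sets borel"
proof -
  have "cell = (\<Inter>i\<in>UNIV. {p. 0 \<le> p $ i} \<inter> {p. p $ i < 1})" by (auto simp: cell_def)
  also have "\<dots> \<in> sets borel"
    by (intro sets.finite_INT sets.Int borel_closed borel_open closed_Collect_le open_Collect_less
        continuous_intros) auto
  finally show ?thesis .
qed

lemma cell_subset: "cell \<subseteq> cbox 0 1"
  by (auto simp: cell_def mem_box_cart less_imp_le)

lemma D_image_borel: "X \<in> sets borel \<Longrightarrow> D ` X \<in> sets borel"
proof -
  assume X: "X \<in> sets borel"
  have "continuous_on UNIV (inv D)"
    using continuous_on_inverse_open[OF open_UNIV continuous_D, of "inv D"] inj_D surj by simp
  then have "inv D \<in> borel_measurable borel" by (rule borel_measurable_continuous_onI)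
  then have "inv D -` X \<in> sets borel" using X measurable_sets_borel by blast
  moreover have "inv D -` X = D ` X"
    using inj_D surj by (metis bij_betw_def bij_vimage_eq_inv_image inv_inv_eq bij_imp_bij_inv)
  ultimately show ?thesis by simp
qed

text \<open>
  The integer part of a point of the universal cover selects its tile; injectivity of \<open>D\<close> carries this
  over to the image.
\<close>

lemma fundamental_cell: "\<exists>!l. l \<in> lattice \<and> w - l \<in> D ` cell"
proof -
  obtain p where p: "w = D p" using surj by (metis surjD)
  obtain m :: "real^2" where m: "\<forall>i. m $ i \<in> \<int>" "\<forall>i. 0 \<le> (p - m) $ i \<and> (p - m) $ i < 1"
    using fractional_part by blast
  show ?thesis
  proof (rule ex1I[of _ "b m"])
    have "D p = D (p - m) + b m" using equivariant[OF m(1), of "p - m"] by simp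
    then show "b m \<in> lattice \<and> w - b m \<in> D ` cell"
      using m p by (auto simp: lattice_def cell_def)
  next
    fix l assume "l \<in> lattice \<and> w - l \<in> D ` cell"
    then obtain n :: "real^2" and q where n: "\<forall>i. n $ i \<in> \<int>" "l = b n" and q: "q \<in> cell" "w - l = D q"
      by (auto simp: lattice_def)
    have "D p = D (q + n)" using equivariant[OF n(1), of q] n q p by (simp add: algebra_simps)
    then have pq: "p = q + n" using inj_D by (simp add: inj_eq)
    have "n $ i = m $ i" for i
    proof -
      have "n $ i - m $ i \<in> \<int>" using n m by simp
      moreover have "\<bar>n $ i - m $ i\<bar> < 1"
      proof -
        have "0 \<le> q $ i" "q $ i < 1" using q(1) by (simp_all add: cell_def)
        moreover have "0 \<le> q $ i + n $ i - m $ i" "q $ i + n $ i - m $ i < 1"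
          using m(2) unfolding pq by simp_all
        ultimately show ?thesis by linarith
      qed
      ultimately have "n $ i - m $ i = 0" by (metis Ints_nonzero_abs_less1)
      then show ?thesis by simp
    qed
    then have "n = m" by (simp add: vec_eq_iff)
    then show "l = b m" using n by simp
  qed
qed

text \<open>
  The area density is the Jacobian of \<open>D\<close>, so integrals over the torus are Lebesgue integrals over the
  image of the unit square. The boundary that distinguishes \<open>cell\<close> from the closed square is negligible.
\<close>

lemma real_change_of_variables:
  fixes \<phi> :: "complex \<Rightarrow> real"
  assumes \<phi>: "continuous_on UNIV \<phi>"
  shows "torus_integral g (\<lambda>p. \<phi> (D p)) = (LINT w:D ` cell|lborel. \<phi> w)"
proof -
  define k where "k w = (vector [Re w, Im w] :: real^2)" for w
  have ck: "cart_complex (k w) = w" and kc: "k (cart_complex v) = v" for w v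
    by (simp_all add: cart_complex_def k_def vec_eq_iff forall_2)
  have lin_k: "linear k" by (intro linearI) (auto simp: k_def vec_eq_iff forall_2)
  then have bl_k: "bounded_linear k" by (simp add: linear_conv_bounded_linear)
  define G where "G p = k (D p)" for p
  define G' where "G' p v = k (dcoord D p v)" for p v
  \<comment> \<open>Real values are wrapped into \<open>real^1\<close> to match the change of variables theorem.\<close>
  define f :: "real^2 \<Rightarrow> real^1" where "f x = vec (\<phi> (cart_complex x))" for x
  have der: "(G has_derivative G' p) (at p within S)" for p S
    unfolding G_def[abs_def] G'_def[abs_def]
    by (rule bounded_linear.has_derivative[OF bl_k has_derivative_at_withinI[OF D_has_derivative]])
  have det: "\<bar>det (matrix (G' p))\<bar> = jac p" for p
    using jac_pos[of p]
    by (simp add: det_2 matrix_def G'_def k_def jac_def mult.commute)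
  have inj: "inj_on G S" for S
  proof (rule inj_onI)
    fix p q assume "G p = G q"
    then have "cart_complex (k (D p)) = cart_complex (k (D q))" by (simp only: G_def)
    then show "p = q" unfolding ck by (rule injD[OF inj_D])
  qed
  have img: "G ` cell = cart_complex -` (D ` cell)"
  proof (intro equalityI subsetI)
    fix x assume "x \<in> cart_complex -` (D ` cell)"
    then obtain p where "p \<in> cell" "cart_complex x = D p" by blast
    then have "x = G p" using kc[of x] by (simp only: G_def)
    then show "x \<in> G ` cell" using \<open>p \<in> cell\<close> by (rule image_eqI)
  next
    fix x assume "x \<in> G ` cell"
    then obtain p where "p \<in> cell" "x = G p" by blast
    then show "x \<in> cart_complex -` (D ` cell)" by (simp add: G_def ck)
  qed
  have intc: "set_integrable lborel cell (\<lambda>p. jac p *\<^sub>R \<phi> (D p))"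
    by (rule set_integrable_subset[OF torus_integrable[OF \<phi>]]) (use cell_subset cell_borel in auto)
  have bnd: "bounded (D ` cell)"
    using compact_continuous_image[OF continuous_D compact_cbox] cell_subset
    by (meson bounded_subset compact_imp_bounded image_mono)
  have Db: "D ` cell \<in> sets borel" by (rule D_image_borel[OF cell_borel])
  have intA: "set_integrable lborel (D ` cell) \<phi>"
    by (rule set_integrable_bounded_continuous[OF bnd Db \<phi>])
  have distr: "(LINT w:D ` cell|lborel. \<phi> w) = (LINT x:G ` cell|lborel. \<phi> (cart_complex x))"
  proof -
    have "(LINT w:D ` cell|lborel. \<phi> w) = (LINT w:D ` cell|distr lborel borel cart_complex. \<phi> w)"
      by (simp add: lborel_distr_cart_complex)
    also have "\<dots> = (LINT x:G ` cell|lborel. \<phi> (cart_complex x))"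
      unfolding set_lebesgue_integral_def img using Db borel_measurable_continuous_onI[OF \<phi>]
      by (subst integral_distr) (auto simp: indicator_def intro!: Bochner_Integration.integral_cong)
    finally show ?thesis .
  qed
  have intG: "set_integrable lborel (G ` cell) (\<lambda>x. \<phi> (cart_complex x))"
  proof -
    have "integrable (distr lborel borel cart_complex) (\<lambda>w. indicator (D ` cell) w *\<^sub>R \<phi> w)"
      using intA by (simp add: lborel_distr_cart_complex set_integrable_def)
    then have "integrable lborel (\<lambda>x. indicator (D ` cell) (cart_complex x) *\<^sub>R \<phi> (cart_complex x))"
      using Db borel_measurable_continuous_onI[OF \<phi>] by (subst (asm) integrable_distr_eq) auto
    then show ?thesis by (simp add: set_integrable_def img indicator_def)
  qed
  have ai: "f absolutely_integrable_on G ` cell"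
  proof -
    have "(\<lambda>x. \<phi> (cart_complex x)) absolutely_integrable_on G ` cell"
      using intG unfolding set_integrable_def
      by (subst integrable_completion) (rule borel_measurable_integrable)
    then show ?thesis unfolding absolutely_integrable_on_1_iff f_def by simp
  qed
  have eq: "integral cell (\<lambda>p. \<bar>det (matrix (G' p))\<bar> *\<^sub>R f (G p)) = integral (G ` cell) f"
    by (rule integral_change_of_variables[OF _ der inj, symmetric]) (use cell_borel ai in auto)
  have "vec (integral cell (\<lambda>p. jac p *\<^sub>R \<phi> (D p))) = (vec (integral (G ` cell) (\<lambda>x. \<phi> (cart_complex x))) :: real^1)"
    using eq by (simp add: det integral_on_1_eq f_def G_def ck)
  then have "(LINT p:cell|lborel. jac p *\<^sub>R \<phi> (D p)) = (LINT x:G ` cell|lborel. \<phi> (cart_complex x))"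
    unfolding set_borel_integral_eq_integral(2)[OF intG] set_borel_integral_eq_integral(2)[OF intc]
    by (simp add: vec_eq_iff)
  moreover have "torus_integral g (\<lambda>p. \<phi> (D p)) = (LINT p:cell|lborel. jac p *\<^sub>R \<phi> (D p))"
    unfolding torus_integral_jac set_borel_integral_eq_integral(2)[OF intc]
      set_borel_integral_eq_integral(2)[OF torus_integrable[OF \<phi>]]
  proof (rule integral_spike_set)
    have "negligible ({p :: real^2. p $ 1 = 1} \<union> {p. p $ 2 = 1})"
      using negligible_standard_hyperplane[of "axis 1 1 :: real^2" 1]
        negligible_standard_hyperplane[of "axis 2 1 :: real^2" 1]
      by (intro negligible_Un) (simp_all add: inner_axis axis_in_Basis_iff)
    then show "negligible {p \<in> cbox 0 1 - cell. jac p *\<^sub>R \<phi> (D p) \<noteq> 0}"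
      by (rule negligible_subset) (auto simp: cell_def mem_box_cart forall_2)
    show "negligible {p \<in> cell - cbox 0 1. jac p *\<^sub>R \<phi> (D p) \<noteq> 0}"
      using cell_subset by (auto simp: Diff_eq_empty_iff[THEN iffD2])
  qed
  ultimately show ?thesis using distr by simp
qed

lemma bounded_cell_image: "bounded (D ` cell)"
  using compact_continuous_image[OF continuous_D compact_cbox] cell_subset
  by (meson bounded_subset compact_imp_bounded image_mono)

lemma countable_lattice: "countable lattice"
proof -
  have "inj_on (\<lambda>m. (m $ 1, m $ 2)) {m :: real^2. \<forall>i. m $ i \<in> \<int>}"
    by (auto simp: inj_on_def vec_eq_iff forall_2)
  moreover have "(\<lambda>m. (m $ 1, m $ 2)) ` {m :: real^2. \<forall>i. m $ i \<in> \<int>} \<subseteq> \<int> \<times> \<int>" by auto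
  moreover have "countable ((\<int> :: real set) \<times> (\<int> :: real set))"
    by (simp add: Ints_def)
  ultimately have "countable {m :: real^2. \<forall>i. m $ i \<in> \<int>}"
    by (meson countable_image_inj_on countable_subset)
  then show ?thesis unfolding lattice_def by (rule countable_image)
qed

lemma uminus_lattice: "l \<in> lattice \<Longrightarrow> - l \<in> lattice"
proof -
  assume "l \<in> lattice"
  then obtain m :: "real^2" where m: "\<forall>i. m $ i \<in> \<int>" "l = b m" by (auto simp: lattice_def)
  have m': "\<forall>i. (- m) $ i \<in> \<int>" using m by simp
  have "D 0 = D (- m) + b m" using equivariant[OF m(1), of "- m"] by simp
  moreover have "D (- m) = D 0 + b (- m)" using equivariant[OF m', of 0] by simp
  ultimately have "b (- m) = - l" using m(2) by (simp add: add_eq_0_iff)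
  moreover have "b (- m) \<in> lattice" unfolding lattice_def using m' by (intro imageI CollectI)
  ultimately show "- l \<in> lattice" by (simp only:)
qed

lemma measure_cell_image: "emeasure lborel (D ` cell) = 1"
proof -
  have "(LINT w:D ` cell|lborel. 1 :: real) = 1"
    using real_change_of_variables[of "\<lambda>_. 1"] unit_area by (simp add: torus_area_def)
  moreover have "emeasure lborel (D ` cell) < \<infinity>"
    by (rule emeasure_bounded_finite[OF bounded_cell_image])
  ultimately show ?thesis
    using D_image_borel[OF cell_borel] by (simp add: set_lebesgue_integral_def emeasure_eq_ennreal_measure less_top)
qed

sublocale fundamental_domain "D ` cell" lattice
  using D_image_borel[OF cell_borel] bounded_cell_image measure_cell_image countable_lattice
    uminus_lattice fundamental_cell
  by unfold_locales auto

lemma periodic_iff: "periodic \<phi> \<longleftrightarrow> lattice_periodic \<phi>"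
  unfolding periodic_def lattice_periodic_def by (auto simp: lattice_def)

lemma complex_change_of_variables:
  fixes \<phi> :: "complex \<Rightarrow> complex"
  assumes \<phi>: "continuous_on UNIV \<phi>"
  shows "torus_integral g (\<lambda>p. \<phi> (D p)) = (LINT w:D ` cell|lborel. \<phi> w)"
proof -
  have i1: "integrable lborel (\<lambda>p. indicator (cbox 0 1) p *\<^sub>R (jac p *\<^sub>R \<phi> (D p)))"
    using torus_integrable[OF \<phi>] by (simp only: set_integrable_def)
  have i2: "integrable lborel (\<lambda>w. indicator (D ` cell) w *\<^sub>R \<phi> w)"
    using set_integrable_A[OF \<phi>] by (simp only: set_integrable_def)
  have "Re (torus_integral g (\<lambda>p. \<phi> (D p))) = torus_integral g (\<lambda>p. Re (\<phi> (D p)))"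
    "Im (torus_integral g (\<lambda>p. \<phi> (D p))) = torus_integral g (\<lambda>p. Im (\<phi> (D p)))"
    using integral_Re[OF i1] integral_Im[OF i1] by (simp_all add: torus_integral_jac set_lebesgue_integral_def mult.assoc)
  moreover have "Re (LINT w:D ` cell|lborel. \<phi> w) = (LINT w:D ` cell|lborel. Re (\<phi> w))"
    "Im (LINT w:D ` cell|lborel. \<phi> w) = (LINT w:D ` cell|lborel. Im (\<phi> w))"
    using integral_Re[OF i2] integral_Im[OF i2] by (simp_all add: set_lebesgue_integral_def)
  ultimately show ?thesis
    using real_change_of_variables[OF continuous_on_Re[OF \<phi>]] real_change_of_variables[OF continuous_on_Im[OF \<phi>]]
    by (simp add: complex_eq_iff)
qed

lemma d_zbar_lattice_periodic:
  assumes per: "lattice_periodic \<psi>" and diff: "\<And>w. \<psi> differentiable (at w)"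
  shows "lattice_periodic (d_zbar \<psi>)"
  unfolding lattice_periodic_def
proof (intro allI impI)
  fix w and m :: "real^2" assume m: "\<forall>i. m $ i \<in> \<int>"
  have eq: "\<psi> (x + b m) = \<psi> x" for x using per m unfolding lattice_periodic_def by blast
  have "((\<lambda>x. \<psi> (x + b m)) has_derivative frechet_derivative \<psi> (at (w + b m))) (at w)"
    by (rule has_derivative_compose[of "\<lambda>q. q + b m" "\<lambda>v. v" w UNIV \<psi>, simplified])
       (use diff in \<open>auto intro!: derivative_eq_intros simp flip: frechet_derivative_works\<close>)
  then have "frechet_derivative \<psi> (at w) = frechet_derivative \<psi> (at (w + b m))"
    unfolding eq by (metis frechet_derivative_at)
  then show "d_zbar \<psi> (w + b m) = d_zbar \<psi> w" by (simp add: d_zbar_def)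
qed

text \<open>
  The projection subtracts the mean of the coefficient, which leaves \<open>d_zbar\<close> unchanged, so the
  estimate for functions of mean zero applies.
\<close>

theorem projection_estimate:
  "\<exists>C. \<forall>\<Psi>\<in>quad_diffs g. qd_L1_norm g (\<Psi> - hol_proj g \<Psi>) \<le> C * dbar_type_L1_norm g (dbar g \<Psi>)"
proof -
  obtain d where d: "d > 0" "D ` cell \<subseteq> cball 0 d"
    using bounded_cell_image[unfolded bounded_pos] by (metis mem_cball_0 subsetI)
  have "qd_L1_norm g (\<Psi> - hol_proj g \<Psi>) \<le> (32 * d / sqrt 2) * dbar_type_L1_norm g (dbar g \<Psi>)"
    if \<Psi>: "\<Psi> \<in> quad_diffs g" for \<Psi>
  proof -
    obtain \<psi> where \<psi>: "smooth_on UNIV \<psi>" "lattice_periodic \<psi>" "\<Psi> = qd \<psi>"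
      using quad_diffs_obtain[OF \<Psi>] by blast
    have c\<psi>: "continuous_on UNIV \<psi>" by (rule smooth_on_continuous[OF \<psi>(1)])
    have diff: "\<psi> differentiable (at w)" for w by (rule smooth_on_differentiable[OF \<psi>(1)]) simp
    define c where "c = torus_integral g (\<lambda>p. \<psi> (D p))"
    define \<phi> where "\<phi> w = \<psi> w - c" for w
    define P where "P w = frechet_derivative \<psi> (at w) 1" for w
    define Q where "Q w = frechet_derivative \<psi> (at w) \<i>" for w
    have der\<psi>: "(\<psi> has_derivative (\<lambda>v. Re v *\<^sub>R P w + Im v *\<^sub>R Q w)) (at w)" for w
    proof -
      have der: "(\<psi> has_derivative frechet_derivative \<psi> (at w)) (at w)"
        using diff by (simp add: frechet_derivative_works)
      have fd: "frechet_derivative \<psi> (at w) v = Re v *\<^sub>R P w + Im v *\<^sub>R Q w" for v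
      proof -
        interpret bounded_linear "frechet_derivative \<psi> (at w)" using der by (rule has_derivative_bounded_linear)
        have "frechet_derivative \<psi> (at w) v = frechet_derivative \<psi> (at w) (Re v *\<^sub>R 1 + Im v *\<^sub>R \<i>)"
          by (rule arg_cong[of v]) (simp add: complex_eq_iff)
        then show ?thesis by (simp only: add scaleR P_def Q_def)
      qed
      show ?thesis by (rule has_derivative_eq_rhs[OF der]) (simp add: fd fun_eq_iff)
    qed
    have der\<phi>: "(\<phi> has_derivative (\<lambda>v. Re v *\<^sub>R P w + Im v *\<^sub>R Q w)) (at w)" for w
      unfolding \<phi>_def[abs_def] using has_derivative_diff[OF der\<psi> has_derivative_const, of c w] by simp
    have c\<phi>: "continuous_on UNIV \<phi>" unfolding \<phi>_def[abs_def] by (intro continuous_intros c\<psi>)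
    have dz: "d_zbar \<phi> = d_zbar \<psi>"
      using frechet_derivative_at[OF der\<phi>] frechet_derivative_at[OF der\<psi>] by (simp add: d_zbar_def fun_eq_iff)
    have per: "lattice_periodic \<phi>" using \<psi>(2) by (auto simp: lattice_periodic_def \<phi>_def)
    have plane: "differentiable_plane_map \<phi> P Q"
      by unfold_locales (use der\<phi> smooth_on_continuous[OF smooth_on_frechet_derivative[OF \<psi>(1)]]
        in \<open>auto simp: P_def[abs_def] Q_def[abs_def]\<close>)
    have cdz: "continuous_on UNIV (d_zbar \<psi>)"
      using differentiable_plane_map.continuous_h[OF plane] differentiable_plane_map.h_eq_d_zbar[OF plane]
      by (simp add: dz)
    have "(LINT w:D ` cell|lborel. \<phi> w) = torus_integral g (\<lambda>p. \<phi> (D p))"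
      by (rule complex_change_of_variables[OF c\<phi>, symmetric])
    also have "\<dots> = 0" unfolding \<phi>_def torus_integral_diff_const[OF c\<psi>] by (simp add: c_def)
    finally have mean: "(LINT w:D ` cell|lborel. \<phi> w) = 0" .
    have "(LINT w:D ` cell|lborel. cmod (\<phi> w)) \<le> 32 * d * (LINT w:D ` cell|lborel. cmod (d_zbar \<phi> w))"
      by (rule L1_estimate[OF plane _ _ _ mean d])
        (use per d_zbar_lattice_periodic[OF \<psi>(2) diff] lattice_periodic_bounded[OF per c\<phi>] in
          \<open>simp_all add: periodic_iff dz\<close>)
    moreover have "qd_L1_norm g (\<Psi> - hol_proj g \<Psi>) = 2 * (LINT w:D ` cell|lborel. cmod (\<phi> w))"
    proof -
      have "\<Psi> - hol_proj g \<Psi> = qd \<phi>"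
        by (simp add: \<psi>(3) hol_proj_qd[OF c\<psi>] qd_minus_const \<phi>_def[abs_def] c_def)
      then have "qd_L1_norm g (\<Psi> - hol_proj g \<Psi>) = torus_integral g (\<lambda>p. (\<lambda>w. 2 * cmod (\<phi> w)) (D p))"
        by (simp add: qd_L1_norm_def qd_norm_qd[abs_def])
      also have "\<dots> = (LINT w:D ` cell|lborel. 2 * cmod (\<phi> w))"
        by (rule real_change_of_variables) (intro continuous_intros c\<phi>)
      finally show ?thesis by simp
    qed
    moreover have "dbar_type_L1_norm g (dbar g \<Psi>) = 2 * sqrt 2 * (LINT w:D ` cell|lborel. cmod (d_zbar \<psi> w))"
    proof -
      have "dbar_type_L1_norm g (dbar g \<Psi>) = torus_integral g (\<lambda>p. (\<lambda>w. 2 * sqrt 2 * cmod (d_zbar \<psi> w)) (D p))"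
        unfolding dbar_type_L1_norm_def \<psi>(3) by (rule arg_cong[of _ _ "torus_integral g"])
          (simp add: fun_eq_iff dbar_type_norm_qd[OF diff])
      also have "\<dots> = (LINT w:D ` cell|lborel. 2 * sqrt 2 * cmod (d_zbar \<psi> w))"
        by (rule real_change_of_variables) (intro continuous_intros cdz)
      finally show ?thesis by simp
    qed
    ultimately show ?thesis by (simp add: dz)
  qed
  then show ?thesis by blast
qed

end

section \<open>Existence of a developing map\<close>

lemma complex_coord_subset:
  assumes "complex_coord g U z \<rho>" "open V" "V \<subseteq> U" shows "complex_coord g V z \<rho>"
  using assms smooth_on_subset[of U z V] inj_on_subset[of z U V]
  unfolding complex_coord_def by (auto dest: subsetD)

lemma complex_coord_cong:
  assumes cc: "complex_coord g U z \<rho>" and eq: "\<And>p. p \<in> U \<Longrightarrow> z p = f p"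
  shows "complex_coord g U f \<rho>"
proof -
  have op: "open U" and sm: "smooth_on U z" using cc by (auto simp: complex_coord_def)
  have d: "dcoord f p = dcoord z p" if "p \<in> U" for p
  proof -
    have "(f has_derivative dcoord z p) (at p)"
      by (rule has_derivative_transform_within_open[OF complex_coord_has_derivative[OF cc that] op that eq])
    then show ?thesis by (rule frechet_derivative_at[symmetric])
  qed
  have "smooth_on U f" by (rule smooth_on_cong[OF op eq sm])
  moreover have "inj_on f U \<longleftrightarrow> inj_on z U" using eq by (auto simp: inj_on_def)
  ultimately show ?thesis using cc d unfolding complex_coord_def by simp
qed

lemma complex_coord_rigid_motion:
  assumes cc: "complex_coord g U z \<rho>" and a: "cmod a = 1"
  shows "complex_coord g U (\<lambda>p. a * z p + c) \<rho>"
proof -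
  have op: "open U" and sm: "smooth_on U z" and inj: "inj_on z U" using cc by (auto simp: complex_coord_def)
  have d: "dcoord (\<lambda>p. a * z p + c) p = (\<lambda>v. a * dcoord z p v)" if "p \<in> U" for p
  proof -
    have "((\<lambda>p. a * z p + c) has_derivative (\<lambda>v. a * dcoord z p v + 0)) (at p)"
      by (intro has_derivative_add has_derivative_mult_right has_derivative_const complex_coord_has_derivative[OF cc that])
    from frechet_derivative_at[OF this, symmetric] show ?thesis by simp
  qed
  have aa: "cnj a * a = 1" using a by (simp add: complex_norm_square[symmetric] mult.commute[of "cnj a"])
  have "cnj (a * x) * (a * y) = (cnj a * a) * (cnj x * y)" for x y by (simp add: mult_ac)
  then have im: "cnj (a * x) * (a * y) = cnj x * y" for x y by (simp only: aa mult_1_left)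
  have inn: "(a * x) \<bullet> (a * y) = x \<bullet> y" for x y
  proof -
    have "u \<bullet> v = Re (cnj u * v)" for u v by (simp add: inner_complex_def)
    then show ?thesis by (simp only: im)
  qed
  have "smooth_on U (\<lambda>p. a * z p + c)"
    by (intro smooth_on_add smooth_on_mult smooth_on_const sm op)
  moreover have "inj_on (\<lambda>p. a * z p + c) U"
    using inj a by (auto simp: inj_on_def)
  moreover have "0 < Im (cnj (dcoord (\<lambda>p. a * z p + c) p (axis 1 1)) * dcoord (\<lambda>p. a * z p + c) p (axis 2 1))"
    "0 < \<rho> p" "g p v w = (\<rho> p)\<^sup>2 * (dcoord (\<lambda>p. a * z p + c) p v \<bullet> dcoord (\<lambda>p. a * z p + c) p w)"
    if "p \<in> U" for p v w
    using cc that unfolding d[OF that] im inn complex_coord_def by blast+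
  ultimately show ?thesis unfolding complex_coord_def using op by blast
qed

lemma complex_coord_shift:
  fixes m :: "real^2"
  assumes cc: "complex_coord g U z (\<lambda>_. 1)" and per: "torus_periodic g" and m: "\<forall>i. m $ i \<in> \<int>"
  shows "complex_coord g ((\<lambda>x. x - m) ` U) (\<lambda>p. z (p + m)) (\<lambda>_. 1)"
proof -
  have op: "open U" and sm: "smooth_on U z" and inj: "inj_on z U" using cc by (auto simp: complex_coord_def)
  let ?U = "(\<lambda>x. x - m) ` U"
  have mem: "p + m \<in> U" if "p \<in> ?U" for p using that by auto
  have d: "dcoord (\<lambda>p. z (p + m)) p = dcoord z (p + m)" if "p \<in> ?U" for p
  proof -
    have "((\<lambda>q. z (q + m)) has_derivative dcoord z (p + m)) (at p)"
      by (rule has_derivative_compose[of "\<lambda>q. q + m" "\<lambda>v. v" p UNIV z, simplified])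
         (auto intro!: derivative_eq_intros complex_coord_has_derivative[OF cc mem[OF that]])
    then show ?thesis by (rule frechet_derivative_at[symmetric])
  qed
  have gm: "g (p + m) = g p" for p using per m unfolding torus_periodic_def by blast
  have "open ?U"
    using open_translation[OF op, of "- m"] by (simp add: image_def)
  moreover have "smooth_on ?U (\<lambda>p. z (p + m))" by (rule smooth_on_shift[OF op sm])
  moreover have "inj_on (\<lambda>p. z (p + m)) ?U" using inj by (auto simp: inj_on_def)
  moreover have "0 < Im (cnj (dcoord (\<lambda>p. z (p + m)) p (axis 1 1)) * dcoord (\<lambda>p. z (p + m)) p (axis 2 1))"
    "g p v w = 1\<^sup>2 * (dcoord (\<lambda>p. z (p + m)) p v \<bullet> dcoord (\<lambda>p. z (p + m)) p w)"
    if "p \<in> ?U" for p v w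
    using cc mem[OF that] gm[of p] unfolding d[OF that] complex_coord_def by fastforce+
  ultimately show ?thesis unfolding complex_coord_def by simp
qed

text \<open>
  The transition function is holomorphic and its derivative has modulus one. By the maximum modulus
  principle the derivative is constant.
\<close>

lemma unit_coords_differ_locally_by_rigid_motion:
  assumes z: "complex_coord g U z (\<lambda>_. 1)" and f: "complex_coord g V f (\<lambda>_. 1)" and p: "p \<in> U" "p \<in> V"
  shows "\<exists>W a c. open W \<and> p \<in> W \<and> cmod a = 1 \<and> (\<forall>q\<in>W. f q = a * z q + c)"
proof -
  have "open (U \<inter> V)" using z f by (auto simp: complex_coord_def)
  then obtain r where r: "r > 0" "ball p r \<subseteq> U \<inter> V" using p by (meson IntI openE)
  define W where "W = ball p r"
  have W: "open W" "p \<in> W" "connected W" "W \<subseteq> U" "W \<subseteq> V" using r by (auto simp: W_def)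
  have zW: "complex_coord g W z (\<lambda>_. 1)" by (rule complex_coord_subset[OF z W(1,4)])
  define S where "S w = f (inv_into W z w)" for w
  have opS: "open (z ` W)" by (rule complex_coord_open_image[OF zW])
  have conS: "connected (z ` W)"
    by (rule connected_continuous_image[OF complex_coord_continuous[OF zW] W(3)])
  have ex: "\<exists>\<tau>. cmod \<tau> = 1 \<and> (S has_field_derivative \<tau>) (at w)" if "w \<in> z ` W" for w
  proof -
    obtain q where q: "q \<in> W" "w = z q" using \<open>w \<in> z ` W\<close> by blast
    then have qV: "q \<in> V" using W by blast
    obtain \<tau> where \<tau>: "cmod \<tau> = 1" "\<And>v. dcoord f q v = \<tau> * dcoord z q v"
      using transition_factor[OF zW f q(1) qV] by auto
    have "(S has_field_derivative \<tau>) (at w)"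
      unfolding S_def q(2)
      by (rule has_field_derivative_in_coord[OF zW q(1) complex_coord_has_derivative[OF f qV] \<tau>(2)])
    then show ?thesis using \<tau>(1) by blast
  qed
  have hol: "S holomorphic_on z ` W" using ex opS by (auto simp: holomorphic_on_open)
  have unit: "cmod (deriv S w) = 1" and der: "(S has_field_derivative deriv S w) (at w)" if "w \<in> z ` W" for w
    using ex[OF that] DERIV_imp_deriv by blast+
  have zp: "z p \<in> z ` W" using W by blast
  have "deriv S constant_on z ` W"
    by (rule maximum_modulus_principle[OF holomorphic_deriv[OF hol opS] opS conS opS subset_refl zp])
      (simp add: unit zp)
  then obtain a where a: "\<And>w. w \<in> z ` W \<Longrightarrow> deriv S w = a" unfolding constant_on_def by blast
  have "((\<lambda>w. S w - a * w) has_field_derivative 0) (at w)" if "w \<in> z ` W" for w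
    using der[OF that] a[OF that] by (auto intro!: derivative_eq_intros)
  then have "(\<lambda>w. S w - a * w) constant_on z ` W"
    by (rule has_field_derivative_0_imp_constant_on[OF _ conS opS])
  then obtain c where c: "\<And>w. w \<in> z ` W \<Longrightarrow> S w - a * w = c" unfolding constant_on_def by blast
  have "f q = a * z q + c" if "q \<in> W" for q
  proof -
    have "S (z q) = f q" using zW that by (simp add: S_def complex_coord_def)
    then show ?thesis using c[of "z q"] that by (simp add: algebra_simps)
  qed
  moreover have "cmod a = 1" using unit[OF zp] a[OF zp] by simp
  ultimately show ?thesis using W by blast
qed

text \<open>
  Injectivity is demanded only near each point: this is what survives gluing. Global injectivity is
  a consequence of the compactness of the torus.
\<close>

definition developing_on :: "metric \<Rightarrow> (real^2) set \<Rightarrow> (real^2 \<Rightarrow> complex) \<Rightarrow> bool" where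
  "developing_on g U f \<longleftrightarrow> open U \<and> (\<forall>p\<in>U. \<exists>V. p \<in> V \<and> complex_coord g V f (\<lambda>_. 1))"

lemma developing_on_chart:
  assumes "developing_on g U f" "p \<in> U"
  obtains V where "p \<in> V" "V \<subseteq> U" "complex_coord g V f (\<lambda>_. 1)"
proof -
  obtain V where V: "p \<in> V" "complex_coord g V f (\<lambda>_. 1)" using assms by (auto simp: developing_on_def)
  moreover have "open (V \<inter> U)" using V assms by (auto simp: developing_on_def complex_coord_def)
  ultimately show ?thesis
    using that[of "V \<inter> U"] complex_coord_subset[OF V(2), of "V \<inter> U"] assms by blast
qed

lemma developing_on_subset:
  "developing_on g U f \<Longrightarrow> open V \<Longrightarrow> V \<subseteq> U \<Longrightarrow> developing_on g V f"
  unfolding developing_on_def by blast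

lemma developing_on_cong:
  assumes "developing_on g U f" "\<And>p. p \<in> U \<Longrightarrow> f p = h p" shows "developing_on g U h"
  unfolding developing_on_def
proof (intro conjI ballI)
  show "open U" using assms by (simp add: developing_on_def)
  fix p assume "p \<in> U"
  then obtain V where V: "p \<in> V" "V \<subseteq> U" "complex_coord g V f (\<lambda>_. 1)"
    using developing_on_chart[OF assms(1)] by blast
  then show "\<exists>V. p \<in> V \<and> complex_coord g V h (\<lambda>_. 1)"
    using complex_coord_cong[OF V(3), of h] assms(2) by blast
qed

lemma developing_on_Un:
  "developing_on g U f \<Longrightarrow> developing_on g V f \<Longrightarrow> developing_on g (U \<union> V) f"
  unfolding developing_on_def by blast

lemma developing_on_rigid_motion:
  "developing_on g U f \<Longrightarrow> cmod a = 1 \<Longrightarrow> developing_on g U (\<lambda>p. a * f p + c)"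
  unfolding developing_on_def using complex_coord_rigid_motion by blast

text \<open>
  The rotation and the translation that take one developing map to the other can be read off at any
  point. They are locally constant, hence constant.
\<close>

lemma developing_map_rigidity:
  assumes f: "developing_on g U f" and h: "developing_on g U h" and U: "connected U" "U \<noteq> {}"
  shows "\<exists>a c. cmod a = 1 \<and> (\<forall>q\<in>U. h q = a * f q + c)"
proof -
  define e :: "real^2" where "e = axis 1 1"
  \<comment> \<open>The rotation that takes \<open>f\<close> to \<open>h\<close> near \<open>q\<close>; the second component of \<open>K\<close> is the translation.\<close>
  define A where "A q = dcoord h q e / dcoord f q e" for q
  define K where "K q = (A q, h q - A q * f q)" for q
  have loc: "\<exists>W a c. open W \<and> p \<in> W \<and> cmod a = 1 \<and> (\<forall>q\<in>W. q \<in> U \<longrightarrow> K q = (a, c))" if p: "p \<in> U" for p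
  proof -
    obtain V where V: "p \<in> V" "complex_coord g V f (\<lambda>_. 1)" using f p by (auto simp: developing_on_def)
    obtain V' where V': "p \<in> V'" "complex_coord g V' h (\<lambda>_. 1)" using h p by (auto simp: developing_on_def)
    obtain W a c where W: "open W" "p \<in> W" "cmod a = 1" "\<And>q. q \<in> W \<Longrightarrow> h q = a * f q + c"
      using unit_coords_differ_locally_by_rigid_motion[OF V(2) V'(2) V(1) V'(1)] by blast
    have "K q = (a, c)" if q: "q \<in> W" "q \<in> U" for q
    proof -
      obtain X where X: "q \<in> X" "complex_coord g X f (\<lambda>_. 1)" using f q by (auto simp: developing_on_def)
      have "((\<lambda>p. a * f p + c) has_derivative (\<lambda>v. a * dcoord f q v + 0)) (at q)"
        by (intro has_derivative_add has_derivative_mult_right has_derivative_const complex_coord_has_derivative[OF X(2,1)])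
      then have "(h has_derivative (\<lambda>v. a * dcoord f q v + 0)) (at q)"
        by (rule has_derivative_transform_within_open[OF _ W(1) q(1)]) (simp add: W(4))
      from frechet_derivative_at[OF this, symmetric] have "dcoord h q e = a * dcoord f q e"
        by simp
      moreover have "dcoord f q e \<noteq> 0" unfolding e_def by (rule dcoord_axis_nonzero[OF X(2,1)])
      ultimately show ?thesis using W(4)[OF q(1)] by (simp add: K_def A_def)
    qed
    then show ?thesis using W by blast
  qed
  have "K constant_on U"
  proof (rule locally_constant_imp_constant[OF U(1)])
    fix p assume p: "p \<in> U"
    obtain W a c where W: "open W" "p \<in> W" "\<forall>q\<in>W. q \<in> U \<longrightarrow> K q = (a, c)" using loc[OF p] by blast
    show "\<exists>T. openin (top_of_set U) T \<and> p \<in> T \<and> (\<forall>x\<in>T. K x = K p)"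
      by (rule exI[of _ "U \<inter> W"]) (use W p openin_open_Int in auto)
  qed
  then obtain k where k: "\<And>q. q \<in> U \<Longrightarrow> K q = k" unfolding constant_on_def by blast
  obtain p where p: "p \<in> U" using U by blast
  obtain a c where ac: "cmod a = 1" "K p = (a, c)" using loc[OF p] p by blast
  have "h q = a * f q + c" if "q \<in> U" for q
  proof -
    have "K q = (a, c)" using k[OF that] k[OF p] ac(2) by (rule trans[OF _ trans[OF sym]])
    then have "A q = a" "h q - A q * f q = c" unfolding K_def by auto
    then show ?thesis by (auto simp: algebra_simps)
  qed
  then show ?thesis using ac(1) by blast
qed

text \<open>
  A rigid motion that fixes two distinct points is the identity.
\<close>

lemma developing_map_eq:
  assumes f: "developing_on g U f" and h: "developing_on g U h" and U: "connected U"
    and O': "open O'" "O' \<noteq> {}" "O' \<subseteq> U" and eq: "\<And>q. q \<in> O' \<Longrightarrow> f q = h q" and q: "q \<in> U"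
  shows "f q = h q"
proof -
  obtain a c where ac: "\<And>q. q \<in> U \<Longrightarrow> h q = a * f q + c"
    using developing_map_rigidity[OF f h U] q by blast
  obtain p where p: "p \<in> O'" using O' by blast
  obtain V where V: "p \<in> V" "complex_coord g V f (\<lambda>_. 1)" using f p O' by (auto simp: developing_on_def)
  have "open (V \<inter> O')" using V O' by (auto simp: complex_coord_def)
  then have "infinite (V \<inter> O')" using p V by (intro infinite_openin[of UNIV] ) (auto intro: open_imp_islimpt)
  then obtain r where r: "r \<in> V \<inter> O'" "r \<noteq> p"
    by (metis finite.emptyI finite.insertI finite_subset insertI1 subsetI)
  have "f r \<noteq> f p" using V r p by (auto simp: complex_coord_def inj_on_def)
  moreover have "f p = a * f p + c" "f r = a * f r + c"
    using ac[of p] ac[of r] eq[OF p] eq[of r] r p O' by auto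
  ultimately have "a = 1" "c = 0"
  proof -
    have "(1 - a) * (f r - f p) = 0"
      using \<open>f p = a * f p + c\<close> \<open>f r = a * f r + c\<close> by algebra
    then show "a = 1" using \<open>f r \<noteq> f p\<close> by simp
    then show "c = 0" using \<open>f p = a * f p + c\<close> by simp
  qed
  then show ?thesis using ac[OF q] by simp
qed

text \<open>
  Moving the second map by a rigid motion makes the two agree on the overlap, whose connectedness
  ensures that one motion suffices.
\<close>

lemma developing_map_glue:
  assumes f: "developing_on g U f" and h: "developing_on g V h"
    and UV: "connected (U \<inter> V)" "U \<inter> V \<noteq> {}"
  shows "\<exists>k. developing_on g (U \<union> V) k"
proof -
  have op: "open (U \<inter> V)" using f h by (auto simp: developing_on_def)
  have f': "developing_on g (U \<inter> V) f" by (rule developing_on_subset[OF f op]) auto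
  have h': "developing_on g (U \<inter> V) h" by (rule developing_on_subset[OF h op]) auto
  obtain a c where ac: "cmod a = 1" "\<And>q. q \<in> U \<inter> V \<Longrightarrow> f q = a * h q + c"
    using developing_map_rigidity[OF h' f' UV] by blast
  define k where "k q = (if q \<in> U then f q else a * h q + c)" for q
  have "developing_on g U k"
    by (rule developing_on_cong[OF f]) (simp add: k_def)
  moreover have "developing_on g V k"
    by (rule developing_on_cong[OF developing_on_rigid_motion[OF h ac(1)]]) (use ac in \<open>auto simp: k_def\<close>)
  ultimately show ?thesis using developing_on_Un by blast
qed

definition rect :: "real \<Rightarrow> real \<Rightarrow> real \<Rightarrow> real \<Rightarrow> (real^2) set" where
  "rect a b c d = {p. a < p $ 1 \<and> p $ 1 < b \<and> c < p $ 2 \<and> p $ 2 < d}"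

lemma rect_eq_box: "rect a b c d = box (vector [a, c]) (vector [b, d])"
  by (auto simp: rect_def mem_box_cart forall_2)

lemma open_rect: "open (rect a b c d)" by (simp add: rect_eq_box open_box)
lemma connected_rect: "connected (rect a b c d)" by (simp add: rect_eq_box convex_connected)

lemma rect_nonempty: "a < b \<Longrightarrow> c < d \<Longrightarrow> rect a b c d \<noteq> {}"
proof -
  assume "a < b" "c < d"
  then have "vector [(a + b) / 2, (c + d) / 2] \<in> rect a b c d" by (simp add: rect_def)
  then show ?thesis by blast
qed

lemma rect_subset: "a \<le> a' \<Longrightarrow> b' \<le> b \<Longrightarrow> c \<le> c' \<Longrightarrow> d' \<le> d \<Longrightarrow> rect a' b' c' d' \<subseteq> rect a b c d"
  by (auto simp: rect_def)

text \<open>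
  Charts are glued along a horizontal segment, and the strips obtained in this way are then glued
  vertically to rectangles. Overlaps of axis-parallel rectangles are rectangles and thus connected,
  which takes the place of a monodromy argument.
\<close>

lemma developing_map_strip:
  assumes flat: "flat_metric g" and ab: "a \<le> b"
  shows "\<exists>e>0. \<exists>f. developing_on g (rect (a - e) (b + e) (y - e) (y + e)) f"
proof -
  define P where "P a b \<longleftrightarrow> (\<exists>e>0. \<exists>f. developing_on g (rect (a - e) (b + e) (y - e) (y + e)) f)" for a b
  have "P a b"
  proof (rule Bolzano[OF ab])
    fix a b c assume "P a b" "P b c" "a \<le> b" "b \<le> c"
    note trans = this[unfolded P_def]
    obtain e1 f1 where 1: "e1 > 0" "developing_on g (rect (a - e1) (b + e1) (y - e1) (y + e1)) f1" using trans(1) by blast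
    obtain e2 f2 where 2: "e2 > 0" "developing_on g (rect (b - e2) (c + e2) (y - e2) (y + e2)) f2" using trans(2) by blast
    define e where "e = min e1 e2"
    have e: "e > 0" "e \<le> e1" "e \<le> e2" using 1 2 by (auto simp: e_def)
    have d1: "developing_on g (rect (a - e) (b + e) (y - e) (y + e)) f1"
      by (rule developing_on_subset[OF 1(2) open_rect rect_subset]) (use e in auto)
    have d2: "developing_on g (rect (b - e) (c + e) (y - e) (y + e)) f2"
      by (rule developing_on_subset[OF 2(2) open_rect rect_subset]) (use e in auto)
    have int: "rect (a - e) (b + e) (y - e) (y + e) \<inter> rect (b - e) (c + e) (y - e) (y + e) = rect (b - e) (b + e) (y - e) (y + e)"
      using trans(3,4) by (auto simp: rect_def)
    have un: "rect (a - e) (b + e) (y - e) (y + e) \<union> rect (b - e) (c + e) (y - e) (y + e) = rect (a - e) (c + e) (y - e) (y + e)"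
      using trans(3,4) e by (auto simp: rect_def)
    have "\<exists>k. developing_on g (rect (a - e) (c + e) (y - e) (y + e)) k"
      using developing_map_glue[OF d1 d2] unfolding int un using connected_rect rect_nonempty[of "b - e" "b + e" "y - e" "y + e"] e by simp
    then show "P a c" unfolding P_def using e by blast
  next
    fix x
    obtain U z where U: "vector [x, y] \<in> U" "complex_coord g U z (\<lambda>_. 1)"
      using flat unfolding flat_metric_def by blast
    then have "open U" by (auto simp: complex_coord_def)
    then obtain r where r: "r > 0" "ball (vector [x, y]) r \<subseteq> U" using U(1) by (meson openE)
    \<comment> \<open>The rectangle \<open>sub\<close> speaks of has half-width \<open>2 d\<close>, hence \<open>l\<^sup>1\<close>-radius \<open>4 d = r\<close>.\<close>
    define d where "d = r / 4"
    have d: "d > 0" using r by (simp add: d_def)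
    have sub: "rect (x - 2 * d) (x + 2 * d) (y - 2 * d) (y + 2 * d) \<subseteq> U"
    proof
      fix p assume p: "p \<in> rect (x - 2 * d) (x + 2 * d) (y - 2 * d) (y + 2 * d)"
      have "dist (vector [x, y]) p \<le> (\<Sum>i\<in>UNIV. \<bar>(vector [x, y] - p) $ i\<bar>)"
        unfolding dist_norm by (rule norm_le_l1_cart)
      also have "\<dots> = \<bar>x - p $ 1\<bar> + \<bar>y - p $ 2\<bar>" by (simp add: sum_2)
      also have "\<dots> < r" using p by (auto simp: rect_def d_def abs_if)
      finally show "p \<in> U" using r by auto
    qed
    have "P a b" if "a \<le> x" "x \<le> b" "b - a < d" for a b
      unfolding P_def
    proof (intro exI conjI)
      have "rect (a - d) (b + d) (y - d) (y + d) \<subseteq> rect (x - 2 * d) (x + 2 * d) (y - 2 * d) (y + 2 * d)"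
        by (rule rect_subset) (use that d in auto)
      then show "developing_on g (rect (a - d) (b + d) (y - d) (y + d)) z"
        using U(2) sub open_rect unfolding developing_on_def by blast
    qed (rule d)
    then show "\<exists>d>0. \<forall>a b. a \<le> x \<and> x \<le> b \<and> b - a < d \<longrightarrow> P a b" using d by blast
  qed
  then show ?thesis unfolding P_def .
qed

lemma developing_map_rectangle:
  assumes flat: "flat_metric g" and R: "R > 0"
  shows "\<exists>f. developing_on g (rect (- R) R (- R) R) f"
proof -
  define P where "P a b \<longleftrightarrow> (\<exists>e>0. \<exists>f. developing_on g (rect (- R) R (a - e) (b + e)) f)" for a b
  have "- R \<le> R" using R by simp
  then have "P (- R) R"
  proof (rule Bolzano)
    fix a b c assume "P a b" "P b c" "a \<le> b" "b \<le> c"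
    note trans = this[unfolded P_def]
    obtain e1 f1 where 1: "e1 > 0" "developing_on g (rect (- R) R (a - e1) (b + e1)) f1" using trans(1) by blast
    obtain e2 f2 where 2: "e2 > 0" "developing_on g (rect (- R) R (b - e2) (c + e2)) f2" using trans(2) by blast
    define e where "e = min e1 e2"
    have e: "e > 0" "e \<le> e1" "e \<le> e2" using 1 2 by (auto simp: e_def)
    have d1: "developing_on g (rect (- R) R (a - e) (b + e)) f1"
      by (rule developing_on_subset[OF 1(2) open_rect rect_subset]) (use e in auto)
    have d2: "developing_on g (rect (- R) R (b - e) (c + e)) f2"
      by (rule developing_on_subset[OF 2(2) open_rect rect_subset]) (use e in auto)
    have int: "rect (- R) R (a - e) (b + e) \<inter> rect (- R) R (b - e) (c + e) = rect (- R) R (b - e) (b + e)"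
      using trans(3,4) by (auto simp: rect_def)
    have un: "rect (- R) R (a - e) (b + e) \<union> rect (- R) R (b - e) (c + e) = rect (- R) R (a - e) (c + e)"
      using trans(3,4) e by (auto simp: rect_def)
    have "\<exists>k. developing_on g (rect (- R) R (a - e) (c + e)) k"
      using developing_map_glue[OF d1 d2] unfolding int un
      using connected_rect rect_nonempty[of "- R" R "b - e" "b + e"] e R by simp
    then show "P a c" unfolding P_def using e by blast
  next
    fix y
    obtain e f where e: "e > 0" "developing_on g (rect (- R - e) (R + e) (y - e) (y + e)) f"
      using developing_map_strip[OF flat, of "- R" R y] R by auto
    have "P a b" if "a \<le> y" "y \<le> b" "b - a < e / 2" for a b
      unfolding P_def
    proof (intro exI conjI)
      show "developing_on g (rect (- R) R (a - e / 2) (b + e / 2)) f"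
        by (rule developing_on_subset[OF e(2) open_rect rect_subset]) (use that e in auto)
    qed (use e in simp)
    then show "\<exists>d>0. \<forall>a b. a \<le> y \<and> y \<le> b \<and> b - a < d \<longrightarrow> P a b"
      using e by (intro exI[of _ "e / 2"]) auto
  qed
  then obtain e f where e: "e > 0" "developing_on g (rect (- R) R (- R - e) (R + e)) f"
    unfolding P_def by blast
  have "developing_on g (rect (- R) R (- R) R) f"
    by (rule developing_on_subset[OF e(2) open_rect rect_subset]) (use e in auto)
  then show ?thesis by blast
qed

text \<open>
  Developing maps on growing squares, normalized to agree on the smallest one, agree wherever they are
  defined and so have a common extension to the plane.
\<close>

lemma developing_map_exists:
  assumes flat: "flat_metric g"
  shows "\<exists>D. developing_on g UNIV D"
proof -
  define Sq where "Sq n = rect (- real (Suc n)) (real (Suc n)) (- real (Suc n)) (real (Suc n))" for n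
  have op: "open (Sq n)" and con: "connected (Sq n)" and ne: "Sq n \<noteq> {}" for n
    unfolding Sq_def by (rule open_rect, rule connected_rect, rule rect_nonempty) simp_all
  have mono: "Sq n \<subseteq> Sq k" if "n \<le> k" for n k
    unfolding Sq_def using that by (intro rect_subset) auto
  obtain f0 where f0: "developing_on g (Sq 0) f0"
    using developing_map_rectangle[OF flat, of "real (Suc 0)"] unfolding Sq_def by force
  have "\<exists>f. developing_on g (Sq n) f \<and> (\<forall>q\<in>Sq 0. f q = f0 q)" for n
  proof -
    obtain h where h: "developing_on g (Sq n) h"
      using developing_map_rectangle[OF flat, of "real (Suc n)"] unfolding Sq_def by force
    have "developing_on g (Sq 0) h" by (rule developing_on_subset[OF h op mono]) simp
    then obtain a c where ac: "cmod a = 1" "\<And>q. q \<in> Sq 0 \<Longrightarrow> f0 q = a * h q + c"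
      using developing_map_rigidity[OF _ f0 con ne] by blast
    show ?thesis
      by (rule exI[of _ "\<lambda>p. a * h p + c"]) (simp add: developing_on_rigid_motion[OF h ac(1)] ac(2))
  qed
  then have "\<exists>F. \<forall>n. developing_on g (Sq n) (F n) \<and> (\<forall>q\<in>Sq 0. F n q = f0 q)" by (intro choice allI)
  then obtain F where F: "\<And>n. developing_on g (Sq n) (F n)" "\<And>n q. q \<in> Sq 0 \<Longrightarrow> F n q = f0 q" by blast
  have agree: "F n q = F k q" if "n \<le> k" "q \<in> Sq n" for n k q
  proof (rule developing_map_eq[OF F(1) _ con op ne])
    show "developing_on g (Sq n) (F k)" by (rule developing_on_subset[OF F(1) op mono[OF that(1)]])
    show "Sq 0 \<subseteq> Sq n" by (rule mono) simp
  qed (use that F(2) in \<open>simp_all only:\<close>)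
  have cover: "\<exists>n. q \<in> Sq n" for q
  proof -
    obtain n where n: "max \<bar>q $ 1\<bar> \<bar>q $ 2\<bar> < real n" using reals_Archimedean2 by blast
    have "- real (Suc n) < q $ 1" "q $ 1 < real (Suc n)" "- real (Suc n) < q $ 2" "q $ 2 < real (Suc n)"
      using n by linarith+
    then have "q \<in> Sq n" by (simp add: Sq_def rect_def)
    then show ?thesis by blast
  qed
  define N where "N q = (SOME n. q \<in> Sq n)" for q
  have N: "q \<in> Sq (N q)" for q unfolding N_def by (rule someI_ex[OF cover])
  define D where "D q = F (N q) q" for q
  have D: "D q = F n q" if "q \<in> Sq n" for n q
  proof (cases "n \<le> N q")
    case True
    show ?thesis unfolding D_def by (rule agree[OF True that, symmetric])
  next
    case False
    then have "N q \<le> n" by simp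
    then show ?thesis unfolding D_def by (rule agree[OF _ N])
  qed
  have dev: "developing_on g (Sq n) D" for n
    by (rule developing_on_cong[OF F(1)]) (simp add: D)
  have "developing_on g UNIV D" unfolding developing_on_def
  proof (intro conjI ballI open_UNIV)
    fix p :: "real^2"
    obtain V where "p \<in> V" "complex_coord g V D (\<lambda>_. 1)" by (rule developing_on_chart[OF dev N])
    then show "\<exists>V. p \<in> V \<and> complex_coord g V D (\<lambda>_. 1)" by blast
  qed
  then show ?thesis by blast
qed

section \<open>Holonomy and bijectivity of the developing map\<close>

lemma developing_map_open:
  assumes D: "developing_on g U D" and W: "open W" "W \<subseteq> U" shows "open (D ` W)"
proof -
  have "\<exists>T. open T \<and> y \<in> T \<and> T \<subseteq> D ` W" if "y \<in> D ` W" for y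
  proof -
    obtain p where p: "p \<in> W" "y = D p" using \<open>y \<in> D ` W\<close> by blast
    obtain V where V: "p \<in> V" "V \<subseteq> W" "complex_coord g V D (\<lambda>_. 1)"
      by (rule developing_on_chart[OF developing_on_subset[OF D W] p(1)])
    show ?thesis
      using complex_coord_open_image[OF V(3)] V p by (intro exI[of _ "D ` V"]) auto
  qed
  then show ?thesis by (subst open_subopen) blast
qed

lemma developing_map_continuous:
  assumes D: "developing_on g U D" shows "continuous_on U D"
proof (rule continuous_at_imp_continuous_on, rule ballI)
  fix p assume "p \<in> U"
  then obtain V where V: "p \<in> V" "complex_coord g V D (\<lambda>_. 1)" using D by (auto simp: developing_on_def)
  show "isCont D p"
    by (rule has_derivative_continuous[OF complex_coord_has_derivative[OF V(2,1)]])
qed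

lemma open_exceeds_modulus:
  assumes "open S" "x \<in> S" shows "\<exists>y\<in>S. cmod x < cmod y"
proof -
  obtain e where e: "e > 0" "ball x e \<subseteq> S" using assms by (meson openE)
  define u where "u = (if x = 0 then 1 else sgn x)"
  have u: "cmod u = 1" "x = of_real (cmod x) * u"
    by (simp add: u_def norm_sgn) (simp add: u_def sgn_eq)
  have "of_real (cmod x) * u + of_real (e / 2) * u = of_real (cmod x + e / 2) * u"
    by (simp only: of_real_add distrib_right)
  then have "x + of_real (e / 2) * u = of_real (cmod x + e / 2) * u" by (simp only: u(2)[symmetric])
  then have "cmod (x + of_real (e / 2) * u) = cmod x + e / 2"
    using u(1) e by (simp only: norm_mult norm_of_real) (simp add: abs_of_nonneg)
  moreover have "x + of_real (e / 2) * u \<in> S"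
    using e u(1) by (intro subsetD[OF e(2)]) (simp add: dist_norm norm_mult)
  ultimately show ?thesis using e(1) by (intro bexI[of _ "x + of_real (e / 2) * u"]) auto
qed

text \<open>
  A periodic continuous function attains its maximum, but a developing map is open and an open set of
  complex numbers contains no point of largest modulus.
\<close>

lemma developing_map_modulus_not_periodic:
  assumes D: "developing_on g UNIV D"
    and per: "\<And>p (m::real^2). \<forall>i. m $ i \<in> \<int> \<Longrightarrow> cmod (D (p + m)) = cmod (D p)"
  shows False
proof -
  have "continuous_on (cbox 0 1) (\<lambda>p. cmod (D p))"
    by (intro continuous_on_norm continuous_on_subset[OF developing_map_continuous[OF D]]) simp
  moreover have "(0 :: real^2) \<in> cbox 0 1" by (simp add: mem_box_cart)
  ultimately obtain q where q: "\<And>p. p \<in> cbox 0 1 \<Longrightarrow> cmod (D p) \<le> cmod (D q)"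
    using continuous_attains_sup[OF compact_cbox, of 0 1 "\<lambda>p. cmod (D p)"] by blast
  obtain y where "y \<in> D ` UNIV" "cmod (D q) < cmod y"
    using open_exceeds_modulus[OF developing_map_open[OF D open_UNIV subset_refl], of "D q"] by blast
  then obtain p where p: "cmod (D q) < cmod (D p)" by blast
  obtain m :: "real^2" where m: "\<forall>i. m $ i \<in> \<int>" "\<forall>i. 0 \<le> (p - m) $ i \<and> (p - m) $ i < 1"
    using fractional_part by blast
  have "cmod (D (p - m + m)) = cmod (D (p - m))" by (rule per[OF m(1)])
  moreover have "p - m \<in> cbox 0 1" using m(2) by (auto simp: mem_box_cart less_imp_le)
  ultimately show False using q[of "p - m"] p by simp
qed

lemma developing_map_holonomy:
  fixes m :: "real^2"
  assumes D: "developing_on g UNIV D" and per: "torus_periodic g" and m: "\<forall>i. m $ i \<in> \<int>"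
  obtains a c where "cmod a = 1" "\<And>p. D (p + m) = a * D p + c"
proof -
  have "developing_on g UNIV (\<lambda>p. D (p + m))"
    unfolding developing_on_def
  proof (intro conjI ballI open_UNIV)
    fix p
    obtain V where V: "p + m \<in> V" "complex_coord g V D (\<lambda>_. 1)"
      by (rule developing_on_chart[OF D UNIV_I])
    have "p = (p + m) - m" by simp
    then have "p \<in> (\<lambda>x. x - m) ` V" by (rule image_eqI[OF _ V(1)])
    then show "\<exists>V. p \<in> V \<and> complex_coord g V (\<lambda>p. D (p + m)) (\<lambda>_. 1)"
      using complex_coord_shift[OF V(2) per m] by (intro exI[of _ "(\<lambda>x. x - m) ` V"] conjI)
  qed
  then have "\<exists>a c. cmod a = 1 \<and> (\<forall>q\<in>UNIV. D (q + m) = a * D q + c)"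
    by (rule developing_map_rigidity[OF D _ connected_UNIV UNIV_not_empty])
  then obtain a c where ac: "cmod a = 1 \<and> (\<forall>q\<in>UNIV. D (q + m) = a * D q + c)"
    by (elim exE)
  show ?thesis
    by (rule that[OF conjunct1[OF ac] bspec[OF conjunct2[OF ac] UNIV_I]])
qed

text \<open>
  If some integer translation acted with a rotation part \<open>a \<noteq> 1\<close>, it would have a fixed point \<open>w\<close>. The
  holonomy is commutative, so all other holonomy motions fix \<open>w\<close> as well. Recentered at \<open>w\<close>, the developing
  map would have periodic modulus.
\<close>

lemma developing_map_translations:
  assumes D: "developing_on g UNIV D" and per: "torus_periodic g"
  shows "\<exists>b. \<forall>p (m::real^2). (\<forall>i. m $ i \<in> \<int>) \<longrightarrow> D (p + m) = D p + b m"
proof -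
  have rot: "\<exists>c. \<forall>p. D (p + m) = D p + c" if m: "\<forall>i. m $ i \<in> \<int>" for m :: "real^2"
  proof -
    obtain a c where ac: "cmod a = 1" "\<And>p. D (p + m) = a * D p + c"
      using developing_map_holonomy[OF D per m] by blast
    have "a = 1"
    proof (rule ccontr)
      assume a: "a \<noteq> 1"
      \<comment> \<open>The fixed point of the motion.\<close>
      define w where "w = c / (1 - a)"
      have w: "a * w + c = w" using a by (simp add: w_def field_simps)
      define E where "E p = 1 * D p + (- w)" for p
      have devE: "developing_on g UNIV E"
        unfolding E_def[abs_def] by (rule developing_on_rigid_motion[OF D]) simp
      have Em: "E (p + m) = a * E p" for p
        unfolding E_def ac(2) using w by (simp add: algebra_simps)
      have "cmod (E (p + n)) = cmod (E p)" if n: "\<forall>i. n $ i \<in> \<int>" for p and n :: "real^2"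
      proof -
        obtain a' c' where n': "cmod a' = 1" "\<And>p. E (p + n) = a' * E p + c'"
          using developing_map_holonomy[OF devE per n] by blast
        have "E (p + m + n) = a' * (a * E p) + c'" by (simp only: n'(2) Em)
        moreover have "E (p + n + m) = a * (a' * E p + c')" by (simp only: n'(2) Em)
        moreover have "p + m + n = p + n + m" by (simp only: add_ac)
        ultimately have "a' * (a * E p) + c' = a * (a' * E p + c')" by (simp only:)
        then have "(1 - a) * c' = 0" by (simp add: algebra_simps)
        then have "c' = 0" using a by simp
        then show ?thesis using n' by (simp add: norm_mult)
      qed
      then show False by (rule developing_map_modulus_not_periodic[OF devE])
    qed
    then show ?thesis using ac(2) by auto
  qed
  define b where "b m = (SOME c. \<forall>p. D (p + m) = D p + c)" for m
  have "\<forall>p. D (p + m) = D p + b m" if m: "\<forall>i. m $ i \<in> \<int>" for m :: "real^2"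
    unfolding b_def by (rule someI_ex[OF rot[OF m]])
  then show ?thesis by blast
qed

text \<open>
  Compactness of the torus: a property of small balls that holds locally uniformly holds with one radius
  everywhere.
\<close>

lemma uniform_radius_of_periodic:
  fixes P :: "real^2 \<Rightarrow> real \<Rightarrow> bool"
  assumes loc: "\<And>p. \<exists>e>0. \<forall>q\<in>ball p e. P q e"
    and mono: "\<And>p e e'. P p e \<Longrightarrow> 0 < e' \<Longrightarrow> e' \<le> e \<Longrightarrow> P p e'"
    and per: "\<And>p (m::real^2) e. \<forall>i. m $ i \<in> \<int> \<Longrightarrow> P p e \<Longrightarrow> P (p + m) e"
  shows "\<exists>e>0. \<forall>p. P p e"
proof -
  obtain r where r: "\<And>p. r p > 0" "\<And>p q. q \<in> ball p (r p) \<Longrightarrow> P q (r p)" using loc by metis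
  have cover: "cbox 0 1 \<subseteq> (\<Union>p\<in>cbox 0 1. ball p (r p))" using r(1) by force
  obtain F where F: "F \<subseteq> cbox 0 1" "finite F" "cbox 0 1 \<subseteq> (\<Union>p\<in>F. ball p (r p))"
    by (rule compactE_image[OF compact_cbox open_ball cover])
  define e where "e = Min (insert 1 (r ` F))"
  have e: "e > 0" "\<And>p. p \<in> F \<Longrightarrow> e \<le> r p"
    unfolding e_def using F(2) r(1) by (simp_all add: Min_gr_iff)
  have "P p e" for p
  proof -
    obtain m :: "real^2" where m: "\<forall>i. m $ i \<in> \<int>" "\<forall>i. 0 \<le> (p - m) $ i \<and> (p - m) $ i < 1"
      using fractional_part by blast
    have "p - m \<in> cbox 0 1" using m(2) by (auto simp: mem_box_cart less_imp_le)
    then obtain q where q: "q \<in> F" "p - m \<in> ball q (r q)" using F(3) by blast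
    have "P (p - m) e" by (rule mono[OF r(2)[OF q(2)] e(1) e(2)[OF q(1)]])
    then have "P (p - m + m) e" by (rule per[OF m(1)])
    then show ?thesis by simp
  qed
  then show ?thesis using e(1) by blast
qed

text \<open>
  By compactness there are uniform \<open>\<delta>\<close> and \<open>r\<close> such that \<open>D\<close> is injective on balls of radius \<open>2 \<delta>\<close> and the
  image of the ball of radius \<open>\<delta>\<close> around \<open>p\<close> contains the ball of radius \<open>r\<close> around \<open>D p\<close>. So every ball of
  radius \<open>r\<close> is evenly covered by the pieces of its preimage near the points over its center, and \<open>D\<close> is a
  covering of the plane. As the plane is simply connected, the identity lifts, and by uniqueness of lifts
  the lift is a left inverse.
\<close>

lemma developing_map_bijective:
  assumes D: "developing_on g UNIV D"
    and b: "\<And>p (m::real^2). \<forall>i. m $ i \<in> \<int> \<Longrightarrow> D (p + m) = D p + b m"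
  shows "bij D"
proof -
  have cont: "continuous_on X D" for X
    using developing_map_continuous[OF D] continuous_on_subset by blast
  have shift_ball: "ball (p + m) e = (\<lambda>x. x + m) ` ball p e" for p m :: "real^2" and e
  proof (intro equalityI subsetI)
    fix x assume "x \<in> ball (p + m) e"
    then have "x - m \<in> ball p e" by (simp add: dist_norm algebra_simps)
    then show "x \<in> (\<lambda>x. x + m) ` ball p e" by (rule rev_image_eqI) simp
  qed (auto simp: dist_norm algebra_simps)
  have "\<exists>e>0. \<forall>p. inj_on D (ball p e)"
  proof (rule uniform_radius_of_periodic)
    fix p
    obtain V where V: "p \<in> V" "complex_coord g V D (\<lambda>_. 1)"
      by (rule developing_on_chart[OF D UNIV_I])
    then obtain r where r: "r > 0" "ball p r \<subseteq> V" unfolding complex_coord_def by (meson openE)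
    have "inj_on D (ball q (r / 2))" if "q \<in> ball p (r / 2)" for q
    proof -
      have "ball q (r / 2) \<subseteq> ball p r" using that 
      proof (intro subsetI)
        fix x assume "x \<in> ball q (r / 2)"
        then show "x \<in> ball p r" using that dist_triangle[of p x q] by simp
      qed
      then show ?thesis using V(2) r(2) inj_on_subset by (metis complex_coord_def)
    qed
    then show "\<exists>e>0. \<forall>q\<in>ball p e. inj_on D (ball q e)" using r(1) by (intro exI[of _ "r / 2"]) simp
  next
    fix p :: "real^2" and e e' :: real assume "inj_on D (ball p e)" "e' \<le> e"
    then show "inj_on D (ball p e')" by (meson inj_on_subset subset_ball)
  next
    fix p m :: "real^2" and e assume m: "\<forall>i. m $ i \<in> \<int>" and inj: "inj_on D (ball p e)"
    show "inj_on D (ball (p + m) e)"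
      unfolding shift_ball using inj by (auto simp: inj_on_def b[OF m])
  qed
  then obtain \<delta> where \<delta>: "\<delta> > 0" "\<And>p. inj_on D (ball p (2 * \<delta>))"
    by (metis mult_2 field_sum_of_halves half_gt_zero)
  have "\<exists>e>0. \<forall>p. ball (D p) e \<subseteq> D ` ball p \<delta>"
  proof (rule uniform_radius_of_periodic)
    fix p
    have "open (D ` ball p (\<delta> / 2))" by (rule developing_map_open[OF D]) auto
    moreover have "D p \<in> D ` ball p (\<delta> / 2)" using \<delta>(1) by simp
    ultimately obtain r where r: "r > 0" "ball (D p) r \<subseteq> D ` ball p (\<delta> / 2)" by (meson openE)
    have "isCont D p" using cont[of UNIV] by (simp add: continuous_on_eq_continuous_at)
    then obtain s where s: "s > 0" "\<And>q. dist q p < s \<Longrightarrow> dist (D q) (D p) < r / 2"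
      using r(1) unfolding continuous_at_eps_delta by (metis half_gt_zero dist_norm)
    define e where "e = min s (min (\<delta> / 2) (r / 2))"
    have "ball (D q) e \<subseteq> D ` ball q \<delta>" if q: "q \<in> ball p e" for q
    proof -
      have qp: "dist q p < s" "dist q p < \<delta> / 2" using q by (auto simp: e_def dist_commute)
      have "ball (D q) e \<subseteq> ball (D p) r"
      proof
        fix y assume "y \<in> ball (D q) e"
        then have "dist (D q) y < r / 2" by (simp add: e_def)
        then show "y \<in> ball (D p) r" using dist_triangle[of "D p" y "D q"] s(2)[OF qp(1)] by (simp add: dist_commute)
      qed
      also have "\<dots> \<subseteq> D ` ball p (\<delta> / 2)" by (rule r(2))
      also have "\<dots> \<subseteq> D ` ball q \<delta>"
      proof (rule image_mono, rule subsetI)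
        fix x assume "x \<in> ball p (\<delta> / 2)"
        then show "x \<in> ball q \<delta>" using dist_triangle[of q x p] qp(2) by (simp add: dist_commute)
      qed
      finally show ?thesis .
    qed
    moreover have "e > 0" using s(1) \<delta>(1) r(1) by (simp add: e_def)
    ultimately show "\<exists>e>0. \<forall>q\<in>ball p e. ball (D q) e \<subseteq> D ` ball q \<delta>" by blast
  next
    fix p and e e' :: real assume "ball (D p) e \<subseteq> D ` ball p \<delta>" "e' \<le> e"
    then show "ball (D p) e' \<subseteq> D ` ball p \<delta>" by (meson subset_ball subset_trans)
  next
    fix p m :: "real^2" and e assume m: "\<forall>i. m $ i \<in> \<int>" and sub: "ball (D p) e \<subseteq> D ` ball p \<delta>"
    show "ball (D (p + m)) e \<subseteq> D ` ball (p + m) \<delta>"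
    proof
      fix y assume "y \<in> ball (D (p + m)) e"
      then have "y - b m \<in> ball (D p) e" unfolding b[OF m] by (simp add: dist_norm algebra_simps)
      then obtain x where "x \<in> ball p \<delta>" "y - b m = D x" using sub by blast
      then have "x + m \<in> ball (p + m) \<delta>" "y = D (x + m)"
        unfolding b[OF m] by (simp_all add: dist_norm algebra_simps)
      then show "y \<in> D ` ball (p + m) \<delta>" by blast
    qed
  qed
  then obtain r where r: "r > 0" "\<And>p. ball (D p) r \<subseteq> D ` ball p \<delta>" by blast
  have surj: "D ` UNIV = UNIV"
  proof -
    have "open (D ` UNIV)" by (rule developing_map_open[OF D]) auto
    moreover have "closed (D ` UNIV)"
    proof -
      have "y \<in> D ` UNIV" if y: "y \<in> closure (D ` UNIV)" for y
      proof -
        obtain p where "dist (D p) y < r" using y r(1) unfolding closure_approachable by blast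
        then have "y \<in> ball (D p) r" by simp
        then show ?thesis using r(2)[of p] by blast
      qed
      then show ?thesis by (metis closure_subset_eq subsetI)
    qed
    ultimately show ?thesis using clopen[of "D ` UNIV"] by simp
  qed
  have cov: "covering_space UNIV D UNIV"
    unfolding covering_space_def
  proof (intro conjI ballI)
    show "continuous_on UNIV D" by (rule cont)
    show "D ` UNIV = UNIV" by (rule surj)
    fix w :: complex
    \<comment> \<open>The sheet through a point \<open>p\<close> over \<open>w\<close>.\<close>
    define sheet where "sheet p = ball p \<delta> \<inter> D -` ball w r" for p
    have op: "open (sheet p)" for p
      unfolding sheet_def by (intro open_Int open_ball open_vimage cont)
    have inj: "inj_on D (sheet p)" for p
      by (rule inj_on_subset[OF \<delta>(2)[of p]]) (use \<delta>(1) in \<open>auto simp: sheet_def\<close>)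
    show "\<exists>T. w \<in> T \<and> openin (top_of_set UNIV) T \<and> (\<exists>v. \<Union> v = UNIV \<inter> D -` T \<and>
        (\<forall>u\<in>v. openin (top_of_set UNIV) u) \<and> pairwise disjnt v \<and> (\<forall>u\<in>v. \<exists>q. homeomorphism u T D q))"
    proof (intro exI conjI)
      show "w \<in> ball w r" using r(1) by simp
      show "openin (top_of_set UNIV) (ball w r)" by simp
      show "\<Union> (sheet ` {p. D p = w}) = UNIV \<inter> D -` ball w r"
      proof (intro equalityI subsetI)
        fix x assume x: "x \<in> UNIV \<inter> D -` ball w r"
        then have "w \<in> ball (D x) r" by (simp add: dist_commute)
        then obtain p where p: "p \<in> ball x \<delta>" "w = D p" using r(2)[of x] by blast
        then have "x \<in> sheet p" using x by (simp add: sheet_def dist_commute)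
        then show "x \<in> \<Union> (sheet ` {p. D p = w})" using p(2) by blast
      qed (auto simp: sheet_def)
      show "\<forall>u\<in>sheet ` {p. D p = w}. openin (top_of_set UNIV) u" using op by auto
      show "pairwise disjnt (sheet ` {p. D p = w})"
      proof (rule pairwiseI)
        fix u v assume uv: "u \<in> sheet ` {p. D p = w}" "v \<in> sheet ` {p. D p = w}" "u \<noteq> v"
        then obtain p q where pq: "u = sheet p" "D p = w" "v = sheet q" "D q = w" by blast
        show "disjnt u v"
        proof (rule ccontr)
          assume "\<not> disjnt u v"
          then obtain x where "x \<in> ball p \<delta>" "x \<in> ball q \<delta>" by (auto simp: disjnt_iff pq sheet_def)
          then have "dist p q < 2 * \<delta>" using dist_triangle[of p q x] by (simp add: dist_commute)
          then have "q \<in> ball p (2 * \<delta>)" "p \<in> ball p (2 * \<delta>)" using \<delta>(1) by simp_all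
          then have "p = q" using \<delta>(2)[of p] pq by (auto dest: inj_onD)
          then show False using uv(3) pq by simp
        qed
      qed
      show "\<forall>u\<in>sheet ` {p. D p = w}. \<exists>q. homeomorphism u (ball w r) D q"
      proof
        fix u assume "u \<in> sheet ` {p. D p = w}"
        then obtain p where p: "u = sheet p" "D p = w" by blast
        have "D ` sheet p = ball w r"
          using r(2)[of p] p(2) unfolding sheet_def by blast
        moreover obtain q where "homeomorphism (sheet p) (D ` sheet p) D q"
          by (rule invariance_of_domain_homeomorphism[OF op cont _ inj]) auto
        ultimately show "\<exists>q. homeomorphism u (ball w r) D q" using p(1) by auto
      qed
    qed
  qed
  have "inj D"
  proof (rule injI)
    fix p q assume pq: "D p = D q"
    obtain G where G: "continuous_on UNIV G" "G (D p) = p" "\<And>y. D (G y) = y"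
      by (rule covering_space_lift_strong[OF cov, of p "D p" UNIV "\<lambda>y. y"])
        (auto simp: convex_imp_simply_connected convex_imp_locally_path_connected)
    have "G (D q) = q"
    proof (rule covering_space_lift_unique[OF cov, of "\<lambda>x. G (D x)" p "\<lambda>x. x" UNIV D q])
      show "continuous_on UNIV (\<lambda>x. G (D x))" by (rule continuous_on_compose2[OF G(1) cont]) auto
    qed (use G cont in auto)
    then show "p = q" using G(2) pq by simp
  qed
  then show ?thesis using surj by (simp add: bij_def)
qed

theorem flat_torus_uniformized:
  assumes flat: "flat_metric g" and area: "torus_area g = 1"
  shows "\<exists>D b. uniformized_torus g D b"
proof -
  have per: "torus_periodic g" using flat by (simp add: flat_metric_def riemannian_metric_def)
  obtain D where D: "developing_on g UNIV D" using developing_map_exists[OF flat] by blast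
  obtain b where b: "\<And>p (m::real^2). \<forall>i. m $ i \<in> \<int> \<Longrightarrow> D (p + m) = D p + b m"
    using developing_map_translations[OF D per] by blast
  have bij: "bij D" by (rule developing_map_bijective[OF D b])
  have loc: "\<exists>V. open V \<and> p \<in> V \<and> complex_coord g V D (\<lambda>_. 1)" for p
    using D unfolding developing_on_def complex_coord_def by blast
  have "\<exists>T. open T \<and> p \<in> T \<and> smooth_on T D" for p
    using loc[of p] unfolding complex_coord_def by blast
  then have "smooth_on UNIV D" by (rule smooth_on_local)
  then have "complex_coord g UNIV D (\<lambda>_. 1)"
    using loc bij_is_inj[OF bij] unfolding complex_coord_def by blast
  then have "uniformized_torus g D b"
    using b bij area by unfold_locales (auto simp: bij_is_surj)
  then show ?thesis by blast
qed

section \<open>Thin tori violate a uniform estimate\<close>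

definition stretch :: "real \<Rightarrow> real^2 \<Rightarrow> complex" where
  "stretch t p = Complex (t * p $ 1) (p $ 2 / t)"

text \<open>
  The flat metric \<open>t\<^sup>2 dx\<^sup>2 + t\<^sup>-\<^sup>2 dy\<^sup>2\<close>. For small \<open>t\<close> the torus is thin, and long in the
  direction of \<open>y\<close>.
\<close>

definition stretched_metric :: "real \<Rightarrow> metric" where
  "stretched_metric t p v w = stretch t v \<bullet> stretch t w"

lemma linear_stretch: "linear (stretch t)"
  by (intro linearI) (auto simp: stretch_def complex_eq_iff algebra_simps add_divide_distrib)

lemma bounded_linear_stretch: "bounded_linear (stretch t)"
  using linear_stretch by (simp add: linear_conv_bounded_linear)

lemma dcoord_stretch: "dcoord (stretch t) p = stretch t"
  using frechet_derivative_at[OF bounded_linear_imp_has_derivative[OF bounded_linear_stretch]] by simp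

lemma stretch_eq_iff: "t > 0 \<Longrightarrow> stretch t v = stretch t w \<longleftrightarrow> v = w"
  by (simp add: stretch_def vec_eq_iff forall_2)

lemma complex_coord_stretch:
  assumes "t > 0" shows "complex_coord (stretched_metric t) UNIV (stretch t) (\<lambda>_. 1)"
  unfolding complex_coord_def dcoord_stretch
  using assms by (auto simp: smooth_on_bounded_linear[OF bounded_linear_stretch] inj_on_def stretch_eq_iff
      stretched_metric_def stretch_def axis_def vec_eq_iff forall_2)

lemma flat_stretched_metric:
  assumes "t > 0" shows "flat_metric (stretched_metric t)"
proof -
  have "bilinear (\<lambda>v w. stretch t v \<bullet> stretch t w)"
    unfolding bilinear_def
    by (auto intro!: linearI simp: linear_add[OF linear_stretch] linear_scale[OF linear_stretch]
        inner_add_left inner_add_right)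
  moreover have "stretch t v \<noteq> 0" if "v \<noteq> 0" for v
    using stretch_eq_iff[OF assms, of v 0] that linear_0[OF linear_stretch, of t] by simp
  ultimately have "riemannian_metric (stretched_metric t)"
    unfolding riemannian_metric_def torus_periodic_def stretched_metric_def[abs_def]
    by (auto simp: smooth_on_const inner_commute)
  then show ?thesis
    unfolding flat_metric_def using complex_coord_stretch[OF assms] by blast
qed

lemma area_stretched_metric:
  assumes "t > 0" shows "torus_area (stretched_metric t) = 1"
proof -
  have "area_density (stretched_metric t) p = 1" for p
    using assms by (simp add: area_density_def stretched_metric_def stretch_def inner_complex_def axis_def
        power2_eq_square)
  moreover have "(0 :: real^2) \<in> cbox 0 1" by (simp add: mem_box_cart)
  then have "measure lborel (cbox 0 1 :: (real^2) set) = 1"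
    by (subst content_cbox_cart) auto
  ultimately show ?thesis
    by (simp add: torus_area_def torus_integral_def set_lebesgue_integral_def)
qed

lemma uniformized_stretched_metric:
  assumes "t > 0" shows "uniformized_torus (stretched_metric t) (stretch t) (stretch t)"
proof
  show "surj (stretch t)"
  proof (rule surjI)
    show "stretch t (vector [Re w / t, Im w * t]) = w" for w
      using assms by (simp add: stretch_def complex_eq_iff)
  qed
qed (use assms complex_coord_stretch area_stretched_metric linear_add[OF linear_stretch] in auto)

text \<open>
  The function \<open>exp (2 \<pi> \<i> y)\<close> of the torus coordinate \<open>y\<close>, in terms of \<open>w = t x + \<i> y / t\<close>. The
  product form shows that it is smooth in every chart.
\<close>

definition wave :: "real \<Rightarrow> complex \<Rightarrow> complex" where
  "wave t w = exp (of_real (pi * t) * w) * cnj (exp (- of_real (pi * t) * w))"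

lemma wave_eq: "wave t w = cis (2 * pi * t * Im w)"
proof -
  have "wave t w = exp (of_real (pi * t) * w + - of_real (pi * t) * cnj w)"
    by (simp add: wave_def exp_cnj exp_add[symmetric])
  also have "of_real (pi * t) * w + - of_real (pi * t) * cnj w = \<i> * of_real (2 * pi * t * Im w)"
    by (simp add: complex_eq_iff)
  finally show ?thesis by (simp add: cis_conv_exp)
qed

lemma wave_has_derivative:
  "(wave t has_derivative (\<lambda>v. of_real (2 * pi * t * Im v) * (\<i> * wave t w))) (at w)"
proof -
  have "((\<lambda>w. cis (2 * pi * t * Im w)) has_derivative (\<lambda>v. (2 * pi * t * Im v) *\<^sub>R (\<i> * cis (2 * pi * t * Im w)))) (at w)"
    by (rule has_derivative_compose[of "\<lambda>w. 2 * pi * t * Im w" "\<lambda>v. 2 * pi * t * Im v" w UNIV cis])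
      (use cis_has_vector_derivative[of "2 * pi * t * Im w"] in
        \<open>auto intro!: derivative_eq_intros simp: has_vector_derivative_def\<close>)
  then show ?thesis by (simp add: wave_eq[abs_def] scaleR_conv_of_real)
qed

lemma d_zbar_wave: "cmod (d_zbar (wave t) w) = pi * \<bar>t\<bar>"
proof -
  have "d_zbar (wave t) w = - of_real (pi * t) * wave t w"
    by (rule d_zbar_eqI[OF wave_has_derivative]) (simp add: algebra_simps)
  then show ?thesis by (simp add: norm_mult wave_eq)
qed

lemma self_eq_minus_zero: "x = - x \<Longrightarrow> x = (0::complex)"
  by (simp add: complex_eq_iff)

text \<open>
  The wave has modulus one and mean zero, so the projection kills it, while its derivative is
  proportional to \<open>t\<close> because it oscillates only along the long direction.
\<close>

lemma wave_violates_estimate: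
  assumes t: "t > 0"
  shows "\<exists>\<Psi>\<in>quad_diffs (stretched_metric t).
    qd_L1_norm (stretched_metric t) (\<Psi> - hol_proj (stretched_metric t) \<Psi>) = 2 \<and>
    dbar_type_L1_norm (stretched_metric t) (dbar (stretched_metric t) \<Psi>) = 2 * sqrt 2 * pi * t"
proof -
  interpret uniformized_torus "stretched_metric t" "stretch t" "stretch t"
    by (rule uniformized_stretched_metric[OF t])
  have "cis (2 * pi * t * Im (w + stretch t m)) = cis (2 * pi * t * Im w)" if "\<forall>i. m $ i \<in> \<int>" for w and m :: "real^2"
  proof -
    have "m $ 2 \<in> \<int>" using that by blast
    then obtain k where k: "m $ 2 = of_int k" by (rule Ints_cases)
    have "2 * pi * t * Im (w + stretch t m) = 2 * pi * t * Im w + 2 * pi * of_int k"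
      using t k by (simp add: stretch_def distrib_left)
    moreover have "cis (2 * pi * of_int k) = 1" by (rule cis_multiple_2pi) simp
    ultimately show ?thesis by (simp only: cis_mult[symmetric] mult_1_right)
  qed
  then have per: "lattice_periodic (wave t)"
    unfolding lattice_periodic_def wave_eq by blast
  have cont: "continuous_on UNIV (wave t)"
    unfolding wave_def[abs_def] by (intro continuous_intros)
  have mem: "qd (wave t) \<in> quad_diffs (stretched_metric t)"
    unfolding wave_def[abs_def]
    by (rule qd_in_quad_diffs, intro holomorphic_intros, intro holomorphic_intros, rule per[unfolded wave_def[abs_def]])
  have "torus_integral (stretched_metric t) (\<lambda>p. wave t (stretch t p)) = 0"
  proof -
    \<comment> \<open>Translation by half a period along \<open>y\<close> changes the sign but not the integral.\<close>
    have half: "wave t (w + Complex 0 (1 / (2 * t))) = - wave t w" for w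
    proof -
      have "2 * pi * t * Im (w + Complex 0 (1 / (2 * t))) = 2 * pi * t * Im w + pi"
        using t by (simp add: distrib_left)
      then show ?thesis unfolding wave_eq by (simp only: cis_mult[symmetric] cis_pi mult_minus1_right)
    qed
    have "(LINT w:stretch t ` cell|lborel. wave t w) = (LINT w:stretch t ` cell|lborel. wave t (w + Complex 0 (1 / (2 * t))))"
      by (rule complex_integral_shift[symmetric]) (use cont per lattice_periodic_bounded[OF per cont] in \<open>simp_all add: periodic_iff\<close>)
    also have "\<dots> = - (LINT w:stretch t ` cell|lborel. wave t w)"
      unfolding half by (simp add: set_lebesgue_integral_def)
    finally have "(LINT w:stretch t ` cell|lborel. wave t w) = 0" by (rule self_eq_minus_zero)
    then show ?thesis by (simp only: complex_change_of_variables[OF cont])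
  qed
  then have "qd (wave t) - hol_proj (stretched_metric t) (qd (wave t)) = qd (wave t)"
    by (simp only: hol_proj_qd[OF cont] qd_minus_const diff_zero)
  moreover have "qd_norm (stretched_metric t) (qd (wave t)) = (\<lambda>_. 2)"
    by (simp add: fun_eq_iff qd_norm_qd wave_eq)
  moreover have "torus_integral (stretched_metric t) (\<lambda>_. r) = r" for r :: real
    using area_stretched_metric[OF t] by (simp add: torus_area_def torus_integral_def mult.commute)
  moreover have "dbar_type_norm (stretched_metric t) (dbar (stretched_metric t) (qd (wave t))) = (\<lambda>_. 2 * sqrt 2 * (pi * \<bar>t\<bar>))"
    by (rule ext) (simp only: dbar_type_norm_qd[OF differentiableI[OF wave_has_derivative]] d_zbar_wave)
  ultimately have "qd_L1_norm (stretched_metric t) (qd (wave t) - hol_proj (stretched_metric t) (qd (wave t))) = 2"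
    "dbar_type_L1_norm (stretched_metric t) (dbar (stretched_metric t) (qd (wave t))) = 2 * sqrt 2 * (pi * \<bar>t\<bar>)"
    by (simp_all only: qd_L1_norm_def dbar_type_L1_norm_def)
  then show ?thesis
    using mem t by (intro bexI[of _ "qd (wave t)"]) simp_all
qed

theorem estimate_not_uniform:
  "\<exists>g. flat_metric g \<and> torus_area g = 1 \<and>
     (\<exists>\<Psi>\<in>quad_diffs g. \<not> qd_L1_norm g (\<Psi> - hol_proj g \<Psi>) \<le> C * dbar_type_L1_norm g (dbar g \<Psi>))"
proof -
  \<comment> \<open>Chosen so that \<open>2 sqrt 2 \<pi> t = 2 / (\<bar>C\<bar> + 1)\<close>, which is below \<open>2 / C\<close> for positive \<open>C\<close>.\<close>
  define t where "t = 1 / (sqrt 2 * pi * (\<bar>C\<bar> + 1))"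
  have t: "t > 0" by (simp add: t_def)
  obtain \<Psi> where "\<Psi> \<in> quad_diffs (stretched_metric t)"
    "qd_L1_norm (stretched_metric t) (\<Psi> - hol_proj (stretched_metric t) \<Psi>) = 2"
    "dbar_type_L1_norm (stretched_metric t) (dbar (stretched_metric t) \<Psi>) = 2 * sqrt 2 * pi * t"
    using wave_violates_estimate[OF t] by blast
  moreover have "C * (2 * sqrt 2 * pi * t) < 2"
  proof -
    have "2 * sqrt 2 * pi * t = 2 / (\<bar>C\<bar> + 1)" by (simp add: t_def)
    moreover have "C * (2 / (\<bar>C\<bar> + 1)) < 2" by (simp add: field_simps)
    ultimately show ?thesis by (simp only:)
  qed
  ultimately show ?thesis
    using flat_stretched_metric[OF t] area_stretched_metric[OF t] by (metis not_le)
qed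

theorem proposition1p5:
  shows "(\<forall>g. flat_metric g \<and> torus_area g = 1 \<longrightarrow>
            (\<exists>C::real. \<forall>\<Psi>\<in>quad_diffs g.
               qd_L1_norm g (\<Psi> - hol_proj g \<Psi>) \<le> C * dbar_type_L1_norm g (dbar g \<Psi>)))
       \<and> (\<forall>C::real. \<exists>g. flat_metric g \<and> torus_area g = 1 \<and>
            (\<exists>\<Psi>\<in>quad_diffs g.
               \<not> qd_L1_norm g (\<Psi> - hol_proj g \<Psi>) \<le> C * dbar_type_L1_norm g (dbar g \<Psi>)))"
  using flat_torus_uniformized uniformized_torus.projection_estimate estimate_not_uniform by blast

end
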